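(* Let $\mathcal F\in\{A\mathrm J,B\mathrm J,A\mathrm M,B\mathrm M\}$ be any of the four families of interpolation polynomials, let $p\in\Lambda$, $\lambda,\mu\in\mathcal P_n$ and $k=|\lambda|-|\mu|$. The structure coefficient $c^\lambda_\mu(p)$ satisfies $$c^\lambda_\mu(p)=\sum_{\zeta\in\mathfrak C_{\lambda\mu}}\mathrm{wt}_p^{\mathrm{LR}}(\zeta)\prod_{i=0}^{k-1}a_{\zeta_i\zeta_{i+1}},\qquad \mathrm{wt}_p^{\mathrm{LR}}(\zeta)=\sum_{j=0}^k\frac{\prod_{0\leqslant i\leqslant k-1}\bigl(\|\overline{\zeta_i}\|-\|\overline{\zeta_{i+1}}\|\bigr)}{\prod_{0\leqslant i\leqslant k,\,i\ne j}\bigl(\|\overline{\zeta_j}\|-\|\overline{\zeta_i}\|\bigr)}\,p(\overline{\zeta_j}),$$ where $\mathfrak C_{\lambda\mu}$ is the set of saturated chains $\zeta=(\zeta_0,\dots,\zeta_k)$ from $\lambda$ to $\mu$ (an empty sum being $0$ and an empty product $1$). In particular: (1) For $p=h_\nu$, $\nu\in\mathcal P_n$, the weight $\mathrm{wt}_p^{\mathrm{LR}}(\zeta)$ equals $$\mathrm{wt}_\nu^{\mathrm{LR}}(\zeta):=\sum_{j=0}^k\frac{\prod_{0\leqslant i\leqslant k-1}(\|\overline{\zeta_i}\|-\|\overline{\zeta_{i+1}}\|)}{\prod_{0\leqslant i\leqslant k,\,i\ne j}(\|\overline{\zeta_j}\|-\|\overline{\zeta_i}\|)}\,b_{\zeta_j\nu}.$$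 (2) For the family $A\mathrm J$, $$\mathrm{wt}_p^{\mathrm{LR}}(\zeta)=\frac1{k!}\sum_{j=0}^k(-1)^{j}\binom kj p(\overline{\zeta_j}),$$ where $\binom kj$ is the usual binomial coefficient. (3) For $\mu=\mathbf 0=(0,\dots,0)$ (where $h_\mu=1$), one has the expansion of $p$ in the interpolation basis, $$p=\sum_{\lambda}c^\lambda_{\mathbf 0}(p)\,h_\lambda,$$ where each coefficient $c^\lambda_{\mathbf 0}(p)$ is given by $$c^\lambda_{\mathbf 0}(p)=\sum_{\zeta\in\mathfrak C_{\lambda\mathbf 0}}\mathrm{wt}_p^{\mathrm{LR}}(\zeta)\prod_{i=0}^{|\lambda|-1}a_{\zeta_i\zeta_{i+1}},$$ the sum being over all saturated chains $\zeta=(\zeta_0,\dots,\zeta_{|\lambda|})$ from $\lambda$ to $\mathbf 0$.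
   Context: Fix $n\geqslant1$. $\mathcal P_n=\{\lambda\in\mathbb Z^n:\lambda_1\geqslant\cdots\geqslant\lambda_n\geqslant0\}$, $|\lambda|=\lambda_1+\dots+\lambda_n$; $\lambda\supseteq\mu$ means $\lambda_i\geqslant\mu_i$ for all $i$; $\lambda\gtrdot\mu$ means $\lambda\supseteq\mu$ and $|\lambda|=|\mu|+1$. A saturated chain from $\lambda$ to $\mu$ is a sequence in $\mathcal P_n$ with $\lambda=\zeta_0\gtrdot\zeta_1\gtrdot\cdots\gtrdot\zeta_k=\mu$. The four families $\mathcal F$ have the following data (base field $\mathbb F$, ring $\Lambda$, shifting map $\mathcal P_n\to\mathbb F^n$, $\lambda\mapsto\overline\lambda$, and "norm" $\|x\|$), with indeterminate parameters: - $A\mathrm J$: $\mathbb F=\mathbb Q(\tau)$; $\Lambda=\mathbb F[x_1,\dots,x_n]^{S_n}$; $\overline\lambda_i=\lambda_i+(n-i)\tau$; $\|x\|=\sum_i x_i$. - $B\mathrm J$: $\mathbb F=\mathbb Q(\tau,\alpha)$; $\Lambda=\mathbb F[x_1^2,\dots,x_n^2]^{S_n}$; $\overline\lambda_i=\lambda_i+(n-i)\tau+\alpha$; $\|x\|=\sum_i x_i^2$. - $A\mathrm M$: $\mathbb F=\mathbb Q(q,t)$; $\Lambda=\mathbb F[x_1,\dots,x_n]^{S_n}$; $\overline\lambda_i=q^{\lambda_i}t^{n-i}$; $\|x\|=\sum_i x_i$. - $B\mathrm M$: $\mathbb F=\mathbb Q(q,t,a)$; $\Lambda=\mathbb F[x_1+x_1^{-1},\dots,x_n+x_n^{-1}]^{S_n}$;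 $\overline\lambda_i=aq^{\lambda_i}t^{n-i}$; $\|x\|=\sum_i(x_i+x_i^{-1})$. The degree of a Laurent polynomial is the maximum of $|\alpha_1|+\dots+|\alpha_n|$ over monomials $x^\alpha$ occurring in it. For $\mu\in\mathcal P_n$, the (unital) interpolation polynomial $h_\mu$ is the unique element of $\Lambda$ of degree at most $|\mu|$ (at most $2|\mu|$ when $\mathcal F=B\mathrm J$) with $h_\mu(\overline\lambda)=\delta_{\lambda\mu}$ for all $\lambda\in\mathcal P_n$ with $|\lambda|\leqslant|\mu|$ (existence and uniqueness are known). The binomial coefficients of the family are $b_{\lambda\mu}=h_\mu(\overline\lambda)\in\mathbb F$; for $\lambda\gtrdot\mu$ the adjacent binomial coefficient is $a_{\lambda\mu}=b_{\lambda\mu}$. The $h_\lambda$ form an $\mathbb F$-basis of $\Lambda$, and for $p\in\Lambda$ the structure coefficients $c^\lambda_\mu(p)\in\mathbb F$ are defined by $p\,h_\mu=\sum_\lambda c^\lambda_\mu(p)h_\lambda$. *)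

theory Defs
  imports
    "HOL-Library.Poly_Mapping"
    "HOL-Combinatorics.Permutations"
    "HOL-Computational_Algebra.Polynomial"
    "HOL-Computational_Algebra.Fraction_Field"
begin

section \<open>Partitions and saturated chains\<close>

text \<open>Partitions of length at most n are functions supported on the index set 1..n.\<close>

type_synonym partition = "nat \<Rightarrow> nat"

definition partitions :: "nat \<Rightarrow> partition set" where
  "partitions n = {lam. (\<forall>i. i \<notin> {1..n} \<longrightarrow> lam i = 0) \<and>
                        (\<forall>i j. 1 \<le> i \<and> i \<le> j \<and> j \<le> n \<longrightarrow> lam j \<le> lam i)}"

definition zero_partition :: partition where
  "zero_partition = (\<lambda>_. 0)"

definition psize :: "nat \<Rightarrow> partition \<Rightarrow> nat" where
  "psize n lam = (\<Sum>i = 1..n. lam i)"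

definition covers :: "nat \<Rightarrow> partition \<Rightarrow> partition \<Rightarrow> bool" where
  "covers n lam \<mu> \<longleftrightarrow> (\<forall>i\<in>{1..n}. \<mu> i \<le> lam i) \<and> psize n lam = psize n \<mu> + 1"

text \<open>A chain with k steps is a list of length k + 1.  If there is a chain from lam to mu, then
  its number of steps is k = psize n lam - psize n mu; otherwise the set is empty.\<close>

definition sat_chains :: "nat \<Rightarrow> partition \<Rightarrow> partition \<Rightarrow> partition list set" where
  "sat_chains n lam \<mu> = {\<zeta>. \<zeta> \<noteq> [] \<and> set \<zeta> \<subseteq> partitions n \<and> hd \<zeta> = lam \<and> last \<zeta> = \<mu> \<and>
                            (\<forall>i. Suc i < length \<zeta> \<longrightarrow> covers n (\<zeta> ! i) (\<zeta> ! Suc i))}"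

section \<open>Laurent polynomials\<close>

text \<open>Exponent vectors are finitely supported integer-valued functions; a Laurent polynomial is a
  finitely supported function from exponent vectors to coefficients, with convolution product.\<close>

type_synonym 'f laurent = "(nat \<Rightarrow>\<^sub>0 int) \<Rightarrow>\<^sub>0 'f"

definition lconst :: "'f::field \<Rightarrow> 'f laurent" where
  "lconst c = Poly_Mapping.single 0 c"

text \<open>The Laurent monomial given by the e-th power of the i-th variable.\<close>

definition var_power :: "nat \<Rightarrow> int \<Rightarrow> 'f::field laurent" where
  "var_power i e = Poly_Mapping.single (Poly_Mapping.single i e) 1"

definition laurent_eval :: "(nat \<Rightarrow> 'f::field) \<Rightarrow> 'f laurent \<Rightarrow> 'f" where
  "laurent_eval x p = (\<Sum>m\<in>Poly_Mapping.keys p. Poly_Mapping.lookup p m *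
                         (\<Prod>i\<in>Poly_Mapping.keys m. x i powi Poly_Mapping.lookup m i))"

definition monomial_degree :: "(nat \<Rightarrow>\<^sub>0 int) \<Rightarrow> nat" where
  "monomial_degree m = (\<Sum>i\<in>Poly_Mapping.keys m. nat \<bar>Poly_Mapping.lookup m i\<bar>)"

text \<open>The zero polynomial gets degree 0, so it has degree at most d for every d.\<close>

definition laurent_degree :: "'f::field laurent \<Rightarrow> nat" where
  "laurent_degree p = Max (insert 0 (monomial_degree ` Poly_Mapping.keys p))"

text \<open>Invariance under permutations of the variables with indices 1..n.\<close>

definition symmetric_laurent :: "nat \<Rightarrow> 'f::field laurent \<Rightarrow> bool" where
  "symmetric_laurent n p \<longleftrightarrow>
     (\<forall>\<pi> m. \<pi> permutes {1..n} \<longrightarrow>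
        Poly_Mapping.lookup p (Poly_Mapping.map_key \<pi> m) = Poly_Mapping.lookup p m)"

text \<open>The subalgebra generated by a set G over the coefficient field.\<close>

inductive_set generated_algebra :: "'f::field laurent set \<Rightarrow> 'f laurent set"
  for G :: "'f laurent set" where
  const: "lconst c \<in> generated_algebra G"
| gen: "g \<in> G \<Longrightarrow> g \<in> generated_algebra G"
| add: "p \<in> generated_algebra G \<Longrightarrow> r \<in> generated_algebra G \<Longrightarrow> p + r \<in> generated_algebra G"
| mult: "p \<in> generated_algebra G \<Longrightarrow> r \<in> generated_algebra G \<Longrightarrow> p * r \<in> generated_algebra G"

section \<open>The four families\<close>

text \<open>A family consists of the generators y_i whose symmetric polynomials form the ring Lambda,
  the shifting map, the contribution of one coordinate to the norm, and the factor relating the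
  degree bound of an interpolation polynomial to the size of its partition.\<close>

record (overloaded) 'f itp_family =
  fam_gen :: "nat \<Rightarrow> 'f laurent"
  fam_shift :: "nat \<Rightarrow> partition \<Rightarrow> nat \<Rightarrow> 'f"
  fam_norm1 :: "'f \<Rightarrow> 'f"
  fam_degfac :: nat

definition Lam :: "'f::field itp_family \<Rightarrow> nat \<Rightarrow> 'f laurent set" where
  "Lam F n = {p \<in> generated_algebra (fam_gen F ` {1..n}). symmetric_laurent n p}"

definition fam_norm :: "'f::field itp_family \<Rightarrow> nat \<Rightarrow> (nat \<Rightarrow> 'f) \<Rightarrow> 'f" where
  "fam_norm F n x = (\<Sum>i = 1..n. fam_norm1 F (x i))"

text \<open>The rational function fields in one, two and three indeterminates over the rationals.\<close>

type_synonym ratfun1 = "rat poly fract"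
type_synonym ratfun2 = "rat poly poly fract"
type_synonym ratfun3 = "rat poly poly poly fract"

definition AJ_tau :: ratfun1 where
  "AJ_tau = Fract [:0, 1:] 1"

definition family_AJ :: "ratfun1 itp_family" where
  "family_AJ = \<lparr> fam_gen = (\<lambda>i. var_power i 1),
                 fam_shift = (\<lambda>n lam i. of_nat (lam i) + of_nat (n - i) * AJ_tau),
                 fam_norm1 = (\<lambda>x. x),
                 fam_degfac = 1 \<rparr>"

definition BJ_tau :: ratfun2 where
  "BJ_tau = Fract [:[:0, 1:]:] 1"

definition BJ_alpha :: ratfun2 where
  "BJ_alpha = Fract [:0, 1:] 1"

definition family_BJ :: "ratfun2 itp_family" where
  "family_BJ = \<lparr> fam_gen = (\<lambda>i. var_power i 2),
                 fam_shift = (\<lambda>n lam i. of_nat (lam i) + of_nat (n - i) * BJ_tau + BJ_alpha),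
                 fam_norm1 = (\<lambda>x. x ^ 2),
                 fam_degfac = 2 \<rparr>"

definition AM_q :: ratfun2 where
  "AM_q = Fract [:[:0, 1:]:] 1"

definition AM_t :: ratfun2 where
  "AM_t = Fract [:0, 1:] 1"

definition family_AM :: "ratfun2 itp_family" where
  "family_AM = \<lparr> fam_gen = (\<lambda>i. var_power i 1),
                 fam_shift = (\<lambda>n lam i. AM_q ^ lam i * AM_t ^ (n - i)),
                 fam_norm1 = (\<lambda>x. x),
                 fam_degfac = 1 \<rparr>"

definition BM_q :: ratfun3 where
  "BM_q = Fract [:[:[:0, 1:]:]:] 1"

definition BM_t :: ratfun3 where
  "BM_t = Fract [:[:0, 1:]:] 1"

definition BM_a :: ratfun3 where
  "BM_a = Fract [:0, 1:] 1"

definition family_BM :: "ratfun3 itp_family" where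
  "family_BM = \<lparr> fam_gen = (\<lambda>i. var_power i 1 + var_power i (- 1)),
                 fam_shift = (\<lambda>n lam i. BM_a * BM_q ^ lam i * BM_t ^ (n - i)),
                 fam_norm1 = (\<lambda>x. x + inverse x),
                 fam_degfac = 1 \<rparr>"

section \<open>Interpolation polynomials, binomial and structure coefficients\<close>

definition itp_poly :: "'f::field itp_family \<Rightarrow> nat \<Rightarrow> partition \<Rightarrow> 'f laurent" where
  "itp_poly F n \<mu> = (THE h. h \<in> Lam F n \<and> laurent_degree h \<le> fam_degfac F * psize n \<mu> \<and>
     (\<forall>lam\<in>partitions n. psize n lam \<le> psize n \<mu> \<longrightarrow>
        laurent_eval (fam_shift F n lam) h = (if lam = \<mu> then 1 else 0)))"

definition binom :: "'f::field itp_family \<Rightarrow> nat \<Rightarrow> partition \<Rightarrow> partition \<Rightarrow> 'f" where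
  "binom F n lam \<mu> = laurent_eval (fam_shift F n lam) (itp_poly F n \<mu>)"

text \<open>Used only when lam covers mu.\<close>

definition adj_binom :: "'f::field itp_family \<Rightarrow> nat \<Rightarrow> partition \<Rightarrow> partition \<Rightarrow> 'f" where
  "adj_binom F n lam \<mu> = binom F n lam \<mu>"

text \<open>The coefficient of itp_poly F n lam in the expansion of p * itp_poly F n mu.\<close>

definition struct_coeff ::
  "'f::field itp_family \<Rightarrow> nat \<Rightarrow> 'f laurent \<Rightarrow> partition \<Rightarrow> partition \<Rightarrow> 'f" where
  "struct_coeff F n p lam \<mu> =
     (THE c. finite {\<nu>. c \<nu> \<noteq> 0} \<and> {\<nu>. c \<nu> \<noteq> 0} \<subseteq> partitions n \<and>
             p * itp_poly F n \<mu> = (\<Sum>\<nu> | c \<nu> \<noteq> 0. lconst (c \<nu>) * itp_poly F n \<nu>)) lam"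

section \<open>Weights of saturated chains\<close>

definition chain_norm :: "'f::field itp_family \<Rightarrow> nat \<Rightarrow> partition list \<Rightarrow> nat \<Rightarrow> 'f" where
  "chain_norm F n \<zeta> i = fam_norm F n (fam_shift F n (\<zeta> ! i))"

definition wt_LR :: "'f::field itp_family \<Rightarrow> nat \<Rightarrow> 'f laurent \<Rightarrow> partition list \<Rightarrow> 'f" where
  "wt_LR F n p \<zeta> = (let k = length \<zeta> - 1 in
     \<Sum>j = 0..k. (\<Prod>i<k. chain_norm F n \<zeta> i - chain_norm F n \<zeta> (Suc i)) /
                 (\<Prod>i\<in>{0..k} - {j}. chain_norm F n \<zeta> j - chain_norm F n \<zeta> i) *
                 laurent_eval (fam_shift F n (\<zeta> ! j)) p)"

definition wt_LR_binom :: "'f::field itp_family \<Rightarrow> nat \<Rightarrow> partition \<Rightarrow> partition list \<Rightarrow> 'f" where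
  "wt_LR_binom F n \<nu> \<zeta> = (let k = length \<zeta> - 1 in
     \<Sum>j = 0..k. (\<Prod>i<k. chain_norm F n \<zeta> i - chain_norm F n \<zeta> (Suc i)) /
                 (\<Prod>i\<in>{0..k} - {j}. chain_norm F n \<zeta> j - chain_norm F n \<zeta> i) *
                 binom F n (\<zeta> ! j) \<nu>)"

end

theory Submission
  imports "HOL-Algebra.Algebraic_Closure_Type" "Jordan_Normal_Form.Determinant" Defs
begin

text \<open>Multiplying \<open>h\<^sub>\<mu>\<close> by the norm yields \<open>\<parallel>\<mu>\<parallel> h\<^sub>\<mu>\<close> plus terms \<open>(\<parallel>\<nu>\<parallel> - \<parallel>\<mu>\<parallel>) a\<^sub>\<nu>\<^sub>\<mu> h\<^sub>\<nu>\<close> over the covers \<open>\<nu>\<close>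
  of \<open>\<mu>\<close>. Computing \<open>\<parallel>x\<parallel> p h\<^sub>\<mu>\<close> in two ways gives a recursion for \<open>c\<^sup>\<lambda>\<^sub>\<mu>(p)\<close> that removes one box from
  \<open>\<lambda>\<close> or adds one to \<open>\<mu>\<close>. The weighted chain sums satisfy the same recursion, because their weights
  are divided differences of \<open>p\<close> along the norms of the chain, and norms of partitions of different
  sizes are different.

  The ingredients are existence and uniqueness of \<open>h\<^sub>\<mu>\<close> and its vanishing at those partitions of
  size \<open>|\<mu>| + 1\<close> that do not contain \<open>\<mu>\<close>. Existence follows from symmetric polynomials that are
  triangular for the colexicographic order, uniqueness from counting coefficients at dominant
  exponents. For the vanishing, every partition \<open>\<nu>\<close> carries a linear functional supported on the
  partitions contained in \<open>\<nu>\<close>, nonzero at \<open>\<nu>\<close>, that kills symmetric polynomials of degree less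
  than \<open>|\<nu>|\<close>. It is built by induction: if the last part is 0, the last variable is specialised;
  otherwise an antisymmetrised difference operator that lowers degrees by \<open>n\<close> removes the first
  column.\<close>

section \<open>Symmetric polynomial functions\<close>

text \<open>The vanishing is the hard ingredient, and the obstacle is that the four families look
  different. What they share is a grid with symmetric half steps: moving \<open>x\<close> by half a
  unit up or down sends \<open>y\<close> to an affine function of \<open>y\<close> plus or minus the
  same quantity \<open>w\<close>, and \<open>w^2\<close> is a polynomial in \<open>y\<close>. Hence
  the difference of two opposite products of half steps is \<open>w\<close> times a polynomial in
  \<open>y\<close> of degree one less than the product. Antisymmetrising over all variables turns
  this into a loss of one degree per variable, which matches the \<open>n\<close> cells of a full
  first column. Half steps need square roots of \<open>q\<close> and \<open>t\<close>, so this part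
  works over a larger field and with functions on the grid; Laurent polynomials enter it only
  through their values. The norm has degree one, so multiplying \<open>h \<mu>\<close> by it reaches
  just the next size; this is why vanishing in that size suffices for the recursion. Norms that
  differ serve twice: they keep the denominators of the weights away from zero and allow the
  recursion to be solved.\<close>

text \<open>Polynomial functions of \<open>y\<^sub>0, \<dots>, y\<^sub>n\<^sub>-\<^sub>1\<close> of degree at most \<open>d\<close>. The bound is an integer so that
  degrees can be subtracted freely; a negative bound forces the zero function.\<close>

inductive poly_fun :: "nat \<Rightarrow> int \<Rightarrow> ((nat \<Rightarrow> 'k::comm_ring_1) \<Rightarrow> 'k) \<Rightarrow> bool" for n d where
  poly_fun_zero: "poly_fun n d (\<lambda>_. 0)"
| poly_fun_step: "poly_fun n d f \<Longrightarrow> int (\<Sum>i<n. m i) \<le> d \<Longrightarrow>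
     poly_fun n d (\<lambda>y. f y + c * (\<Prod>i<n. y i ^ m i))"

lemma poly_fun_monom:
  assumes "int (\<Sum>i<n. m i) \<le> d"
  shows "poly_fun n d (\<lambda>y. c * (\<Prod>i<n. y i ^ m i))"
  using poly_fun_step[OF poly_fun_zero assms, of c] by simp

lemma poly_fun_mono: "poly_fun n d f \<Longrightarrow> d \<le> e \<Longrightarrow> poly_fun n e f"
  by (induction rule: poly_fun.induct) (auto intro: poly_fun.intros)

lemma poly_fun_add: "poly_fun n d g \<Longrightarrow> poly_fun n d f \<Longrightarrow> poly_fun n d (\<lambda>y. f y + g y)"
proof (induction rule: poly_fun.induct)
  case (poly_fun_step g m c)
  then show ?case using poly_fun.poly_fun_step[of n d "\<lambda>y. f y + g y" m c]
    by (simp add: add.assoc)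
qed simp

lemma poly_fun_cmult: "poly_fun n d f \<Longrightarrow> poly_fun n d (\<lambda>y. c * f y)"
proof (induction rule: poly_fun.induct)
  case (poly_fun_step f m b)
  then show ?case using poly_fun.poly_fun_step[of n d "\<lambda>y. c * f y" m "c * b"]
    by (simp add: algebra_simps)
qed (simp add: poly_fun_zero)

lemma poly_fun_uminus: "poly_fun n d f \<Longrightarrow> poly_fun n d (\<lambda>y. - f y)"
  using poly_fun_cmult[of n d f "-1"] by simp

lemma poly_fun_diff: "poly_fun n d f \<Longrightarrow> poly_fun n d g \<Longrightarrow> poly_fun n d (\<lambda>y. f y - g y)"
  using poly_fun_add[of n d "\<lambda>y. - g y" f] poly_fun_uminus by auto

lemma poly_fun_mult_monom:
  assumes "poly_fun n d f" "int (\<Sum>i<n. m i) \<le> e"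
  shows "poly_fun n (d + e) (\<lambda>y. f y * (c * (\<Prod>i<n. y i ^ m i)))"
  using assms(1)
proof (induction rule: poly_fun.induct)
  case (poly_fun_step f p b)
  have "poly_fun n (d + e) (\<lambda>y. f y * (c * (\<Prod>i<n. y i ^ m i)) + (b * c) * (\<Prod>i<n. y i ^ (p i + m i)))"
    by (rule poly_fun.poly_fun_step) (use poly_fun_step assms in \<open>auto simp: sum.distrib\<close>)
  then show ?case by (simp add: algebra_simps power_add prod.distrib)
qed (simp add: poly_fun_zero)

lemma poly_fun_mult:
  assumes "poly_fun n e g" "poly_fun n d f"
  shows "poly_fun n (d + e) (\<lambda>y. f y * g y)"
  using assms(1)
proof (induction rule: poly_fun.induct)
  case (poly_fun_step g m c)
  then show ?case
    using poly_fun_add[OF poly_fun_mult_monom[OF assms(2) poly_fun_step(2)]]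
    by (simp add: distrib_left)
qed (simp add: poly_fun_zero)

lemma poly_fun_const: "0 \<le> d \<Longrightarrow> poly_fun n d (\<lambda>_. c)"
  using poly_fun_monom[where m = "\<lambda>_. 0" and c = c] by simp

lemma poly_fun_var: assumes "i < n" shows "poly_fun n 1 (\<lambda>y. (y i :: 'k::comm_ring_1))"
proof -
  have "(\<Prod>j<n. y j ^ (if j = i then 1 else 0)) = y i" for y :: "nat \<Rightarrow> 'k"
    using assms by (simp add: if_distrib prod.delta cong: if_cong)
  then show ?thesis
    using poly_fun_monom[where n = n and m = "\<lambda>j. if j = i then 1 else 0" and d = 1 and c = "1 :: 'k"] assms by (simp cong: if_cong)
qed

lemma poly_fun_sum:
  assumes "\<And>i. i \<in> A \<Longrightarrow> poly_fun n d (f i)"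
  shows "poly_fun n d (\<lambda>y. \<Sum>i\<in>A. f i y)"
  using assms by (induction A rule: infinite_finite_induct) (auto intro: poly_fun_zero poly_fun_add)

lemma poly_fun_prod:
  assumes "\<And>i. i \<in> A \<Longrightarrow> poly_fun n (d i) (f i)"
  shows "poly_fun n (\<Sum>i\<in>A. d i) (\<lambda>y. \<Prod>i\<in>A. f i y)"
  using assms
proof (induction A rule: infinite_finite_induct)
  case (insert x F)
  have "poly_fun n (d x + (\<Sum>i\<in>F. d i)) (\<lambda>y. f x y * (\<Prod>i\<in>F. f i y))"
    by (rule poly_fun_mult) (use insert in auto)
  then show ?case using insert by simp
qed (auto intro: poly_fun_const)

lemma poly_fun_neg: "poly_fun n d f \<Longrightarrow> d < 0 \<Longrightarrow> f y = 0"
  by (induction rule: poly_fun.induct) auto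

lemma poly_fun_restrict:
  assumes "poly_fun (Suc n) d f"
  shows "poly_fun n d (\<lambda>y. f (y(n := c)))"
  using assms
proof (induction rule: poly_fun.induct)
  case (poly_fun_step f m b)
  have "poly_fun n d (\<lambda>y. f (\<lambda>i. (y(n := c)) i) + (b * c ^ m n) * (\<Prod>i<n. y i ^ m i))"
    by (rule poly_fun.poly_fun_step) (use poly_fun_step in \<open>auto simp del: fun_upd_apply\<close>)
  moreover have "(\<Prod>i<Suc n. (y(n := c)) i ^ m i) = (\<Prod>i<n. y i ^ m i) * c ^ m n" for y
    by simp
  ultimately show ?case by (simp add: mult_ac)
qed (simp add: poly_fun_zero)

definition sym_fun :: "nat \<Rightarrow> ((nat \<Rightarrow> 'a) \<Rightarrow> 'b) \<Rightarrow> bool" where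
  "sym_fun n f \<longleftrightarrow> (\<forall>\<rho> y. \<rho> permutes {..<n} \<longrightarrow> f (y \<circ> \<rho>) = f y)"

lemma poly_fun_cong: "poly_fun n d f \<Longrightarrow> (\<And>i. i < n \<Longrightarrow> y i = z i) \<Longrightarrow> f y = f z"
  by (induction rule: poly_fun.induct) auto

section \<open>Remainders modulo the monic polynomial with given roots\<close>

definition node_poly :: "nat \<Rightarrow> (nat \<Rightarrow> 'k::field) \<Rightarrow> 'k poly" where
  "node_poly n y = (\<Prod>i<n. [:- y i, 1:])"

lemma degree_node_poly: "degree (node_poly n y) = n"
  unfolding node_poly_def by (subst degree_prod_eq_sum_degree) auto

lemma monic_node_poly: "lead_coeff (node_poly n y) = 1"
  unfolding node_poly_def by (simp add: lead_coeff_prod)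

lemma node_poly_nonzero [simp]: "node_poly n y \<noteq> 0"
  using monic_node_poly[of n y] by auto

lemma node_poly_permute:
  assumes "\<rho> permutes {..<n}" shows "node_poly n (y \<circ> \<rho>) = node_poly n y"
  unfolding node_poly_def using prod.permute[OF assms, of "\<lambda>i. [:- y i, 1:]"] by (simp add: o_def)

text \<open>Up to sign the coefficient is the elementary symmetric polynomial of degree
  \<open>card A - k\<close>. For \<open>k > card A\<close> the bound is negative, which correctly
  encodes that the coefficient is zero.\<close>

lemma poly_fun_coeff_prod:
  assumes "finite A" "A \<subseteq> {..<n}"
  shows "poly_fun n (int (card A) - int k) (\<lambda>y. Polynomial.coeff (\<Prod>i\<in>A. [:- y i, 1:]) k)"
  using assms
proof (induction A arbitrary: k rule: finite_induct)
  case empty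
  then show ?case by (cases k) (auto intro: poly_fun_const poly_fun_zero)
next
  case (insert x A)
  have *: "Polynomial.coeff (\<Prod>i\<in>insert x A. [:- y i, 1:]) k =
     - (y x * Polynomial.coeff (\<Prod>i\<in>A. [:- y i, 1:]) k) +
       (case k of 0 \<Rightarrow> 0 | Suc k' \<Rightarrow> Polynomial.coeff (\<Prod>i\<in>A. [:- y i, 1:]) k')" for y :: "nat \<Rightarrow> 'a"
    using insert by (cases k) auto
  have "poly_fun n (1 + (int (card A) - int k)) (\<lambda>y::nat \<Rightarrow> 'a. y x * Polynomial.coeff (\<Prod>i\<in>A. [:- y i, 1:]) k)"
    by (rule poly_fun_mult) (use insert in \<open>auto intro: poly_fun_var\<close>)
  then have 1: "poly_fun n (int (card (insert x A)) - int k)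
      (\<lambda>y::nat \<Rightarrow> 'a. - (y x * Polynomial.coeff (\<Prod>i\<in>A. [:- y i, 1:]) k))"
    using insert by (auto intro: poly_fun_uminus simp: algebra_simps)
  have 2: "poly_fun n (int (card (insert x A)) - int k)
      (\<lambda>y::nat \<Rightarrow> 'a. case k of 0 \<Rightarrow> 0 | Suc k' \<Rightarrow> Polynomial.coeff (\<Prod>i\<in>A. [:- y i, 1:]) k')"
  proof (cases k)
    case (Suc k')
    then show ?thesis using insert.IH[of k'] insert by auto
  qed (auto intro: poly_fun_zero)
  show ?case unfolding * by (rule poly_fun_add[OF 2 1])
qed

lemma poly_fun_coeff_node_poly: "poly_fun n (int n - int k) (\<lambda>y. Polynomial.coeff (node_poly n y) k)"
  unfolding node_poly_def using poly_fun_coeff_prod[of "{..<n}" n k] by simp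

text \<open>Give the polynomial variable and all \<open>y i\<close> weight 1. Then
  \<open>node_poly n y\<close> is homogeneous of weight \<open>n\<close> and monic, so one division
  step (multiply by the variable, subtract the top coefficient times the modulus) preserves the
  grading and never divides.\<close>

lemma poly_fun_coeff_mod_node_poly:
  "poly_fun n (int m - int k) (\<lambda>y. Polynomial.coeff (Polynomial.monom 1 m mod node_poly n y) k)"
proof (induction m arbitrary: k)
  case 0
  show ?case
  \<comment> \<open>For \<open>n = 0\<close> the modulus is the constant 1 and every remainder is
    0.\<close>
  proof (cases "n = 0")
    case True
    then show ?thesis by (simp add: node_poly_def poly_fun_zero)
  next
    case False
    then have "Polynomial.monom 1 0 mod node_poly n y = (Polynomial.monom 1 0 :: 'a poly)" for y
      by (intro mod_poly_less) (simp add: degree_node_poly degree_monom_eq)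
    then show ?thesis by (cases k) (auto intro: poly_fun_const poly_fun_zero)
  qed
next
  case (Suc m)
  let ?r = "\<lambda>y::nat \<Rightarrow> 'a. Polynomial.monom 1 m mod node_poly n y"
  let ?q = "\<lambda>y. pCons 0 (?r y)"
  have mod_eq: "Polynomial.monom 1 (Suc m) mod node_poly n y =
     ?q y - Polynomial.smult (Polynomial.coeff (?q y) n) (node_poly n y)" for y :: "nat \<Rightarrow> 'a"
    using monic_node_poly[of n y] by (simp add: monom_Suc mod_pCons degree_node_poly)
  have q: "poly_fun n (int (Suc m) - int k) (\<lambda>y. Polynomial.coeff (?q y) k)" for k
    using Suc[of "k - 1"] by (cases k) (auto intro: poly_fun_zero)
  have "poly_fun n (int (Suc m) - int n + (int n - int k)) (\<lambda>y. Polynomial.coeff (?q y) n * Polynomial.coeff (node_poly n y) k)"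
    by (rule poly_fun_mult[OF poly_fun_coeff_node_poly q])
  then have "poly_fun n (int (Suc m) - int k) (\<lambda>y. Polynomial.coeff (?q y) n * Polynomial.coeff (node_poly n y) k)"
    by (simp add: algebra_simps)
  from poly_fun_diff[OF q this] show ?case unfolding mod_eq by simp
qed

text \<open>An upper bound for the degree in which every negative bound forces the zero polynomial.\<close>

definition deg_le :: "'k::zero poly \<Rightarrow> int \<Rightarrow> bool" where
  "deg_le F D \<longleftrightarrow> (\<forall>e. D < int e \<longrightarrow> Polynomial.coeff F e = 0)"

lemma poly_fun_coeff_mod:
  assumes "deg_le F D"
  shows "poly_fun n (D - int k) (\<lambda>y. Polynomial.coeff (F mod node_poly n y) k)"
proof -
  have "(\<Sum>e\<in>A. Polynomial.monom (Polynomial.coeff F e) e) mod node_poly n y =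
      (\<Sum>e\<in>A. Polynomial.smult (Polynomial.coeff F e) (Polynomial.monom 1 e mod node_poly n y))" for y A
  proof (induction A rule: infinite_finite_induct)
    case (insert x A)
    have "Polynomial.monom (Polynomial.coeff F x) x mod node_poly n y = Polynomial.smult (Polynomial.coeff F x) (Polynomial.monom 1 x mod node_poly n y)"
      by (metis mod_smult_left mult.right_neutral smult_monom)
    then show ?case using insert by (simp add: poly_mod_add_left)
  qed auto
  from this[of "{..degree F}"] have *: "Polynomial.coeff (F mod node_poly n y) k =
      (\<Sum>e\<le>degree F. Polynomial.coeff F e * Polynomial.coeff (Polynomial.monom 1 e mod node_poly n y) k)" for y
    by (simp add: poly_as_sum_of_monoms coeff_sum)
  have "poly_fun n (D - int k) (\<lambda>y. Polynomial.coeff F e * Polynomial.coeff (Polynomial.monom 1 e mod node_poly n y) k)" for e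
  proof (cases "D < int e")
    case True
    then show ?thesis using assms by (simp add: deg_le_def poly_fun_zero)
  next
    case False
    then show ?thesis
      by (intro poly_fun_cmult poly_fun_mono[OF poly_fun_coeff_mod_node_poly]) auto
  qed
  then show ?thesis unfolding * by (intro poly_fun_sum)
qed

section \<open>Vandermonde determinants and division of alternants\<close>

definition vand :: "nat \<Rightarrow> (nat \<Rightarrow> 'k::field) \<Rightarrow> 'k" where
  "vand n y = det (mat n n (\<lambda>(i, j). y i ^ j))"

text \<open>A kernel vector of the Vandermonde matrix is the coefficient vector of a nonzero
  polynomial of degree less than \<open>n\<close> with \<open>n\<close> distinct roots.\<close>

lemma vand_nonzero:
  assumes "inj_on y {..<n}" shows "vand n y \<noteq> 0"
proof
  let ?A = "mat n n (\<lambda>(i, j). y i ^ j)"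
  assume "vand n y = 0"
  then obtain v where v: "v \<in> carrier_vec n" "v \<noteq> 0\<^sub>v n" "?A *\<^sub>v v = 0\<^sub>v n"
    using det_0_iff_vec_prod_zero_field[of ?A n] by (auto simp: vand_def)
  define p where "p = (\<Sum>j<n. Polynomial.monom (v $ j) j)"
  have "Polynomial.coeff p j = v $ j" if "j < n" for j
    using that by (simp add: p_def coeff_sum)
  moreover have "\<exists>j<n. v $ j \<noteq> 0"
    using v by (metis carrier_vecD eq_vecI index_zero_vec)
  ultimately have p0: "p \<noteq> 0" by auto
  have deg: "degree p < n"
    using p0 by (metis (no_types, lifting) p_def degree_monom_le degree_sum_less le_less_trans
        lessThan_iff lessThan_0 not_gr_zero sum.empty)
  have "poly p (y i) = 0" if "i < n" for i
  proof -
    have "poly p (y i) = (\<Sum>j<n. v $ j * y i ^ j)"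
      by (simp add: p_def poly_sum poly_monom)
    also have "\<dots> = (?A *\<^sub>v v) $ i"
      using that v(1) by (auto simp: scalar_prod_def atLeast0LessThan intro!: sum.cong)
    finally show ?thesis using v(3) that by simp
  qed
  then have "y ` {..<n} \<subseteq> {x. poly p x = 0}" by auto
  then have "card (y ` {..<n}) \<le> degree p"
    using card_poly_roots_bound[OF p0] poly_roots_finite[OF p0] card_mono le_trans by blast
  then show False using deg assms by (simp add: card_image)
qed

lemma vand_eq_0:
  assumes "i < n" "j < n" "i \<noteq> j" "y i = y j"
  shows "vand n y = 0"
  unfolding vand_def by (rule det_identical_rows[of _ n i j]) (use assms in \<open>auto intro!: eq_vecI\<close>)

lemma vand_altdef:
  "vand n y = (\<Sum>\<pi> | \<pi> permutes {..<n}. signof \<pi> * (\<Prod>i<n. y i ^ \<pi> i))"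
proof -
  have "vand n y = (\<Sum>\<pi> | \<pi> permutes {..<n}. signof \<pi> * (\<Prod>i<n. mat n n (\<lambda>(i, j). y i ^ j) $$ (i, \<pi> i)))"
    unfolding vand_def by (subst det_def'[of _ n]) (auto simp: atLeast0LessThan)
  also have "\<dots> = (\<Sum>\<pi> | \<pi> permutes {..<n}. signof \<pi> * (\<Prod>i<n. y i ^ \<pi> i))"
    using permutes_in_image by (fastforce intro!: sum.cong prod.cong arg_cong2[of _ _ _ _ "(*)"])
  finally show ?thesis .
qed

text \<open>Reducing \<open>F j\<close> modulo \<open>node_poly n y\<close> does not change its
  values at the nodes, so the matrix of values is the Vandermonde matrix times the matrix of
  remainder coefficients. The determinant of the latter is the quotient: it is polynomial without
  any division, remains meaningful when nodes coincide, and is symmetric because the modulus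
  is.\<close>

lemma bialternant:
  fixes F :: "nat \<Rightarrow> 'k::field poly"
  assumes "\<And>j. j < n \<Longrightarrow> deg_le (F j) (D j)"
  shows "\<exists>g. poly_fun n ((\<Sum>j<n. D j) - int (\<Sum>j<n. j)) g \<and> sym_fun n g \<and>
    (\<forall>y. (\<Sum>\<pi> | \<pi> permutes {..<n}. signof \<pi> * (\<Prod>i<n. poly (F (\<pi> i)) (y i))) = vand n y * g y)"
proof -
  let ?r = "\<lambda>y. mat n n (\<lambda>(k, j). Polynomial.coeff (F j mod node_poly n y) k)"
  define g where "g = (\<lambda>y. det (?r y))"
  have g_eq: "g y = (\<Sum>\<pi> | \<pi> permutes {..<n}. signof \<pi> * (\<Prod>k<n. Polynomial.coeff (F (\<pi> k) mod node_poly n y) k))" for y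
  proof -
    have "g y = (\<Sum>\<pi> | \<pi> permutes {..<n}. signof \<pi> * (\<Prod>k<n. ?r y $$ (k, \<pi> k)))"
      unfolding g_def by (subst det_def'[of _ n]) (auto simp: atLeast0LessThan)
    also have "\<dots> = (\<Sum>\<pi> | \<pi> permutes {..<n}. signof \<pi> * (\<Prod>k<n. Polynomial.coeff (F (\<pi> k) mod node_poly n y) k))"
      using permutes_in_image by (fastforce intro!: sum.cong prod.cong arg_cong2[of _ _ _ _ "(*)"])
    finally show ?thesis .
  qed
  have "poly_fun n ((\<Sum>j<n. D j) - int (\<Sum>j<n. j)) (\<lambda>y. \<Prod>k<n. Polynomial.coeff (F (\<pi> k) mod node_poly n y) k)"
    if "\<pi> permutes {..<n}" for \<pi>
  proof -
    have "poly_fun n (\<Sum>k<n. D (\<pi> k) - int k) (\<lambda>y. \<Prod>k<n. Polynomial.coeff (F (\<pi> k) mod node_poly n y) k)"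
      using that permutes_in_image
      by (intro poly_fun_prod poly_fun_coeff_mod assms) fastforce
    moreover have "(\<Sum>k<n. D (\<pi> k) - int k) = (\<Sum>j<n. D j) - int (\<Sum>j<n. j)"
      using sum.permute[OF that, of D] by (simp add: sum_subtractf o_def)
    ultimately show ?thesis by simp
  qed
  then have "poly_fun n ((\<Sum>j<n. D j) - int (\<Sum>j<n. j)) g"
    unfolding g_eq[abs_def] by (intro poly_fun_sum poly_fun_cmult) auto
  moreover have "sym_fun n g"
    unfolding sym_fun_def g_def by (simp add: node_poly_permute)
  moreover have "(\<Sum>\<pi> | \<pi> permutes {..<n}. signof \<pi> * (\<Prod>i<n. poly (F (\<pi> i)) (y i))) = vand n y * g y" for y
  proof -
    let ?M = "mat n n (\<lambda>(i, j). poly (F j) (y i))"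
    have "poly (F j) (y i) = (\<Sum>k<n. y i ^ k * Polynomial.coeff (F j mod node_poly n y) k)"
      if "i < n" for i j
    proof -
      have "poly (node_poly n y) (y i) = 0"
        using that by (auto simp: node_poly_def poly_prod)
      then have "poly (F j) (y i) = poly (F j mod node_poly n y) (y i)"
        by (metis add.left_neutral mult_zero_right poly_add poly_mult div_mult_mod_eq)
      also have "degree (F j mod node_poly n y) < n"
        using that degree_mod_less[of "node_poly n y" "F j"] by (auto simp: degree_node_poly)
      then have "poly (F j mod node_poly n y) (y i) = (\<Sum>k<n. Polynomial.coeff (F j mod node_poly n y) k * y i ^ k)"
        unfolding poly_altdef by (intro sum.mono_neutral_left) (auto simp: coeff_eq_0)
      finally show ?thesis by (simp add: mult.commute)
    qed
    then have "?M = mat n n (\<lambda>(i, j). y i ^ j) * ?r y"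
      by (intro eq_matI) (auto simp: scalar_prod_def atLeast0LessThan)
    then have "det ?M = vand n y * g y"
      unfolding vand_def g_def by (metis det_mult mat_carrier)
    moreover have "det ?M = (\<Sum>\<pi> | \<pi> permutes {..<n}. signof \<pi> * (\<Prod>i<n. ?M $$ (i, \<pi> i)))"
      by (subst det_def'[of _ n]) (auto simp: atLeast0LessThan)
    moreover have "\<dots> = (\<Sum>\<pi> | \<pi> permutes {..<n}. signof \<pi> * (\<Prod>i<n. poly (F (\<pi> i)) (y i)))"
      using permutes_in_image by (fastforce intro!: sum.cong prod.cong arg_cong2[of _ _ _ _ "(*)"])
    ultimately show ?thesis by simp
  qed
  ultimately show ?thesis by blast
qed

section \<open>The antisymmetrised difference operator\<close>

lemma prod_diff_expand:
  fixes a b :: "'i \<Rightarrow> 'k::comm_ring_1"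
  assumes "finite A"
  shows "(\<Prod>i\<in>A. a i - b i) =
    (\<Sum>S\<in>Pow A. (-1) ^ card (A - S) * (\<Prod>i\<in>A. if i \<in> S then a i else b i))"
proof -
  have "(\<Prod>i\<in>A. a i - b i) = (\<Prod>i\<in>A. a i + (- b i))" by simp
  also have "\<dots> = (\<Sum>S\<in>Pow A. prod a S * (\<Prod>i\<in>A - S. - b i))"
    by (rule prod_add[OF assms])
  also have "\<dots> = (\<Sum>S\<in>Pow A. (-1) ^ card (A - S) * (\<Prod>i\<in>A. if i \<in> S then a i else b i))"
  proof (rule sum.cong[OF refl])
    fix S assume S: "S \<in> Pow A"
    have "(\<Prod>i\<in>A. if i \<in> S then a i else b i) = prod a (A \<inter> S) * prod b (A \<inter> - S)"
      using prod.If_cases[OF assms, of "\<lambda>i. i \<in> S" a b] by simp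
    moreover have "A \<inter> S = S" "A \<inter> - S = A - S" using S by auto
    ultimately show "prod a S * (\<Prod>i\<in>A - S. - b i) =
        (-1) ^ card (A - S) * (\<Prod>i\<in>A. if i \<in> S then a i else b i)"
      by (simp add: prod_uminus mult_ac)
  qed
  finally show ?thesis .
qed

definition mix :: "nat set \<Rightarrow> (nat \<Rightarrow> 'a) \<Rightarrow> (nat \<Rightarrow> 'a) \<Rightarrow> nat \<Rightarrow> 'a" where
  "mix S a b i = (if i \<in> S then a i else b i)"

text \<open>Expanding the Vandermonde determinant and summing over \<open>S\<close> leaves, for each
  permutation, a product over \<open>i\<close> of differences, each of which the hypothesis turns
  into \<open>w i * poly (b k l) (V i)\<close>. What remains is a combination of alternants. In each
  of them the degrees \<open>\<theta> j + m j - 1\<close> sum to the degree of the Vandermonde plus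
  \<open>(\<Sum>i<n. m i) - n\<close>. The function \<open>g\<close> is chosen before
  \<open>P\<close>, \<open>Q\<close>, \<open>G\<close>, \<open>H\<close>, \<open>V\<close>, because
  it will be evaluated at many points.\<close>

lemma lowering_monom:
  fixes b :: "nat \<Rightarrow> nat \<Rightarrow> 'k::field poly"
  assumes deg: "\<And>k m. deg_le (b k m) (int k + int m - 1)"
  shows "\<exists>g. poly_fun n (int (\<Sum>i<n. m i) - int n) g \<and> sym_fun n g \<and>
    (\<forall>P Q G H V w. (\<forall>i<n. \<forall>k l. P i ^ k * G i ^ l - Q i ^ k * H i ^ l = w i * poly (b k l) (V i)) \<longrightarrow>
      (\<Sum>\<rho> | \<rho> permutes {..<n}. \<Sum>S\<in>Pow {..<n}. (-1) ^ card ({..<n} - S) *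
         vand n (mix S P Q) * (\<Prod>i<n. mix S G H (\<rho> i) ^ m i)) = (\<Prod>i<n. w i) * vand n V * g V)"
proof -
  let ?P = "{\<pi>. \<pi> permutes {..<n}}"
  let ?Q = "\<lambda>\<theta> g. poly_fun n (int (\<Sum>i<n. m i) - int n) g \<and> sym_fun n g \<and>
    (\<forall>y. (\<Sum>\<pi>\<in>?P. signof \<pi> * (\<Prod>i<n. poly (b (\<theta> (\<pi> i)) (m (\<pi> i))) (y i))) = vand n y * g y)"
  have "\<forall>\<theta>\<in>?P. \<exists>g. ?Q \<theta> g"
  proof
    fix \<theta> assume \<theta>: "\<theta> \<in> ?P"
    have eq: "(\<Sum>j<n. int (\<theta> j) + int (m j) - 1) - int (\<Sum>j<n. j) = int (\<Sum>i<n. m i) - int n"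
      using sum.permute[of \<theta> "{..<n}" int] \<theta> by (simp add: sum_subtractf sum.distrib o_def)
    show "\<exists>g. ?Q \<theta> g"
      using bialternant[of n "\<lambda>j. b (\<theta> j) (m j)" "\<lambda>j. int (\<theta> j) + int (m j) - 1", OF deg]
      unfolding eq .
  qed
  from bchoice[OF this] obtain g where g: "\<forall>\<theta>\<in>?P. ?Q \<theta> (g \<theta>)" by (elim exE)
  define g' where "g' = (\<lambda>y. \<Sum>\<theta>\<in>?P. signof \<theta> * g \<theta> y)"
  have pf: "poly_fun n (int (\<Sum>i<n. m i) - int n) g'"
    unfolding g'_def using g by (intro poly_fun_sum poly_fun_cmult) auto
  have sf: "sym_fun n g'"
    using g unfolding g'_def sym_fun_def by (auto intro!: sum.cong)
  have "(\<Sum>\<rho>\<in>?P. \<Sum>S\<in>Pow {..<n}. (-1) ^ card ({..<n} - S) *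
         vand n (mix S P Q) * (\<Prod>i<n. mix S G H (\<rho> i) ^ m i)) = (\<Prod>i<n. w i) * vand n V * g' V"
    if *: "\<forall>i<n. \<forall>k l. P i ^ k * G i ^ l - Q i ^ k * H i ^ l = w i * poly (b k l) (V i)"
    for P Q G H V and w :: "nat \<Rightarrow> 'k"
  proof -
    have "(\<Sum>S\<in>Pow {..<n}. (-1) ^ card ({..<n} - S) *
         vand n (mix S P Q) * (\<Prod>i<n. mix S G H i ^ m (\<rho> i)))
       = (\<Prod>i<n. w i) * (\<Sum>\<pi>\<in>?P. signof \<pi> * (\<Prod>i<n. poly (b (\<pi> i) (m (\<rho> i))) (V i)))" for \<rho>
    proof -
      have "(\<Sum>S\<in>Pow {..<n}. (-1) ^ card ({..<n} - S) *
         vand n (mix S P Q) * (\<Prod>i<n. mix S G H i ^ m (\<rho> i)))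
        = (\<Sum>S\<in>Pow {..<n}. \<Sum>\<pi>\<in>?P. signof \<pi> * ((-1) ^ card ({..<n} - S) *
             (\<Prod>i<n. mix S P Q i ^ \<pi> i * mix S G H i ^ m (\<rho> i))))"
        by (simp add: vand_altdef sum_distrib_left sum_distrib_right prod.distrib mult_ac)
      also have "\<dots> = (\<Sum>\<pi>\<in>?P. signof \<pi> * (\<Sum>S\<in>Pow {..<n}. (-1) ^ card ({..<n} - S) *
             (\<Prod>i<n. if i \<in> S then P i ^ \<pi> i * G i ^ m (\<rho> i) else Q i ^ \<pi> i * H i ^ m (\<rho> i))))"
        unfolding sum_distrib_left
        by (subst sum.swap) (auto simp: mix_def intro!: sum.cong prod.cong)
      also have "\<dots> = (\<Sum>\<pi>\<in>?P. signof \<pi> *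
             (\<Prod>i<n. P i ^ \<pi> i * G i ^ m (\<rho> i) - Q i ^ \<pi> i * H i ^ m (\<rho> i)))"
        by (subst prod_diff_expand) auto
      also have "\<dots> = (\<Sum>\<pi>\<in>?P. signof \<pi> * (\<Prod>i<n. w i * poly (b (\<pi> i) (m (\<rho> i))) (V i)))"
        using * by simp
      finally show ?thesis by (simp add: prod.distrib sum_distrib_left mult_ac)
    qed
    note inner = this
    have "(\<Sum>\<rho>\<in>?P. \<Sum>S\<in>Pow {..<n}. (-1) ^ card ({..<n} - S) *
         vand n (mix S P Q) * (\<Prod>i<n. mix S G H (\<rho> i) ^ m i))
      = (\<Sum>\<rho>\<in>?P. \<Sum>S\<in>Pow {..<n}. (-1) ^ card ({..<n} - S) *
         vand n (mix S P Q) * (\<Prod>i<n. mix S G H i ^ m (Hilbert_Choice.inv \<rho> i)))"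
    proof (intro sum.cong refl arg_cong2[of _ _ _ _ "(*)"])
      fix \<rho> S assume "\<rho> \<in> ?P"
      then have \<rho>: "\<rho> permutes {..<n}" by simp
      show "(\<Prod>i<n. mix S G H (\<rho> i) ^ m i) = (\<Prod>i<n. mix S G H i ^ m (Hilbert_Choice.inv \<rho> i))"
        using prod.permute[OF \<rho>, of "\<lambda>i. mix S G H i ^ m (Hilbert_Choice.inv \<rho> i)"]
        by (simp add: o_def permutes_inverses[OF \<rho>])
    qed
    also have "\<dots> = (\<Sum>\<rho>\<in>?P. \<Sum>S\<in>Pow {..<n}. (-1) ^ card ({..<n} - S) *
         vand n (mix S P Q) * (\<Prod>i<n. mix S G H i ^ m (\<rho> i)))"
      by (rule sum_permutations_inverse[symmetric, of "\<lambda>\<rho>. \<Sum>S\<in>Pow {..<n}. (-1) ^ card ({..<n} - S) *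
         vand n (mix S P Q) * (\<Prod>i<n. mix S G H i ^ m (\<rho> i))"])
    also have "\<dots> = (\<Prod>i<n. w i) * (\<Sum>\<rho>\<in>?P. \<Sum>\<pi>\<in>?P. signof \<pi> * (\<Prod>i<n. poly (b (\<pi> i) (m (\<rho> i))) (V i)))"
      unfolding inner by (simp add: sum_distrib_left)
    \<comment> \<open>Substituting \<open>\<theta> \<circ> \<rho>\<close> for \<open>\<pi>\<close>
      decouples the sums: for fixed \<open>\<theta>\<close> the sum over \<open>\<rho>\<close> is
      the alternant of the polynomials \<open>b (\<theta> j) (m j)\<close>.\<close>
    also have "(\<Sum>\<rho>\<in>?P. \<Sum>\<pi>\<in>?P. signof \<pi> * (\<Prod>i<n. poly (b (\<pi> i) (m (\<rho> i))) (V i)))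
       = (\<Sum>\<rho>\<in>?P. \<Sum>\<theta>\<in>?P. signof (\<theta> \<circ> \<rho>) * (\<Prod>i<n. poly (b ((\<theta> \<circ> \<rho>) i) (m (\<rho> i))) (V i)))"
      by (intro sum.cong refl sum_permutations_compose_right) simp
    also have "\<dots> = (\<Sum>\<theta>\<in>?P. signof \<theta> * (\<Sum>\<rho>\<in>?P. signof \<rho> * (\<Prod>i<n. poly (b (\<theta> (\<rho> i)) (m (\<rho> i))) (V i))))"
      unfolding sum_distrib_left
      by (subst sum.swap, intro sum.cong refl)
         (simp add: sign_compose permutation_permutes[of _] exI[of _ "{..<n}"] permutes_imp_permutation)
    also have "\<dots> = (\<Sum>\<theta>\<in>?P. signof \<theta> * (vand n V * g \<theta> V))"
      using g by (intro sum.cong) auto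
    also have "\<dots> = vand n V * g' V"
      by (simp add: g'_def sum_distrib_left mult_ac)
    finally show ?thesis by (simp add: mult_ac)
  qed
  with pf sf show ?thesis by (intro exI[of _ g']) blast
qed

text \<open>For a monomial \<open>f\<close>, expanding the Vandermonde determinants turns the left-hand side into
  a determinant with polynomial entries, which the bialternant formula divides by \<open>vand n V\<close>.\<close>

lemma lowering:
  fixes b :: "nat \<Rightarrow> nat \<Rightarrow> 'k::field_char_0 poly"
  assumes deg: "\<And>k m. deg_le (b k m) (int k + int m - 1)"
    and f: "poly_fun n d f" "sym_fun n f"
  shows "\<exists>g. poly_fun n (d - int n) g \<and> sym_fun n g \<and>
    (\<forall>P Q G H V w. (\<forall>i<n. \<forall>k l. P i ^ k * G i ^ l - Q i ^ k * H i ^ l = w i * poly (b k l) (V i)) \<longrightarrow>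
      (\<Sum>S\<in>Pow {..<n}. (-1) ^ card ({..<n} - S) * vand n (mix S P Q) * f (mix S G H)) =
      (\<Prod>i<n. w i) * vand n V * g V)"
proof -
  let ?P = "{\<pi>. \<pi> permutes {..<n}}"
  \<comment> \<open>The induction needs the sum over all permutations of the arguments, since the
    monomials that make up a symmetric \<open>f\<close> are not symmetric themselves.\<close>
  have "\<exists>g. poly_fun n (d - int n) g \<and> sym_fun n g \<and>
    (\<forall>P Q G H V w. (\<forall>i<n. \<forall>k l. P i ^ k * G i ^ l - Q i ^ k * H i ^ l = w i * poly (b k l) (V i)) \<longrightarrow>
      (\<Sum>\<rho>\<in>?P. \<Sum>S\<in>Pow {..<n}. (-1) ^ card ({..<n} - S) *
         vand n (mix S P Q) * f (\<lambda>i. mix S G H (\<rho> i))) = (\<Prod>i<n. w i) * vand n V * g V)"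
    using f(1)
  proof (induction rule: poly_fun.induct)
    case poly_fun_zero
    show ?case by (rule exI[of _ "\<lambda>_. 0"]) (auto simp: sym_fun_def poly_fun.poly_fun_zero)
  next
    case (poly_fun_step f m c)
    obtain g where g: "poly_fun n (d - int n) g" "sym_fun n g"
      "\<And>P Q G H V w. (\<forall>i<n. \<forall>k l. P i ^ k * G i ^ l - Q i ^ k * H i ^ l = w i * poly (b k l) (V i)) \<Longrightarrow>
      (\<Sum>\<rho>\<in>?P. \<Sum>S\<in>Pow {..<n}. (-1) ^ card ({..<n} - S) *
         vand n (mix S P Q) * f (\<lambda>i. mix S G H (\<rho> i))) = (\<Prod>i<n. w i) * vand n V * g V"
      using poly_fun_step.IH by blast
    obtain h where h: "poly_fun n (int (\<Sum>i<n. m i) - int n) h" "sym_fun n h"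
      "\<And>P Q G H V w. (\<forall>i<n. \<forall>k l. P i ^ k * G i ^ l - Q i ^ k * H i ^ l = w i * poly (b k l) (V i)) \<Longrightarrow>
      (\<Sum>\<rho>\<in>?P. \<Sum>S\<in>Pow {..<n}. (-1) ^ card ({..<n} - S) *
         vand n (mix S P Q) * (\<Prod>i<n. mix S G H (\<rho> i) ^ m i)) = (\<Prod>i<n. w i) * vand n V * h V"
      using lowering_monom[of b n m, OF deg] by blast
    have "poly_fun n (d - int n) (\<lambda>y. g y + c * h y)"
      using poly_fun_step.hyps g(1) h(1)
      by (intro poly_fun_add poly_fun_cmult) (auto elim: poly_fun_mono)
    moreover have "sym_fun n (\<lambda>y. g y + c * h y)"
      using g(2) h(2) by (auto simp: sym_fun_def)
    moreover have "(\<Sum>\<rho>\<in>?P. \<Sum>S\<in>Pow {..<n}. (-1) ^ card ({..<n} - S) *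
         vand n (mix S P Q) * (f (\<lambda>i. mix S G H (\<rho> i)) + c * (\<Prod>i<n. mix S G H (\<rho> i) ^ m i)))
         = (\<Prod>i<n. w i) * vand n V * (g V + c * h V)"
      if *: "\<forall>i<n. \<forall>k l. P i ^ k * G i ^ l - Q i ^ k * H i ^ l = w i * poly (b k l) (V i)"
      for P Q G H V and w :: "nat \<Rightarrow> 'k"
    proof -
      have "(\<Sum>\<rho>\<in>?P. \<Sum>S\<in>Pow {..<n}. (-1) ^ card ({..<n} - S) *
         vand n (mix S P Q) * (f (\<lambda>i. mix S G H (\<rho> i)) + c * (\<Prod>i<n. mix S G H (\<rho> i) ^ m i)))
        = (\<Sum>\<rho>\<in>?P. \<Sum>S\<in>Pow {..<n}. (-1) ^ card ({..<n} - S) *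
         vand n (mix S P Q) * f (\<lambda>i. mix S G H (\<rho> i))) + c *
         (\<Sum>\<rho>\<in>?P. \<Sum>S\<in>Pow {..<n}. (-1) ^ card ({..<n} - S) *
         vand n (mix S P Q) * (\<Prod>i<n. mix S G H (\<rho> i) ^ m i))"
        by (simp add: sum_distrib_left sum.distrib distrib_left mult_ac)
      then show ?thesis unfolding g(3)[OF *] h(3)[OF *] by (simp add: algebra_simps)
    qed
    ultimately show ?case by (intro exI[of _ "\<lambda>y. g y + c * h y"]) blast
  qed
  then obtain g where g: "poly_fun n (d - int n) g" "sym_fun n g"
    "\<And>P Q G H V w. (\<forall>i<n. \<forall>k l. P i ^ k * G i ^ l - Q i ^ k * H i ^ l = w i * poly (b k l) (V i)) \<Longrightarrow>
      (\<Sum>\<rho>\<in>?P. \<Sum>S\<in>Pow {..<n}. (-1) ^ card ({..<n} - S) *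
         vand n (mix S P Q) * f (\<lambda>i. mix S G H (\<rho> i))) = (\<Prod>i<n. w i) * vand n V * g V"
    by blast
  have cardP: "card ?P = fact n"
    by (rule card_permutations) auto
  \<comment> \<open>For symmetric \<open>f\<close> all \<open>fact n\<close> summands agree;
    characteristic 0 allows dividing by their number.\<close>
  have "(\<Sum>S\<in>Pow {..<n}. (-1) ^ card ({..<n} - S) * vand n (mix S P Q) * f (mix S G H)) =
      (\<Prod>i<n. w i) * vand n V * (1 / fact n * g V)"
    if *: "\<forall>i<n. \<forall>k l. P i ^ k * G i ^ l - Q i ^ k * H i ^ l = w i * poly (b k l) (V i)"
      for P Q G H V and w :: "nat \<Rightarrow> 'k"
  proof -
    have "(\<Sum>\<rho>\<in>?P. \<Sum>S\<in>Pow {..<n}. (-1) ^ card ({..<n} - S) *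
         vand n (mix S P Q) * f (\<lambda>i. mix S G H (\<rho> i)))
       = (\<Sum>\<rho>\<in>?P. \<Sum>S\<in>Pow {..<n}. (-1) ^ card ({..<n} - S) *
         vand n (mix S P Q) * f (mix S G H))"
      using f(2) by (intro sum.cong refl) (simp add: sym_fun_def o_def)
    also have "\<dots> = fact n * (\<Sum>S\<in>Pow {..<n}. (-1) ^ card ({..<n} - S) *
         vand n (mix S P Q) * f (mix S G H))"
      by (simp add: cardP)
    finally show ?thesis using g(3)[OF *] by (simp add: field_simps)
  qed
  moreover have "poly_fun n (d - int n) (\<lambda>y. 1 / fact n * g y)" "sym_fun n (\<lambda>y. 1 / fact n * g y)"
    using poly_fun_cmult[OF g(1), of "1 / fact n"] g(2) by (auto simp: sym_fun_def)
  ultimately show ?thesis by (intro exI[of _ "\<lambda>y. 1 / fact n * g y"]) blast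
qed


section \<open>Annihilators on perfect grids\<close>

lemma deg_le_add: "deg_le F D \<Longrightarrow> deg_le G D \<Longrightarrow> deg_le (F + G) D"
  by (simp add: deg_le_def)

lemma deg_le_mono: "deg_le F D \<Longrightarrow> D \<le> E \<Longrightarrow> deg_le F E"
  by (simp add: deg_le_def)

lemma deg_le_mult:
  fixes F G :: "'k::comm_ring_1 poly"
  assumes "deg_le F D" "deg_le G E"
  shows "deg_le (F * G) (D + E)"
  unfolding deg_le_def
proof (intro allI impI)
  fix e assume e: "D + E < int e"
  have "Polynomial.coeff F i * Polynomial.coeff G (e - i) = 0" if "i \<le> e" for i
  proof (cases "D < int i")
    case False
    then have "E < int (e - i)" using e that by auto
    then show ?thesis using assms by (simp add: deg_le_def)
  qed (use assms in \<open>simp add: deg_le_def\<close>)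
  then show "Polynomial.coeff (F * G) e = 0" by (simp add: coeff_mult)
qed

text \<open>\<open>V A B\<close> models the value of the variable \<open>y\<close> (that is \<open>x\<close>, \<open>x\<^sup>2\<close> or \<open>x + x\<^sup>-\<^sup>1\<close>) at
  \<open>x = \<alpha> + A/2 + B\<tau>/2\<close> (at \<open>x = a q\<^sup>A\<^sup>/\<^sup>2 t\<^sup>B\<^sup>/\<^sup>2\<close> in the multiplicative cases). The two half steps in
  either direction are conjugate under \<open>w \<mapsto> -w\<close>.\<close>

locale perfect_grid =
  fixes V w :: "int \<Rightarrow> int \<Rightarrow> 'k::field_char_0" and c0 c1 d0 d1 e q0 q1 q2 :: 'k
  assumes V_inj: "V A B = V A' B' \<Longrightarrow> A = A' \<and> B = B'"
    and V_up: "V (A + 1) B = c0 + c1 * V A B + w A B"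
    and V_down: "V (A - 1) B = c0 + c1 * V A B - w A B"
    and V_right: "V A (B + 1) = d0 + d1 * V A B + e * w A B"
    and V_left: "V A (B - 1) = d0 + d1 * V A B - e * w A B"
    and w_sq: "w A B * w A B = q0 + q1 * V A B + q2 * (V A B * V A B)"
begin

lemma w_nonzero: "w A B \<noteq> 0"
  using V_up[of A B] V_down[of A B] V_inj[of "A + 1" B "A - 1" B] by auto

text \<open>The pair consists of conjugate elements \<open>a + w b\<close> and
  \<open>a - w b\<close> of the quadratic extension by \<open>w\<close>. Since \<open>w^2\<close> is
  a polynomial of degree at most 2, \<open>w\<close> counts as degree 1, which explains the bound
  \<open>s - 1\<close> for \<open>b\<close>.\<close>

definition even_odd :: "(int \<Rightarrow> int \<Rightarrow> 'k) \<Rightarrow> (int \<Rightarrow> int \<Rightarrow> 'k) \<Rightarrow> nat \<Rightarrow> bool" where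
  "even_odd f g s \<longleftrightarrow> (\<exists>a b. deg_le a (int s) \<and> deg_le b (int s - 1) \<and>
     (\<forall>A B. f A B = poly a (V A B) + w A B * poly b (V A B) \<and>
            g A B = poly a (V A B) - w A B * poly b (V A B)))"

lemma even_odd_step:
  assumes "even_odd f g s" and "\<And>A B. f' A B = u0 + u1 * V A B + u * w A B"
    "\<And>A B. g' A B = u0 + u1 * V A B - u * w A B"
  shows "even_odd (\<lambda>A B. f' A B * f A B) (\<lambda>A B. g' A B * g A B) (Suc s)"
proof -
  obtain a b where ab: "deg_le a (int s)" "deg_le b (int s - 1)"
    "\<And>A B. f A B = poly a (V A B) + w A B * poly b (V A B)"
    "\<And>A B. g A B = poly a (V A B) - w A B * poly b (V A B)"
    using assms(1) unfolding even_odd_def by blast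
  let ?l = "[:u0, u1:]" and ?q = "[:q0, q1, q2:]"
  have l: "deg_le ?l 1" by (auto simp: deg_le_def coeff_pCons split: nat.splits)
  have q: "deg_le ?q 2" by (auto simp: deg_le_def coeff_pCons split: nat.splits)
  have u: "deg_le [:u:] 0" by (auto simp: deg_le_def coeff_pCons split: nat.splits)
  have 1: "deg_le (?l * a + [:u:] * (?q * b)) (int (Suc s))"
    using deg_le_mult[OF l ab(1)] deg_le_mult[OF u deg_le_mult[OF q ab(2)]]
    by (intro deg_le_add) (auto simp: algebra_simps elim: deg_le_mono)
  have 2: "deg_le (?l * b + [:u:] * a) (int (Suc s) - 1)"
    using deg_le_mult[OF l ab(2)] deg_le_mult[OF u ab(1)]
    by (intro deg_le_add) (auto elim: deg_le_mono)
  have 3: "poly ?q (V A B) = w A B * w A B" for A B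
    by (simp add: w_sq algebra_simps)
  show ?thesis unfolding even_odd_def
    by (intro exI[of _ "?l * a + [:u:] * (?q * b)"] exI[of _ "?l * b + [:u:] * a"] conjI 1 2 allI;
        simp only: poly_add poly_mult 3 ab(3,4) assms(2,3)) (simp_all add: algebra_simps)
qed

lemma even_odd_power:
  "even_odd (\<lambda>A B. V A (B + 1) ^ k * V (A + 1) B ^ m) (\<lambda>A B. V A (B - 1) ^ k * V (A - 1) B ^ m) (k + m)"
proof (induction k)
  case 0
  show ?case
  proof (induction m)
    case 0
    show ?case unfolding even_odd_def
      by (rule exI[of _ 1], rule exI[of _ 0]) (auto simp: deg_le_def)
  next
    case (Suc m)
    from even_odd_step[OF this, of "\<lambda>A B. V (A + 1) B" c0 c1 1 "\<lambda>A B. V (A - 1) B"]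
    show ?case by (simp add: V_up V_down)
  qed
next
  case (Suc k)
  from even_odd_step[OF this, of "\<lambda>A B. V A (B + 1)" d0 d1 e "\<lambda>A B. V A (B - 1)"]
  show ?case by (simp add: V_right V_left mult.assoc)
qed

text \<open>The difference of conjugates cancels the even part. This supplies the hypothesis of
  \<open>lowering\<close>, with the horizontal half steps as \<open>P\<close>, \<open>Q\<close> and
  the vertical ones as \<open>G\<close>, \<open>H\<close>.\<close>

lemma odd_part:
  obtains b where "\<And>k m. deg_le (b k m) (int k + int m - 1)"
    "\<And>k m A B. V A (B + 1) ^ k * V (A + 1) B ^ m - V A (B - 1) ^ k * V (A - 1) B ^ m
       = 2 * w A B * poly (b k m) (V A B)"
proof -
  have "\<exists>b. deg_le b (int k + int m - 1) \<and>
    (\<forall>A B. V A (B + 1) ^ k * V (A + 1) B ^ m - V A (B - 1) ^ k * V (A - 1) B ^ m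
       = 2 * w A B * poly b (V A B))" for k m
  proof -
    obtain a b where "deg_le b (int (k + m) - 1)"
     "\<And>A B. V A (B + 1) ^ k * V (A + 1) B ^ m = poly a (V A B) + w A B * poly b (V A B)"
     "\<And>A B. V A (B - 1) ^ k * V (A - 1) B ^ m = poly a (V A B) - w A B * poly b (V A B)"
      using even_odd_power[of k m] unfolding even_odd_def by blast
    then show ?thesis by (intro exI[of _ b]) (simp add: algebra_simps)
  qed
  then show ?thesis using that by metis
qed

end

section \<open>Partitions contained in a given partition\<close>

definition below :: "nat \<Rightarrow> partition \<Rightarrow> partition set" where
  "below n \<nu> = {\<kappa> \<in> partitions n. \<forall>i. \<kappa> i \<le> \<nu> i}"

lemma finite_below: "finite (below n \<nu>)"
proof (rule finite_subset)
  show "below n \<nu> \<subseteq> (\<lambda>f i. if i \<in> {1..n} then f i else 0) ` (PiE {1..n} (\<lambda>i. {..\<nu> i}))"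
  proof
    fix \<kappa> assume "\<kappa> \<in> below n \<nu>"
    then have "\<kappa> = (\<lambda>i. if i \<in> {1..n} then restrict \<kappa> {1..n} i else 0)"
      "restrict \<kappa> {1..n} \<in> PiE {1..n} (\<lambda>i. {..\<nu> i})"
      by (auto simp: below_def partitions_def)
    then show "\<kappa> \<in> (\<lambda>f i. if i \<in> {1..n} then f i else 0) ` (PiE {1..n} (\<lambda>i. {..\<nu> i}))"
      by blast
  qed
qed (auto intro: finite_PiE)

lemma partitionsI:
  assumes "\<And>i. i \<notin> {1..n} \<Longrightarrow> \<kappa> i = 0" "\<And>i. 1 \<le> i \<Longrightarrow> i < n \<Longrightarrow> \<kappa> (Suc i) \<le> \<kappa> i"
  shows "\<kappa> \<in> partitions n"
proof -
  have "\<kappa> j \<le> \<kappa> i" if "1 \<le> i" "i \<le> j" "j \<le> n" for i j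
    using that(2,3)
  proof (induction j rule: dec_induct)
    case (step j)
    then show ?case using assms(2)[of j] that(1) by auto
  qed simp
  then show ?thesis using assms(1) by (auto simp: partitions_def)
qed

text \<open>Adds one cell to each row selected by \<open>S\<close>. The rows in \<open>S\<close> are
  counted from 0, like the variables of polynomial functions; the guard \<open>1 \<le> j\<close> is
  there because \<open>0 - 1 = 0\<close> for natural numbers.\<close>

definition bump :: "nat set \<Rightarrow> partition \<Rightarrow> partition" where
  "bump S \<kappa> j = \<kappa> j + (if 1 \<le> j \<and> j - 1 \<in> S then 1 else 0)"

lemma psize_eq_0_iff: "psize n \<nu> = 0 \<longleftrightarrow> (\<forall>i\<in>{1..n}. \<nu> i = 0)"
  by (simp add: psize_def)

context perfect_grid
begin

text \<open>The variables of polynomial functions are numbered from 0, the parts of partitions from 1.\<close>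

definition node :: "int \<Rightarrow> int \<Rightarrow> nat \<Rightarrow> partition \<Rightarrow> nat \<Rightarrow> 'k" where
  "node A B n \<kappa> i = V (A + 2 * int (\<kappa> (Suc i))) (B + 2 * (int n - 1 - int i))"

text \<open>All partitions below \<open>\<nu>\<close> have last part 0, so the last variable always
  takes the value \<open>V A B\<close> and can be specialised. One variable less moves every
  remaining node by one full step in the second direction, hence \<open>B + 2\<close>.\<close>

lemma annihilator_restrict:
  assumes "\<nu> \<in> partitions (Suc n)" "\<nu> (Suc n) = 0"
    and f: "poly_fun (Suc n) d f" "sym_fun (Suc n) f"
    and l: "\<And>f'. poly_fun n d f' \<Longrightarrow> sym_fun n f' \<Longrightarrow> (\<Sum>\<kappa>\<in>below n \<nu>. l \<kappa> * f' (node A (B + 2) n \<kappa>)) = 0"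
  shows "(\<Sum>\<kappa>\<in>below (Suc n) \<nu>. l \<kappa> * f (node A B (Suc n) \<kappa>)) = 0"
proof -
  define f' where "f' = (\<lambda>y. f (y(n := V A B)))"
  have "sym_fun n f'"
    unfolding sym_fun_def f'_def
  proof (intro allI impI)
    fix \<rho> y assume \<rho>: "\<rho> permutes {..<n}"
    then have "\<rho> permutes {..<Suc n}" by (rule permutes_subset) auto
    moreover have "(y \<circ> \<rho>)(n := V A B) = y(n := V A B) \<circ> \<rho>"
      using permutes_not_in[OF \<rho>, of n] permutes_inj[OF \<rho>] by (auto simp: fun_eq_iff inj_def)
    ultimately show "f ((y \<circ> \<rho>)(n := V A B)) = f (y(n := V A B))"
      using f(2) by (simp add: sym_fun_def)
  qed
  then have "(\<Sum>\<kappa>\<in>below n \<nu>. l \<kappa> * f' (node A (B + 2) n \<kappa>)) = 0"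
    using l poly_fun_restrict[OF f(1)] unfolding f'_def by blast
  moreover have "below (Suc n) \<nu> = below n \<nu>"
  proof -
    have "\<kappa> (Suc n) = 0" if "\<forall>i. \<kappa> i \<le> \<nu> i" for \<kappa>
      using that assms(2) by (metis le_zero_eq)
    then show ?thesis
      unfolding below_def partitions_def by (auto simp: le_Suc_eq)
  qed
  moreover have "f (node A B (Suc n) \<kappa>) = f' (node A (B + 2) n \<kappa>)" if "\<kappa> \<in> below n \<nu>" for \<kappa>
    unfolding f'_def
  proof (rule poly_fun_cong[OF f(1)])
    fix i assume "i < Suc n"
    moreover have "\<kappa> (Suc n) = 0" using that by (auto simp: below_def partitions_def)
    ultimately show "node A B (Suc n) \<kappa> i = ((node A (B + 2) n \<kappa>)(n := V A B)) i"
      by (auto simp: node_def algebra_simps)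
  qed
  ultimately show ?thesis by simp
qed

text \<open>The operator of \<open>lowering\<close> replaces each variable by one of its two half steps. Its
  coefficient at \<open>bump S \<kappa>\<close> contains a Vandermonde determinant that vanishes when \<open>bump S \<kappa>\<close> is
  not a partition, so it transports annihilators from \<open>\<nu> - (1, \<dots>, 1)\<close> on the shifted grid to \<open>\<nu>\<close>.\<close>

lemma annihilator_step:
  assumes \<nu>: "\<nu> \<in> partitions n" "\<nu> n > 0" "n > 0"
    and lam: "lam = (\<lambda>i. \<nu> i - (if i \<in> {1..n} then 1 else 0))"
    and l': "l' lam \<noteq> 0"
      "\<And>f d. poly_fun n d f \<Longrightarrow> sym_fun n f \<Longrightarrow> d < int (psize n lam) \<Longrightarrow>
         (\<Sum>\<kappa>\<in>below n lam. l' \<kappa> * f (node (A + 1) B n \<kappa>)) = 0"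
  shows "\<exists>l. l \<nu> \<noteq> 0 \<and> (\<forall>f d. poly_fun n d f \<longrightarrow> sym_fun n f \<longrightarrow> d < int (psize n \<nu>) \<longrightarrow>
         (\<Sum>\<kappa>\<in>below n \<nu>. l \<kappa> * f (node A B n \<kappa>)) = 0)"
proof -
  obtain b where b: "\<And>k m. deg_le (b k m) (int k + int m - 1)"
    "\<And>k m A B. V A (B + 1) ^ k * V (A + 1) B ^ m - V A (B - 1) ^ k * V (A - 1) B ^ m
       = 2 * w A B * poly (b k m) (V A B)"
    using odd_part by blast
  have \<nu>pos: "\<nu> i \<ge> 1" if "i \<in> {1..n}" for i
    using \<nu> that by (force simp: partitions_def)
  have nu_lam: "\<nu> i = lam i + (if i \<in> {1..n} then 1 else 0)" for i
    using \<nu>pos[of i] by (auto simp: lam)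
  have size: "psize n \<nu> = psize n lam + n"
    unfolding psize_def nu_lam sum.distrib by simp
  have lam_p: "lam \<in> partitions n"
    using \<nu>(1) by (auto simp: partitions_def lam diff_le_mono)
  \<comment> \<open>The grid that starts at \<open>A + 1\<close> lies halfway between levels of the
    one that starts at \<open>A\<close>: from its node for \<open>\<kappa>\<close>, the step
    \<open>G\<close> up gives the node of a row with one more cell, the step \<open>H\<close> down
    the node of the unchanged row. The sideways steps \<open>P\<close> and \<open>Q\<close> enter
    only the Vandermonde determinants.\<close>
  define a where "a = (\<lambda>\<kappa> i. A + 1 + 2 * int (\<kappa> (Suc i)))"
  define c where "c = (\<lambda>i. B + 2 * (int n - 1 - int i))"
  define P where "P = (\<lambda>\<kappa> i. V (a \<kappa> i) (c i + 1))"
  define Q where "Q = (\<lambda>\<kappa> i. V (a \<kappa> i) (c i - 1))"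
  define G where "G = (\<lambda>\<kappa> i. V (a \<kappa> i + 1) (c i))"
  define H where "H = (\<lambda>\<kappa> i. V (a \<kappa> i - 1) (c i))"
  define W where "W = (\<lambda>\<kappa>. (\<Prod>i<n. 2 * w (a \<kappa> i) (c i)) * vand n (node (A + 1) B n \<kappa>))"
  \<comment> \<open>The coefficients of the operator in \<open>lowering\<close>, normalised by the
    factor \<open>W\<close> so that exactly the value of \<open>g\<close> at the node of
    \<open>\<kappa>\<close> remains.\<close>
  define co where "co = (\<lambda>\<kappa> S. l' \<kappa> * ((-1) ^ card ({..<n} - S) * vand n (mix S (P \<kappa>) (Q \<kappa>)) / W \<kappa>))"
  have node_eq: "node (A + 1) B n \<kappa> i = V (a \<kappa> i) (c i)" for \<kappa> i
    by (simp add: node_def a_def c_def)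
  have mix_eq: "mix S (G \<kappa>) (H \<kappa>) = node A B n (bump S \<kappa>)" for S \<kappa>
    by (rule ext) (auto simp: mix_def G_def H_def node_def a_def c_def bump_def algebra_simps)
  have W0: "W \<kappa> \<noteq> 0" for \<kappa>
    unfolding W_def using w_nonzero
    by (auto intro!: vand_nonzero inj_onI simp: node_eq c_def dest!: V_inj)
  have co0: "co lam {..<n} \<noteq> 0"
    unfolding co_def using l'(1) W0
    by (auto intro!: vand_nonzero inj_onI simp: mix_def P_def c_def dest!: V_inj)
  have bump_below: "bump S \<kappa> \<in> below n \<nu>"
    if \<kappa>: "\<kappa> \<in> below n lam" and S: "S \<subseteq> {..<n}" and nz: "co \<kappa> S \<noteq> 0" for \<kappa> S
  proof -
    have "bump S \<kappa> i \<le> \<nu> i" for i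
    proof -
      have "\<kappa> i \<le> lam i" using \<kappa> by (simp add: below_def)
      moreover have "i \<in> {1..n}" if "1 \<le> i" "i - 1 \<in> S"
        using that S by (cases i) auto
      ultimately show ?thesis unfolding bump_def nu_lam by auto
    qed
    moreover have "bump S \<kappa> \<in> partitions n"
    proof (rule partitionsI)
      fix i assume "i \<notin> {1..n}"
      moreover have "\<nu> i = 0" using \<nu>(1) \<open>i \<notin> {1..n}\<close> unfolding partitions_def by blast
      ultimately show "bump S \<kappa> i = 0" using \<open>bump S \<kappa> i \<le> \<nu> i\<close> by simp
    next
      fix i assume i: "1 \<le> i" "i < n"
      show "bump S \<kappa> (Suc i) \<le> bump S \<kappa> i"
      proof (rule ccontr)
        assume *: "\<not> ?thesis"
        have "\<kappa> (Suc i) \<le> \<kappa> i" using \<kappa> i by (auto simp: below_def partitions_def)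
        with * have eq: "\<kappa> (Suc i) = \<kappa> i" "i \<in> S" "i - 1 \<notin> S"
          using i by (auto simp: bump_def split: if_splits)
        \<comment> \<open>Adding a cell only to the lower of two equal rows makes two Vandermonde
          nodes coincide: \<open>c (i - 1) - 1 = c i + 1\<close>.\<close>
        then have "mix S (P \<kappa>) (Q \<kappa>) (i - 1) = mix S (P \<kappa>) (Q \<kappa>) i"
          using i by (simp add: mix_def P_def Q_def a_def c_def algebra_simps of_nat_diff)
        then have "vand n (mix S (P \<kappa>) (Q \<kappa>)) = 0"
          using i by (intro vand_eq_0[of "i - 1" n i]) auto
        then show False using nz by (simp add: co_def)
      qed
    qed
    ultimately show ?thesis by (simp add: below_def)
  qed
  define l where "l = (\<lambda>\<mu>. \<Sum>\<kappa>\<in>below n lam. \<Sum>S\<in>Pow {..<n}. if bump S \<kappa> = \<mu> then co \<kappa> S else 0)"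
  \<comment> \<open>Only the largest \<open>\<kappa>\<close> with a cell added in every row gives
    \<open>\<nu>\<close>, so nothing can cancel the nonzero coefficient
    \<open>co lam {..<n}\<close>.\<close>
  have "l \<nu> = (\<Sum>\<kappa>\<in>below n lam. \<Sum>S\<in>Pow {..<n}. if \<kappa> = lam \<and> S = {..<n} then co \<kappa> S else 0)"
    unfolding l_def
  proof (intro sum.cong refl if_cong)
    fix \<kappa> S assume \<kappa>: "\<kappa> \<in> below n lam" and S: "S \<in> Pow {..<n}"
    show "(bump S \<kappa> = \<nu>) = (\<kappa> = lam \<and> S = {..<n})"
    proof
      assume *: "bump S \<kappa> = \<nu>"
      have le: "\<kappa> j \<le> lam j" for j using \<kappa> by (simp add: below_def)
      have eq: "\<kappa> j + (if 1 \<le> j \<and> j - 1 \<in> S then 1 else 0) = lam j + (if j \<in> {1..n} then 1 else 0)" for j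
        using fun_cong[OF *, of j] unfolding bump_def nu_lam .
      have "i \<in> S" if "i < n" for i
        using le[of "Suc i"] eq[of "Suc i"] that by (auto split: if_splits)
      then have "S = {..<n}" using S by auto
      moreover have "\<kappa> j = lam j" for j
        using le[of j] eq[of j] \<open>S = {..<n}\<close> by (cases j) (auto split: if_splits)
      ultimately show "\<kappa> = lam \<and> S = {..<n}" by blast
    next
      assume "\<kappa> = lam \<and> S = {..<n}"
      then show "bump S \<kappa> = \<nu>" by (auto simp: fun_eq_iff bump_def nu_lam)
    qed
  qed
  also have "\<dots> = (\<Sum>\<kappa>\<in>below n lam. if \<kappa> = lam then co \<kappa> {..<n} else 0)"
    by (intro sum.cong refl) (auto simp: sum.delta)
  also have "\<dots> = co lam {..<n}"
    using lam_p by (simp add: sum.delta finite_below) (simp add: below_def)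
  finally have "l \<nu> \<noteq> 0" using co0 by simp
  moreover have "(\<Sum>\<kappa>\<in>below n \<nu>. l \<kappa> * f (node A B n \<kappa>)) = 0"
    if f: "poly_fun n d f" "sym_fun n f" and d: "d < int (psize n \<nu>)" for f d
  proof -
    obtain g where g: "poly_fun n (d - int n) g" "sym_fun n g"
      "\<And>P Q G H V' w. (\<forall>i<n. \<forall>k l. P i ^ k * G i ^ l - Q i ^ k * H i ^ l = w i * poly (b k l) (V' i)) \<Longrightarrow>
      (\<Sum>S\<in>Pow {..<n}. (-1) ^ card ({..<n} - S) * vand n (mix S P Q) * f (mix S G H)) =
      (\<Prod>i<n. w i) * vand n V' * g V'"
      using lowering[OF b(1) f] by blast
    have "(\<Sum>\<mu>\<in>below n \<nu>. l \<mu> * f (node A B n \<mu>)) =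
       (\<Sum>\<mu>\<in>below n \<nu>. \<Sum>\<kappa>\<in>below n lam. \<Sum>S\<in>Pow {..<n}.
           if bump S \<kappa> = \<mu> then co \<kappa> S * f (node A B n \<mu>) else 0)"
      unfolding l_def sum_distrib_right by (intro sum.cong refl) auto
    also have "\<dots> = (\<Sum>\<kappa>\<in>below n lam. \<Sum>S\<in>Pow {..<n}. \<Sum>\<mu>\<in>below n \<nu>.
           if bump S \<kappa> = \<mu> then co \<kappa> S * f (node A B n \<mu>) else 0)"
      by (subst sum.swap, intro sum.cong refl, subst sum.swap, rule refl)
    also have "\<dots> = (\<Sum>\<kappa>\<in>below n lam. \<Sum>S\<in>Pow {..<n}. co \<kappa> S * f (mix S (G \<kappa>) (H \<kappa>)))"
    proof (intro sum.cong refl)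
      fix \<kappa> S assume \<kappa>: "\<kappa> \<in> below n lam" and S: "S \<in> Pow {..<n}"
      show "(\<Sum>\<mu>\<in>below n \<nu>. if bump S \<kappa> = \<mu> then co \<kappa> S * f (node A B n \<mu>) else 0) =
        co \<kappa> S * f (mix S (G \<kappa>) (H \<kappa>))"
        using bump_below[OF \<kappa>, of S] S
        by (cases "co \<kappa> S = 0") (auto simp: sum.delta' finite_below mix_eq)
    qed
    also have "\<dots> = (\<Sum>\<kappa>\<in>below n lam. l' \<kappa> * g (node (A + 1) B n \<kappa>))"
    proof (intro sum.cong refl)
      fix \<kappa>
      have "(\<Sum>S\<in>Pow {..<n}. (-1) ^ card ({..<n} - S) * vand n (mix S (P \<kappa>) (Q \<kappa>)) * f (mix S (G \<kappa>) (H \<kappa>))) =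
        (\<Prod>i<n. 2 * w (a \<kappa> i) (c i)) * vand n (node (A + 1) B n \<kappa>) * g (node (A + 1) B n \<kappa>)"
        by (rule g(3)) (simp add: P_def Q_def G_def H_def node_eq b(2))
      then have "(\<Sum>S\<in>Pow {..<n}. (-1) ^ card ({..<n} - S) * vand n (mix S (P \<kappa>) (Q \<kappa>)) * f (mix S (G \<kappa>) (H \<kappa>))) / W \<kappa> =
        g (node (A + 1) B n \<kappa>)"
        using W0[of \<kappa>] by (simp add: W_def)
      moreover have "(\<Sum>S\<in>Pow {..<n}. co \<kappa> S * f (mix S (G \<kappa>) (H \<kappa>))) = l' \<kappa> * ((\<Sum>S\<in>Pow {..<n}. (-1) ^ card ({..<n} - S) * vand n (mix S (P \<kappa>) (Q \<kappa>)) * f (mix S (G \<kappa>) (H \<kappa>))) / W \<kappa>)"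
        by (simp add: co_def sum_distrib_left sum_divide_distrib mult_ac)
      ultimately show "(\<Sum>S\<in>Pow {..<n}. co \<kappa> S * f (mix S (G \<kappa>) (H \<kappa>))) = l' \<kappa> * g (node (A + 1) B n \<kappa>)"
        by simp
    qed
    also have "\<dots> = 0"
      using l'(2)[OF g(1,2)] d size by simp
    finally show ?thesis .
  qed
  ultimately show ?thesis by blast
qed

text \<open>The measure \<open>psize n \<nu> + n\<close> covers both reductions: specialising the
  last variable lowers \<open>n\<close>, removing the first column lowers the size. \<open>A\<close>
  and \<open>B\<close> are generalised because each reduction moves the origin of the grid.\<close>

lemma annihilator:
  assumes "\<nu> \<in> partitions n"
  shows "\<exists>l. l \<nu> \<noteq> 0 \<and> (\<forall>f d. poly_fun n d f \<longrightarrow> sym_fun n f \<longrightarrow> d < int (psize n \<nu>) \<longrightarrow>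
         (\<Sum>\<kappa>\<in>below n \<nu>. l \<kappa> * f (node A B n \<kappa>)) = 0)"
  using assms
proof (induction "psize n \<nu> + n" arbitrary: n \<nu> A B rule: less_induct)
  case less
  consider "psize n \<nu> = 0" | n' where "n = Suc n'" "\<nu> n = 0" | "n > 0" "\<nu> n > 0"
    by (cases n) (auto simp: psize_def)
  then show ?case
  proof cases
    case 1
    \<comment> \<open>The degree bound is negative, so every admissible \<open>f\<close> is the zero
      function.\<close>
    then show ?thesis by (intro exI[of _ "\<lambda>_. 1"]) (auto simp: poly_fun_neg)
  next
    case 2
    have "\<nu> \<in> partitions n'"
      using less.prems 2 by (intro partitionsI) (auto simp: partitions_def le_Suc_eq)
    moreover have size: "psize n \<nu> = psize n' \<nu>" using 2 by (simp add: psize_def)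
    ultimately obtain l where l: "l \<nu> \<noteq> 0"
      "\<And>f d. poly_fun n' d f \<Longrightarrow> sym_fun n' f \<Longrightarrow> d < int (psize n' \<nu>) \<Longrightarrow>
         (\<Sum>\<kappa>\<in>below n' \<nu>. l \<kappa> * f (node A (B + 2) n' \<kappa>)) = 0"
      using less.hyps[of n' \<nu> A "B + 2"] 2 by auto
    show ?thesis
    proof (intro exI[of _ l] conjI allI impI l(1))
      fix f :: "(nat \<Rightarrow> 'k) \<Rightarrow> 'k" and d assume "poly_fun n d f" "sym_fun n f" "d < int (psize n \<nu>)"
      then show "(\<Sum>\<kappa>\<in>below n \<nu>. l \<kappa> * f (node A B n \<kappa>)) = 0"
        using 2 less.prems l(2) size by (auto intro!: annihilator_restrict)
    qed
  next
    case 3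
    define lam where "lam = (\<lambda>i. \<nu> i - (if i \<in> {1..n} then 1 else 0))"
    have "lam \<in> partitions n"
      using less.prems by (auto simp: partitions_def lam_def diff_le_mono)
    moreover have "psize n lam < psize n \<nu>"
      unfolding psize_def by (rule sum_strict_mono_ex1) (use 3 in \<open>auto simp: lam_def intro!: bexI[of _ n]\<close>)
    ultimately obtain l' where "l' lam \<noteq> 0"
      "\<And>f d. poly_fun n d f \<Longrightarrow> sym_fun n f \<Longrightarrow> d < int (psize n lam) \<Longrightarrow>
         (\<Sum>\<kappa>\<in>below n lam. l' \<kappa> * f (node (A + 1) B n \<kappa>)) = 0"
      using less.hyps[of n lam "A + 1" B] by auto
    then show ?thesis using annihilator_step[OF less.prems 3(2,1) lam_def] by blast
  qed
qed

end

section \<open>Laurent polynomials\<close>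

lemma sum_single_keys:
  assumes "finite S" "Poly_Mapping.keys p \<subseteq> S"
  shows "p = (\<Sum>m\<in>S. Poly_Mapping.single m (Poly_Mapping.lookup p m))"
proof (rule poly_mapping_eqI)
  fix k
  show "Poly_Mapping.lookup p k =
    Poly_Mapping.lookup (\<Sum>m\<in>S. Poly_Mapping.single m (Poly_Mapping.lookup p m)) k"
    using assms by (auto simp: lookup_sum lookup_single when_def sum.delta in_keys_iff)
qed

definition mono_eval :: "(nat \<Rightarrow> 'f::field) \<Rightarrow> (nat \<Rightarrow>\<^sub>0 int) \<Rightarrow> 'f" where
  "mono_eval x m = (\<Prod>i\<in>Poly_Mapping.keys m. x i powi Poly_Mapping.lookup m i)"

lemma mono_eval_superset:
  assumes "finite S" "Poly_Mapping.keys m \<subseteq> S"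
  shows "mono_eval x m = (\<Prod>i\<in>S. x i powi Poly_Mapping.lookup m i)"
  unfolding mono_eval_def
  by (rule prod.mono_neutral_left) (use assms in \<open>auto simp: in_keys_iff\<close>)

lemma mono_eval_0 [simp]: "mono_eval x 0 = 1"
  by (simp add: mono_eval_def)

lemma mono_eval_single: "mono_eval x (Poly_Mapping.single i e) = x i powi e"
  by (auto simp: mono_eval_def)

text \<open>At a zero coordinate \<open>powi\<close> is not additive for exponents of opposite
  signs. Such coordinates do occur, for instance the last one in the family AJ when
  \<open>lam n = 0\<close>; nonnegative exponents are harmless there.\<close>

lemma mono_eval_add:
  assumes "\<And>i. x i \<noteq> 0 \<or> (0 \<le> Poly_Mapping.lookup a i \<and> 0 \<le> Poly_Mapping.lookup b i)"
  shows "mono_eval x (a + b) = mono_eval x a * mono_eval x b"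
proof -
  let ?S = "Poly_Mapping.keys a \<union> Poly_Mapping.keys b"
  have "x i powi (Poly_Mapping.lookup a i + Poly_Mapping.lookup b i) =
     x i powi Poly_Mapping.lookup a i * x i powi Poly_Mapping.lookup b i" for i
    using assms[of i] by (cases "x i = 0") (auto simp: power_int_add power_int_0_left_if)
  then show ?thesis
    by (simp add: mono_eval_superset[of ?S] keys_add lookup_add prod.distrib)
qed

lemma laurent_eval_superset:
  assumes "finite S" "Poly_Mapping.keys p \<subseteq> S"
  shows "laurent_eval x p = (\<Sum>m\<in>S. Poly_Mapping.lookup p m * mono_eval x m)"
  unfolding laurent_eval_def mono_eval_def
  by (rule sum.mono_neutral_left) (use assms in \<open>auto simp: in_keys_iff\<close>)

lemma laurent_eval_0 [simp]: "laurent_eval x 0 = 0"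
  by (simp add: laurent_eval_def)

lemma laurent_eval_add: "laurent_eval x (p + q) = laurent_eval x p + laurent_eval x q"
  by (simp add: laurent_eval_superset[of "Poly_Mapping.keys p \<union> Poly_Mapping.keys q"] keys_add
      lookup_add sum.distrib distrib_right)

lemma laurent_eval_sum: "laurent_eval x (\<Sum>a\<in>A. p a) = (\<Sum>a\<in>A. laurent_eval x (p a))"
  by (induction A rule: infinite_finite_induct) (auto simp: laurent_eval_add)

lemma laurent_eval_single: "laurent_eval x (Poly_Mapping.single m c) = c * mono_eval x m"
  by (auto simp: laurent_eval_def mono_eval_def)

lemma laurent_eval_lconst [simp]: "laurent_eval x (lconst c) = c"
  by (simp add: lconst_def laurent_eval_single)

lemma laurent_eval_var_power: "laurent_eval x (var_power i e) = x i powi e"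
  by (simp add: var_power_def laurent_eval_single mono_eval_single)

lemma laurent_mult_expand:
  "p * q = (\<Sum>a\<in>Poly_Mapping.keys p. \<Sum>b\<in>Poly_Mapping.keys q.
      Poly_Mapping.single (a + b) (Poly_Mapping.lookup p a * Poly_Mapping.lookup q b))"
proof -
  have "p * q = (\<Sum>a\<in>Poly_Mapping.keys p. Poly_Mapping.single a (Poly_Mapping.lookup p a)) *
     (\<Sum>b\<in>Poly_Mapping.keys q. Poly_Mapping.single b (Poly_Mapping.lookup q b))"
    by (rule arg_cong2[of _ _ _ _ "(*)"]; rule sum_single_keys) auto
  then show ?thesis by (simp only: sum_product mult_single)
qed

lemma laurent_eval_mult:
  assumes "\<And>a b. a \<in> Poly_Mapping.keys p \<Longrightarrow> b \<in> Poly_Mapping.keys q \<Longrightarrow>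
     mono_eval x (a + b) = mono_eval x a * mono_eval x b"
  shows "laurent_eval x (p * q) = laurent_eval x p * laurent_eval x q"
proof -
  have "laurent_eval x (p * q) = (\<Sum>a\<in>Poly_Mapping.keys p. \<Sum>b\<in>Poly_Mapping.keys q.
      Poly_Mapping.lookup p a * Poly_Mapping.lookup q b * (mono_eval x a * mono_eval x b))"
    unfolding laurent_mult_expand laurent_eval_sum laurent_eval_single
    by (intro sum.cong refl) (simp add: assms)
  then show ?thesis
    by (simp add: laurent_eval_def mono_eval_def sum_product mult_ac)
qed

lemma lconst_add: "lconst (a + b) = lconst a + lconst b"
  by (simp add: lconst_def single_add)

lemma lconst_mult: "lconst (a * b) = lconst a * lconst b"
  by (simp add: lconst_def mult_single)

lemma lconst_0 [simp]: "lconst 0 = 0"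
  by (simp add: lconst_def)

lemma lconst_1 [simp]: "lconst 1 = 1"
  by (simp add: lconst_def)

lemma lconst_minus: "lconst (- a) = - lconst a"
  by (simp add: lconst_def single_uminus)

lemma lookup_lconst_mult: "Poly_Mapping.lookup (lconst c * p) m = c * Poly_Mapping.lookup p m"
proof (cases "c = 0")
  case False
  have "lconst c * p = Poly_Mapping.map ((*) c) p"
    by (simp add: lconst_def mult_map_scale_conv_mult)
  then show ?thesis
    by (simp add: Poly_Mapping.map.rep_eq when_def)
qed simp

subsection \<open>Degree\<close>

lemma laurent_degree_le_iff:
  "laurent_degree p \<le> d \<longleftrightarrow> (\<forall>m\<in>Poly_Mapping.keys p. monomial_degree m \<le> d)"
  unfolding laurent_degree_def by (subst Max_le_iff) auto

lemma monomial_degree_superset: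
  assumes "finite S" "Poly_Mapping.keys m \<subseteq> S"
  shows "monomial_degree m = (\<Sum>i\<in>S. nat \<bar>Poly_Mapping.lookup m i\<bar>)"
  unfolding monomial_degree_def
  by (rule sum.mono_neutral_left) (use assms in \<open>auto simp: in_keys_iff\<close>)

lemma monomial_degree_add: "monomial_degree (a + b) \<le> monomial_degree a + monomial_degree b"
proof -
  have "nat \<bar>Poly_Mapping.lookup (a + b) i\<bar> \<le> nat \<bar>Poly_Mapping.lookup a i\<bar> + nat \<bar>Poly_Mapping.lookup b i\<bar>" for i
    by (simp add: lookup_add)
  then show ?thesis
    by (simp add: monomial_degree_superset[of "Poly_Mapping.keys a \<union> Poly_Mapping.keys b"] keys_add
        sum_mono flip: sum.distrib)
qed

lemma laurent_degree_add_le: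
  "laurent_degree p \<le> d \<Longrightarrow> laurent_degree q \<le> d \<Longrightarrow> laurent_degree (p + q) \<le> d"
  unfolding laurent_degree_le_iff using keys_add[of p q] by blast

lemma laurent_degree_mult_le:
  assumes "laurent_degree p \<le> d" "laurent_degree q \<le> e"
  shows "laurent_degree (p * q) \<le> d + e"
  unfolding laurent_degree_le_iff
proof
  fix m assume "m \<in> Poly_Mapping.keys (p * q)"
  then obtain a b where "m = a + b" "a \<in> Poly_Mapping.keys p" "b \<in> Poly_Mapping.keys q"
    using keys_mult[of p q] by blast
  then show "monomial_degree m \<le> d + e"
    using assms monomial_degree_add[of a b] unfolding laurent_degree_le_iff by fastforce
qed

lemma laurent_degree_lconst [simp]: "laurent_degree (lconst c) = 0"
  by (auto simp: laurent_degree_def lconst_def monomial_degree_def)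

lemma laurent_degree_var_power: "laurent_degree (var_power i e) \<le> nat \<bar>e\<bar>"
  by (auto simp: laurent_degree_le_iff var_power_def monomial_degree_def)

subsection \<open>Symmetry\<close>

lemma map_key_sum:
  "inj f \<Longrightarrow> Poly_Mapping.map_key f (\<Sum>a\<in>A. p a) = (\<Sum>a\<in>A. Poly_Mapping.map_key f (p a))"
  by (induction A rule: infinite_finite_induct) (auto simp: map_key_plus)

lemma map_key_single_inverse:
  assumes "inj f" "f k = m"
  shows "Poly_Mapping.map_key f (Poly_Mapping.single m c) = Poly_Mapping.single k c"
  using map_key_single[OF assms(1), of k c] assms(2) by simp

text \<open>A monomial substitution that acts additively on exponents is multiplicative. It is used
  for permutations of the variables and for inverting some of them.\<close>

lemma map_key_times:
  fixes p q :: "'m::monoid_add \<Rightarrow>\<^sub>0 'f::comm_semiring_0"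
  assumes inj: "inj \<phi>" and inv: "\<And>m. \<phi> (\<psi> m) = m" and add: "\<And>a b. \<psi> (a + b) = \<psi> a + \<psi> b"
  shows "Poly_Mapping.map_key \<phi> (p * q) = Poly_Mapping.map_key \<phi> p * Poly_Mapping.map_key \<phi> q"
proof -
  have single: "Poly_Mapping.map_key \<phi> (Poly_Mapping.single m c) = Poly_Mapping.single (\<psi> m) c"
    for m and c :: 'f
    by (rule map_key_single_inverse[OF inj inv])
  have expand: "r = (\<Sum>m\<in>Poly_Mapping.keys r. Poly_Mapping.single m (Poly_Mapping.lookup r m))"
    for r :: "'m \<Rightarrow>\<^sub>0 'f"
    by (rule sum_single_keys) auto
  have image: "Poly_Mapping.map_key \<phi> r =
      (\<Sum>m\<in>Poly_Mapping.keys r. Poly_Mapping.single (\<psi> m) (Poly_Mapping.lookup r m))" for r :: "'m \<Rightarrow>\<^sub>0 'f"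
    using arg_cong[OF expand[of r], of "Poly_Mapping.map_key \<phi>"] by (simp only: map_key_sum[OF inj] single)
  have "p * q = (\<Sum>a\<in>Poly_Mapping.keys p. \<Sum>b\<in>Poly_Mapping.keys q.
      Poly_Mapping.single (a + b) (Poly_Mapping.lookup p a * Poly_Mapping.lookup q b))"
    using arg_cong2[OF expand[of p] expand[of q], of "(*)"] by (simp only: sum_product mult_single)
  then have "Poly_Mapping.map_key \<phi> (p * q) = (\<Sum>a\<in>Poly_Mapping.keys p. \<Sum>b\<in>Poly_Mapping.keys q.
      Poly_Mapping.single (\<psi> a + \<psi> b) (Poly_Mapping.lookup p a * Poly_Mapping.lookup q b))"
    by (simp only: map_key_sum[OF inj] single add)
  then show ?thesis
    by (simp only: image sum_product mult_single)
qed

definition permute_vars :: "(nat \<Rightarrow> nat) \<Rightarrow> 'f::field laurent \<Rightarrow> 'f laurent" where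
  "permute_vars \<pi> p = Poly_Mapping.map_key (Poly_Mapping.map_key \<pi>) p"

lemma inj_map_key: "bij \<pi> \<Longrightarrow> inj (Poly_Mapping.map_key \<pi> :: ('b \<Rightarrow>\<^sub>0 'a::zero) \<Rightarrow> _)"
proof (rule injI)
  fix a b :: "'b \<Rightarrow>\<^sub>0 'a"
  assume \<pi>: "bij \<pi>" and eq: "Poly_Mapping.map_key \<pi> a = Poly_Mapping.map_key \<pi> b"
  show "a = b"
  proof (rule poly_mapping_eqI)
    fix k
    obtain j where "k = \<pi> j" using \<pi> by (metis bij_pointE)
    then show "Poly_Mapping.lookup a k = Poly_Mapping.lookup b k"
      using arg_cong[OF eq, of "\<lambda>a. Poly_Mapping.lookup a j"] \<pi>
      by (simp add: Poly_Mapping.map_key.rep_eq bij_is_inj)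
  qed
qed

text \<open>Symmetry becomes invariance under a ring homomorphism, so that closure under sums and
  products is immediate.\<close>

lemma symmetric_laurent_iff:
  "symmetric_laurent n p \<longleftrightarrow> (\<forall>\<pi>. \<pi> permutes {1..n} \<longrightarrow> permute_vars \<pi> p = p)"
proof -
  have "Poly_Mapping.lookup (permute_vars \<pi> p) m = Poly_Mapping.lookup p (Poly_Mapping.map_key \<pi> m)"
    if "\<pi> permutes {1..n}" for \<pi> m
    unfolding permute_vars_def
    by (subst Poly_Mapping.map_key.rep_eq) (auto intro: inj_map_key permutes_bij that)
  then show ?thesis
    unfolding symmetric_laurent_def by (metis poly_mapping_eqI)
qed

context
  fixes \<pi> :: "nat \<Rightarrow> nat" assumes \<pi>: "bij \<pi>"
begin

lemma permute_vars_mult: "permute_vars \<pi> (p * q) = permute_vars \<pi> p * permute_vars \<pi> q"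
  unfolding permute_vars_def
proof (rule map_key_times[where \<psi> = "Poly_Mapping.map_key (Hilbert_Choice.inv \<pi>)"])
  have inv: "inj (Hilbert_Choice.inv \<pi>)" using \<pi> by (simp add: bij_is_inj bij_imp_bij_inv)
  show "inj (Poly_Mapping.map_key \<pi> :: (nat \<Rightarrow>\<^sub>0 int) \<Rightarrow> _)" by (rule inj_map_key[OF \<pi>])
  show "Poly_Mapping.map_key \<pi> (Poly_Mapping.map_key (Hilbert_Choice.inv \<pi>) m) = m" for m :: "nat \<Rightarrow>\<^sub>0 int"
  proof -
    have "Hilbert_Choice.inv \<pi> \<circ> \<pi> = (\<lambda>x. x)" using \<pi> by (simp add: fun_eq_iff bij_is_inj inv_f_f)
    then show ?thesis
      by (simp add: map_key_compose[OF bij_is_inj[OF \<pi>] inv] map_key_id)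
  qed
  show "Poly_Mapping.map_key (Hilbert_Choice.inv \<pi>) (a + b) =
    Poly_Mapping.map_key (Hilbert_Choice.inv \<pi>) a + Poly_Mapping.map_key (Hilbert_Choice.inv \<pi>) b"
    for a b :: "nat \<Rightarrow>\<^sub>0 int"
    by (rule map_key_plus[OF inv])
qed

lemma permute_vars_add: "permute_vars \<pi> (p + q) = permute_vars \<pi> p + permute_vars \<pi> q"
  unfolding permute_vars_def by (rule map_key_plus[OF inj_map_key[OF \<pi>]])

lemma permute_vars_lconst: "permute_vars \<pi> (lconst c) = lconst c"
  unfolding permute_vars_def lconst_def
  by (rule map_key_single_inverse[OF inj_map_key[OF \<pi>]]) (simp add: map_key_zero[OF bij_is_inj[OF \<pi>]])

lemma permute_vars_var_power: "permute_vars \<pi> (var_power i e) = var_power (\<pi> i) e"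
  unfolding permute_vars_def var_power_def
  by (intro map_key_single_inverse[OF inj_map_key[OF \<pi>]] map_key_single bij_is_inj[OF \<pi>])

lemma permute_vars_sum: "permute_vars \<pi> (\<Sum>a\<in>A. p a) = (\<Sum>a\<in>A. permute_vars \<pi> (p a))"
  unfolding permute_vars_def by (rule map_key_sum[OF inj_map_key[OF \<pi>]])

lemma permute_vars_prod: "permute_vars \<pi> (\<Prod>a\<in>A. p a) = (\<Prod>a\<in>A. permute_vars \<pi> (p a))"
proof -
  have "permute_vars \<pi> 1 = 1" using permute_vars_lconst[of 1] by simp
  then show ?thesis
    by (induction A rule: infinite_finite_induct) (auto simp: permute_vars_mult)
qed

end

lemma Lam_lconst: "lconst c \<in> Lam F n"
  by (auto simp: Lam_def symmetric_laurent_iff permutes_bij permute_vars_lconst intro: generated_algebra.intros)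

lemma Lam_add: "p \<in> Lam F n \<Longrightarrow> q \<in> Lam F n \<Longrightarrow> p + q \<in> Lam F n"
  by (auto simp: Lam_def symmetric_laurent_iff permutes_bij permute_vars_add intro: generated_algebra.intros)

lemma Lam_mult: "p \<in> Lam F n \<Longrightarrow> q \<in> Lam F n \<Longrightarrow> p * q \<in> Lam F n"
  by (auto simp: Lam_def symmetric_laurent_iff permutes_bij permute_vars_mult intro: generated_algebra.intros)

lemma Lam_0: "0 \<in> Lam F n"
  using Lam_lconst[of 0] by simp

lemma Lam_sum: "(\<And>a. a \<in> A \<Longrightarrow> p a \<in> Lam F n) \<Longrightarrow> (\<Sum>a\<in>A. p a) \<in> Lam F n"
  by (induction A rule: infinite_finite_induct) (auto intro: Lam_add Lam_0)

lemma generated_algebra_sum: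
  "(\<And>a. a \<in> A \<Longrightarrow> p a \<in> generated_algebra G) \<Longrightarrow> (\<Sum>a\<in>A. p a) \<in> generated_algebra G"
  using generated_algebra.const[of 0 G]
  by (induction A rule: infinite_finite_induct) (auto intro: generated_algebra.add)

lemma generated_algebra_prod:
  "(\<And>a. a \<in> A \<Longrightarrow> p a \<in> generated_algebra G) \<Longrightarrow> (\<Prod>a\<in>A. p a) \<in> generated_algebra G"
  using generated_algebra.const[of 1 G]
  by (induction A rule: infinite_finite_induct) (auto intro: generated_algebra.mult)

section \<open>Dominant exponents determine a symmetric polynomial\<close>

text \<open>Swap a smallest value into the last position and sort the others by induction.\<close>

lemma ex_sorting_permutation:
  fixes k :: "nat \<Rightarrow> nat"
  shows "\<exists>\<pi>. \<pi> permutes {1..n} \<and> (\<forall>i j. 1 \<le> i \<and> i \<le> j \<and> j \<le> n \<longrightarrow> k (\<pi> j) \<le> k (\<pi> i))"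
proof (induction n arbitrary: k)
  case 0
  then show ?case by (auto intro: exI[of _ id])
next
  case (Suc n)
  obtain m where m: "m \<in> {1..Suc n}" "\<And>i. i \<in> {1..Suc n} \<Longrightarrow> k m \<le> k i"
    using ex_has_least_nat[of "\<lambda>i. i \<in> {1..Suc n}" 1 k] by auto
  define \<tau> where "\<tau> = transpose m (Suc n)"
  have \<tau>: "\<tau> permutes {1..Suc n}" unfolding \<tau>_def using m by (intro permutes_swap_id) auto
  obtain \<pi> where \<pi>: "\<pi> permutes {1..n}"
    "\<And>i j. 1 \<le> i \<and> i \<le> j \<and> j \<le> n \<Longrightarrow> (k \<circ> \<tau>) (\<pi> j) \<le> (k \<circ> \<tau>) (\<pi> i)"
    using Suc.IH[of "k \<circ> \<tau>"] by blast
  have \<pi>': "\<pi> permutes {1..Suc n}" by (rule permutes_subset[OF \<pi>(1)]) auto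
  have "\<pi> (Suc n) = Suc n" using \<pi>(1) by (simp add: permutes_not_in)
  then have last: "k (\<tau> (\<pi> (Suc n))) = k m" by (simp add: \<tau>_def)
  have "k ((\<tau> \<circ> \<pi>) j) \<le> k ((\<tau> \<circ> \<pi>) i)" if "1 \<le> i" "i \<le> j" "j \<le> Suc n" for i j
  proof (cases "j = Suc n")
    case True
    have "\<tau> (\<pi> i) \<in> {1..Suc n}"
      using permutes_in_image[OF \<tau>] permutes_in_image[OF \<pi>'] that by auto
    then show ?thesis using m(2) last True by simp
  qed (use \<pi>(2)[of i j] that in auto)
  then show ?case using permutes_compose[OF \<pi>' \<tau>] by blast
qed

text \<open>The scale \<open>s\<close> will be \<open>fam_degfac\<close>: in the family BJ only even
  exponents occur. The argument may be any function, because the exponent of an arbitrary monomial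
  is put into this form before it is sorted.\<close>

definition expo :: "nat \<Rightarrow> nat \<Rightarrow> partition \<Rightarrow> nat \<Rightarrow>\<^sub>0 int" where
  "expo s n lam = Abs_poly_mapping (\<lambda>i. if i \<in> {1..n} then int (s * lam i) else 0)"

lemma lookup_expo: "Poly_Mapping.lookup (expo s n lam) i = (if i \<in> {1..n} then int (s * lam i) else 0)"
proof -
  have "finite {i. (if i \<in> {1..n} then int (s * lam i) else 0) \<noteq> 0}"
    by (rule finite_subset[of _ "{1..n}"]) (auto split: if_splits)
  then show ?thesis unfolding expo_def by (subst lookup_Abs_poly_mapping) auto
qed

text \<open>The hypothesis \<open>normal\<close> covers both genuine polynomials and polynomials in \<open>x\<^sub>i + x\<^sub>i\<^sup>-\<^sup>1\<close>.\<close>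

lemma symmetric_laurent_determined:
  assumes sym: "symmetric_laurent n p" and deg: "laurent_degree p \<le> s * d" and s: "s > 0"
    and normal: "\<And>m. m \<in> Poly_Mapping.keys p \<Longrightarrow> Poly_Mapping.keys m \<subseteq> {1..n} \<and>
       (\<exists>k. Poly_Mapping.lookup p (expo s n k) = Poly_Mapping.lookup p m \<and>
            (\<forall>i\<in>{1..n}. \<bar>Poly_Mapping.lookup m i\<bar> = int (s * k i)))"
    and zero: "\<And>lam. lam \<in> partitions n \<Longrightarrow> psize n lam \<le> d \<Longrightarrow> Poly_Mapping.lookup p (expo s n lam) = 0"
  shows "p = 0"
proof (rule ccontr)
  assume "p \<noteq> 0"
  then obtain m where m: "m \<in> Poly_Mapping.keys p" by (metis all_not_in_conv keys_eq_empty)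
  obtain k where k: "Poly_Mapping.keys m \<subseteq> {1..n}" "Poly_Mapping.lookup p (expo s n k) = Poly_Mapping.lookup p m"
     "\<And>i. i \<in> {1..n} \<Longrightarrow> \<bar>Poly_Mapping.lookup m i\<bar> = int (s * k i)"
    using normal[OF m] by blast
  obtain \<pi> where \<pi>: "\<pi> permutes {1..n}"
    "\<And>i j. 1 \<le> i \<and> i \<le> j \<and> j \<le> n \<Longrightarrow> k (\<pi> j) \<le> k (\<pi> i)"
    using ex_sorting_permutation[of n k] by blast
  define lam where "lam = (\<lambda>i. if i \<in> {1..n} then k (\<pi> i) else 0)"
  have "lam \<in> partitions n"
    using \<pi>(2) by (auto simp: lam_def partitions_def)
  have "Poly_Mapping.map_key \<pi> (expo s n k) = expo s n lam"
  proof (rule poly_mapping_eqI)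
    fix i
    have "\<pi> i \<in> {1..n} \<longleftrightarrow> i \<in> {1..n}" using permutes_in_image[OF \<pi>(1)] by auto
    then show "Poly_Mapping.lookup (Poly_Mapping.map_key \<pi> (expo s n k)) i = Poly_Mapping.lookup (expo s n lam) i"
      by (auto simp: Poly_Mapping.map_key.rep_eq permutes_inj[OF \<pi>(1)] lookup_expo lam_def)
  qed
  then have "Poly_Mapping.lookup p (expo s n lam) = Poly_Mapping.lookup p m"
    using sym \<pi>(1) k(2) unfolding symmetric_laurent_def by metis
  moreover have "psize n lam \<le> d"
  proof -
    have "s * psize n lam = (\<Sum>i\<in>{1..n}. s * k (\<pi> i))"
      by (simp add: psize_def lam_def sum_distrib_left)
    also have "\<dots> = (\<Sum>i\<in>{1..n}. s * k i)"
      using sum.permute[OF \<pi>(1), of "\<lambda>i. s * k i"] by (simp add: o_def)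
    also have "\<dots> = (\<Sum>i\<in>{1..n}. nat \<bar>Poly_Mapping.lookup m i\<bar>)"
      using k(3) by (intro sum.cong refl) (metis nat_int)
    also have "\<dots> = monomial_degree m" using monomial_degree_superset[OF _ k(1)] by simp
    also have "\<dots> \<le> s * d" using deg m by (simp add: laurent_degree_le_iff)
    finally show ?thesis using s by simp
  qed
  ultimately show False using zero \<open>lam \<in> partitions n\<close> m by (simp add: in_keys_iff)
qed

section \<open>Interpolation polynomials\<close>

text \<open>Gaussian elimination: an equation \<open>b\<close> with a nonzero entry at
  \<open>a0\<close> is used to eliminate the unknown \<open>a0\<close> from the other
  equations.\<close>

lemma finite_card_lt_kernel:
  fixes M :: "'a \<Rightarrow> 'b \<Rightarrow> 'f::field"
  assumes "finite B" "finite A" "card B < card A"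
  shows "\<exists>c. (\<exists>a\<in>A. c a \<noteq> 0) \<and> (\<forall>b\<in>B. (\<Sum>a\<in>A. c a * M a b) = 0)"
  using assms
proof (induction B arbitrary: A M rule: finite_induct)
  case empty
  then have "A \<noteq> {}" by auto
  then show ?case by (intro exI[of _ "\<lambda>_. 1"]) auto
next
  case (insert b B)
  show ?case
  proof (cases "\<forall>a\<in>A. M a b = 0")
    case True
    then show ?thesis using insert.IH[of A M] insert by auto
  next
    case False
    then obtain a0 where a0: "a0 \<in> A" "M a0 b \<noteq> 0" by blast
    define M' where "M' = (\<lambda>a b'. M a b' - M a b / M a0 b * M a0 b')"
    have "card B < card (A - {a0})" using insert a0 by simp
    then obtain c where c: "\<exists>a\<in>A - {a0}. c a \<noteq> 0"
      "\<forall>b'\<in>B. (\<Sum>a\<in>A - {a0}. c a * M' a b') = 0"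
      using insert.IH[of "A - {a0}" M'] insert.prems by blast
    define d where "d = c(a0 := - (\<Sum>a\<in>A - {a0}. c a * M a b) / M a0 b)"
    have "(\<Sum>a\<in>A. d a * M a b') = d a0 * M a0 b' + (\<Sum>a\<in>A - {a0}. c a * M a b')" for b'
      using a0 insert by (subst sum.remove[of A a0]) (auto simp: d_def intro!: sum.cong)
    moreover have "(\<Sum>a\<in>A - {a0}. c a * M' a b') =
       (\<Sum>a\<in>A - {a0}. c a * M a b') - (\<Sum>a\<in>A - {a0}. c a * M a b) / M a0 b * M a0 b'" for b'
      by (simp add: M'_def algebra_simps sum_subtractf sum_distrib_left sum_distrib_right sum_divide_distrib)
    ultimately have d: "(\<Sum>a\<in>A. d a * M a b') = (\<Sum>a\<in>A - {a0}. c a * M' a b')" for b'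
      by (simp add: d_def)
    have "(\<Sum>a\<in>A. d a * M a b') = 0" if "b' \<in> insert b B" for b'
      using that c(2) a0 unfolding d by (auto simp: M'_def)
    moreover have "\<exists>a\<in>A. d a \<noteq> 0"
      using c(1) by (auto simp: d_def)
    ultimately show ?thesis by blast
  qed
qed

section \<open>Elementary symmetric functions with trailing variables specialised\<close>

text \<open>The ring is left general because the same expression is needed for the Laurent
  generators, for their values in the base field, and for polynomial functions over the larger
  field.\<close>

definition es :: "('i \<Rightarrow> 'a::comm_semiring_1) \<Rightarrow> 'i set \<Rightarrow> nat \<Rightarrow> 'a" where
  "es y A j = (\<Sum>B | B \<subseteq> A \<and> card B = j. \<Prod>i\<in>B. y i)"

lemma es_image:
  assumes "inj_on h A"
  shows "es (\<lambda>i. y (h i)) A j = es y (h ` A) j"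
proof -
  have *: "{B. B \<subseteq> h ` A \<and> card B = j} = (`) h ` {B. B \<subseteq> A \<and> card B = j}"
  proof safe
    fix B assume "B \<subseteq> h ` A" "j = card B"
    then obtain C where C: "C \<subseteq> A" "B = h ` C" by (meson subset_image_iff)
    then have "card C = card B" using assms by (metis card_image inj_on_subset)
    then show "B \<in> (`) h ` {B'. B' \<subseteq> A \<and> card B' = card B}" using C by blast
  qed (use assms in \<open>auto simp: card_image inj_on_subset\<close>)
  have inj: "inj_on ((`) h) {B. B \<subseteq> A \<and> card B = j}"
    by (rule inj_on_subset[OF inj_on_image_Pow[OF assms]]) auto
  have "prod y (h ` B) = (\<Prod>i\<in>B. y (h i))" if "B \<subseteq> A" for B
    using prod.reindex[OF inj_on_subset[OF assms that], of y] by (simp add: o_def)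
  then show ?thesis
    unfolding es_def * sum.reindex[OF inj] o_def by (intro sum.cong) auto
qed

lemma es_permute: "\<pi> permutes A \<Longrightarrow> es (\<lambda>i. y (\<pi> i)) A j = es y A j"
  by (simp add: es_image permutes_image permutes_inj_on)

lemma es_0: "finite A \<Longrightarrow> es y A 0 = 1"
proof -
  assume "finite A"
  then have "{B. B \<subseteq> A \<and> card B = 0} = {{}}" by (auto dest: finite_subset)
  then show ?thesis by (simp add: es_def)
qed

lemma es_insert:
  assumes "finite A" "x \<notin> A"
  shows "es y (insert x A) (Suc j) = es y A (Suc j) + y x * es y A j"
proof -
  let ?S = "{B. B \<subseteq> A \<and> card B = j}"
  have *: "{B. B \<subseteq> insert x A \<and> card B = Suc j} = {B. B \<subseteq> A \<and> card B = Suc j} \<union> insert x ` ?S"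
  proof safe
    fix B assume B: "B \<subseteq> insert x A" "card B = Suc j" "B \<notin> insert x ` ?S"
    fix z assume "z \<in> B" show "z \<in> A"
    proof (rule ccontr)
      assume "z \<notin> A"
      then have "x \<in> B" using B \<open>z \<in> B\<close> by auto
      then have "B = insert x (B - {x})" "B - {x} \<in> ?S" using B by auto
      then show False using B(3) by blast
    qed
  next
    fix B assume B: "B \<subseteq> A" "j = card B"
    have "x \<notin> B" "finite B" using B assms finite_subset by blast+
    then show "card (insert x B) = Suc (card B)" by simp
  qed auto
  have fin: "finite {B. B \<subseteq> A \<and> card B = k}" for k
    by (rule finite_subset[of _ "Pow A"]) (use assms in auto)
  have inj: "inj_on (insert x) ?S" using assms by (auto simp: inj_on_def)
  have "es y (insert x A) (Suc j) = es y A (Suc j) + (\<Sum>B\<in>insert x ` ?S. prod y B)"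
    unfolding es_def * by (rule sum.union_disjoint) (use fin assms in auto)
  also have "(\<Sum>B\<in>insert x ` ?S. prod y B) = (\<Sum>B\<in>?S. y x * prod y B)"
    unfolding sum.reindex[OF inj] o_def
    by (intro sum.cong refl prod.insert) (use assms in \<open>auto dest: finite_subset\<close>)
  finally show ?thesis by (simp add: es_def sum_distrib_left)
qed

text \<open>The coefficients are chosen before \<open>y\<close>, but the identity is asked for only
  on \<open>Y\<close>, the set of points whose trailing variables have prescribed values.\<close>

definition es_span ::
  "('i \<Rightarrow> 'f::field) set \<Rightarrow> 'i set \<Rightarrow> nat \<Rightarrow> (('i \<Rightarrow> 'f) \<Rightarrow> 'f) \<Rightarrow> bool" where
  "es_span Y A m f \<longleftrightarrow> (\<exists>\<gamma>. \<forall>y\<in>Y. f y = (\<Sum>j\<le>m. \<gamma> j * es y A j))"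

lemma es_span_es: "j \<le> m \<Longrightarrow> es_span Y A m (\<lambda>y. es y A j)"
  unfolding es_span_def
  by (intro exI[of _ "\<lambda>i. if i = j then 1 else 0"]) (simp add: if_distrib[of "\<lambda>x. x * _"] cong: if_cong)

lemma es_span_cmult: "es_span Y A m f \<Longrightarrow> es_span Y A m (\<lambda>y. c * f y)"
  unfolding es_span_def
proof (elim exE)
  fix a assume "\<forall>y\<in>Y. f y = (\<Sum>j\<le>m. a j * es y A j)"
  then show "\<exists>\<gamma>. \<forall>y\<in>Y. c * f y = (\<Sum>j\<le>m. \<gamma> j * es y A j)"
    by (intro exI[of _ "\<lambda>j. c * a j"]) (simp add: sum_distrib_left mult.assoc)
qed

lemma es_span_add: "es_span Y A m f \<Longrightarrow> es_span Y A m g \<Longrightarrow> es_span Y A m (\<lambda>y. f y + g y)"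
  unfolding es_span_def
proof (elim exE)
  fix a b assume "\<forall>y\<in>Y. f y = (\<Sum>j\<le>m. a j * es y A j)" "\<forall>y\<in>Y. g y = (\<Sum>j\<le>m. b j * es y A j)"
  then show "\<exists>\<gamma>. \<forall>y\<in>Y. f y + g y = (\<Sum>j\<le>m. \<gamma> j * es y A j)"
    by (intro exI[of _ "\<lambda>j. a j + b j"]) (simp add: sum.distrib distrib_right)
qed

lemma es_span_sum:
  assumes "\<And>i. i \<in> I \<Longrightarrow> es_span Y A m (f i)"
  shows "es_span Y A m (\<lambda>y. \<Sum>i\<in>I. f i y)"
proof -
  have "es_span Y A m (\<lambda>y. 0)" unfolding es_span_def by (intro exI[of _ "\<lambda>_. 0"]) simp
  then show ?thesis using assms by (induction I rule: infinite_finite_induct) (auto intro: es_span_add)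
qed

lemma es_span_cong: "es_span Y A m f \<Longrightarrow> (\<And>y. y \<in> Y \<Longrightarrow> g y = f y) \<Longrightarrow> es_span Y A m g"
  unfolding es_span_def by auto

lemma es_span_mono:
  assumes "es_span Y A m f" "m \<le> m'" shows "es_span Y A m' f"
proof -
  obtain \<gamma> where "\<forall>y\<in>Y. f y = (\<Sum>j\<le>m. \<gamma> j * es y A j)" using assms unfolding es_span_def by blast
  moreover have "es_span Y A m' (\<lambda>y. \<Sum>j\<le>m. \<gamma> j * es y A j)"
    by (rule es_span_sum, rule es_span_cmult, rule es_span_es) (use assms in auto)
  ultimately show ?thesis unfolding es_span_def by auto
qed

text \<open>Solving \<open>es_insert\<close> for the smaller index set expresses its function of
  degree \<open>j + 1\<close> by the one of the larger set and, with the prescribed value as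
  coefficient, by its own function of degree \<open>j\<close>. Hence an inner induction on
  \<open>j\<close> for each variable that is added.\<close>

lemma es_span_extend:
  fixes c :: "nat \<Rightarrow> 'f::field"
  assumes "r \<le> n"
  shows "es_span {y. \<forall>i\<in>{r<..n}. y i = c i} {1..n} j (\<lambda>y. es y {1..r} j)"
  using assms
proof (induction n rule: dec_induct)
  case base
  show ?case by (rule es_span_es) simp
next
  case (step n)
  let ?Y = "\<lambda>n. {y. \<forall>i\<in>{r<..n}. y i = c i}"
  have 1: "es_span (?Y (Suc n)) {1..Suc n} j (\<lambda>y. es y {1..n} j)" for j
  proof (induction j)
    case 0
    show ?case by (rule es_span_cong[OF es_span_es[of 0]]) (auto simp: es_0)
  next
    case (Suc j)
    have eq: "es y {1..n} (Suc j) = es y {1..Suc n} (Suc j) + (- c (Suc n)) * es y {1..n} j"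
      if "y \<in> ?Y (Suc n)" for y
      using es_insert[of "{1..n}" "Suc n" y j] that step
      by (simp add: atLeastAtMostSuc_conv)
    have "es_span (?Y (Suc n)) {1..Suc n} (Suc j) (\<lambda>y. es y {1..n} j)"
      by (rule es_span_mono[OF Suc.IH]) simp
    from es_span_add[OF es_span_es[OF order.refl] es_span_cmult[OF this]]
    have "es_span (?Y (Suc n)) {1..Suc n} (Suc j)
        (\<lambda>y. es y {1..Suc n} (Suc j) + (- c (Suc n)) * es y {1..n} j)" .
    then show ?case by (rule es_span_cong) (rule eq)
  qed
  obtain \<gamma> where \<gamma>: "\<forall>y\<in>?Y n. es y {1..r} j = (\<Sum>i\<le>j. \<gamma> i * es y {1..n} i)"
    using step.IH unfolding es_span_def by blast
  have "es_span (?Y (Suc n)) {1..Suc n} j (\<lambda>y. \<Sum>i\<le>j. \<gamma> i * es y {1..n} i)"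
    by (rule es_span_sum, rule es_span_cmult, rule es_span_mono[OF 1]) auto
  then show ?case
    by (rule es_span_cong) (use \<gamma> in auto)
qed

lemma prod_diff_es:
  fixes c :: "'f::field"
  assumes "finite A"
  shows "(\<Prod>i\<in>A. y i - c) = (\<Sum>j\<le>card A. (- c) ^ (card A - j) * es y A j)"
proof -
  have "(\<Prod>i\<in>A. y i - c) = (\<Sum>B\<in>Pow A. prod y B * (- c) ^ card (A - B))"
    using prod_add[OF assms, of y "\<lambda>_. - c"] by simp
  also have "\<dots> = (\<Sum>j\<le>card A. \<Sum>B | B \<in> Pow A \<and> card B = j. prod y B * (- c) ^ card (A - B))"
    by (rule sum.group[symmetric]) (use assms in \<open>auto intro: card_mono\<close>)
  also have "\<dots> = (\<Sum>j\<le>card A. (- c) ^ (card A - j) * es y A j)"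
    unfolding es_def sum_distrib_left
    by (intro sum.cong refl) (use assms in \<open>auto simp: card_Diff_subset finite_subset mult.commute\<close>)
  finally show ?thesis .
qed

lemma es_span_prod:
  fixes c :: "nat \<Rightarrow> 'f::field"
  assumes "r \<le> n"
  shows "es_span {y. \<forall>i\<in>{r<..n}. y i = c i} {1..n} r (\<lambda>y. \<Prod>i\<in>{1..r}. y i - c')"
  unfolding prod_diff_es[OF finite_atLeastAtMost]
  by (rule es_span_sum, rule es_span_cmult, rule es_span_mono[OF es_span_extend[OF assms]]) auto

section \<open>Colexicographic order and columns of a partition\<close>

definition colex :: "nat \<Rightarrow> partition \<Rightarrow> partition \<Rightarrow> bool" where
  "colex n lam \<mu> \<longleftrightarrow> (\<exists>k\<in>{1..n}. (\<forall>i\<in>{k<..n}. lam i = \<mu> i) \<and> lam k < \<mu> k)"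

lemma colex_total:
  assumes "lam \<in> partitions n" "\<mu> \<in> partitions n" "lam \<noteq> \<mu>"
  shows "colex n lam \<mu> \<or> colex n \<mu> lam"
proof -
  let ?D = "{i \<in> {1..n}. lam i \<noteq> \<mu> i}"
  have "?D \<noteq> {}"
    using assms by (auto simp: partitions_def fun_eq_iff) (metis One_nat_def atLeastAtMost_iff)
  then have k: "Max ?D \<in> ?D" by (intro Max_in) auto
  have "i \<le> Max ?D" if "i \<in> ?D" for i using that by (intro Max_ge) auto
  then have "\<forall>i\<in>{Max ?D<..n}. lam i = \<mu> i"
    using k by (metis (mono_tags, lifting) atLeastAtMost_iff greaterThanAtMost_iff leD le_trans less_imp_le mem_Collect_eq)
  then show ?thesis using k unfolding colex_def
    by (metis (mono_tags, lifting) linorder_neqE_nat mem_Collect_eq)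
qed

lemma colex_trans: "colex n a b \<Longrightarrow> colex n b c \<Longrightarrow> colex n a c"
proof -
  assume "colex n a b" "colex n b c"
  then obtain k l where kl: "k \<in> {1..n}" "\<forall>i\<in>{k<..n}. a i = b i" "a k < b k"
    "l \<in> {1..n}" "\<forall>i\<in>{l<..n}. b i = c i" "b l < c l" unfolding colex_def by blast
  then have "max k l \<in> {1..n}" "\<forall>i\<in>{max k l<..n}. a i = c i" by auto
  moreover have "a (max k l) < c (max k l)"
    using kl by (cases k l rule: linorder_cases) (auto simp: max_def)
  ultimately show ?thesis unfolding colex_def by blast
qed

lemma colex_irrefl: "\<not> colex n a a"
  by (auto simp: colex_def)

lemma colex_max:
  assumes "finite S" "S \<noteq> {}" "S \<subseteq> partitions n"
  obtains m where "m \<in> S" "\<And>x. x \<in> S \<Longrightarrow> x \<noteq> m \<Longrightarrow> colex n x m"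
proof -
  have "asymp_on S (colex n)" by (auto intro!: asymp_onI dest: colex_trans simp: colex_irrefl)
  moreover have "transp_on S (colex n)" by (auto intro!: transp_onI intro: colex_trans)
  ultimately obtain m where "m \<in> S" "\<forall>x\<in>S. x \<noteq> m \<longrightarrow> \<not> colex n m x"
    using Finite_Set.bex_max_element[OF assms(1) _ _ assms(2)] by blast
  then show ?thesis using colex_total assms(3) that by blast
qed

lemma colex_min:
  assumes "finite S" "S \<noteq> {}" "S \<subseteq> partitions n"
  obtains m where "m \<in> S" "\<And>x. x \<in> S \<Longrightarrow> x \<noteq> m \<Longrightarrow> colex n m x"
proof -
  have "asymp_on S (colex n)" by (auto intro!: asymp_onI dest: colex_trans simp: colex_irrefl)
  moreover have "transp_on S (colex n)" by (auto intro!: transp_onI intro: colex_trans)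
  ultimately obtain m where "m \<in> S" "\<forall>x\<in>S. x \<noteq> m \<longrightarrow> \<not> colex n x m"
    using Finite_Set.bex_min_element[OF assms(1) _ _ assms(2)] by blast
  then show ?thesis using colex_total assms(3) that by blast
qed

lemma finite_partitions_le: "finite {lam \<in> partitions n. psize n lam \<le> d}"
proof (rule finite_subset[OF _ finite_below])
  show "{lam \<in> partitions n. psize n lam \<le> d} \<subseteq> below n (\<lambda>_. d)"
  proof safe
    fix lam assume lam: "lam \<in> partitions n" "psize n lam \<le> d"
    have "lam i \<le> d" for i
    proof (cases "i \<in> {1..n}")
      case True
      then have "lam i \<le> psize n lam" unfolding psize_def by (intro member_le_sum) auto
      then show ?thesis using lam by simp
    next
      case False
      then have "lam i = 0" using lam(1) unfolding partitions_def by blast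
      then show ?thesis by simp
    qed
    then show "lam \<in> below n (\<lambda>_. d)" using lam by (simp add: below_def)
  qed
qed

text \<open>These are the parts of the conjugate partition.\<close>

definition column :: "nat \<Rightarrow> partition \<Rightarrow> nat \<Rightarrow> nat" where
  "column n \<mu> j = card {i \<in> {1..n}. j \<le> \<mu> i}"

text \<open>The parts decrease, so the rows of length at least \<open>j\<close> form an initial
  segment, and their number is also the index of the last of them.\<close>

lemma column_iff:
  assumes "\<mu> \<in> partitions n" "i \<in> {1..n}"
  shows "j \<le> \<mu> i \<longleftrightarrow> i \<le> column n \<mu> j"
proof -
  let ?S = "{i \<in> {1..n}. j \<le> \<mu> i}"
  have down: "i' \<in> ?S" if "i \<in> ?S" "1 \<le> i'" "i' \<le> i" for i i'
  proof -
    have "\<mu> i \<le> \<mu> i'" using assms(1) that by (simp add: partitions_def)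
    then show ?thesis using that by simp
  qed
  show ?thesis
  proof
    assume "j \<le> \<mu> i"
    then have "i \<in> ?S" using assms(2) by simp
    then have "{1..i} \<subseteq> ?S" using down[of i] by auto
    then have "card {1..i} \<le> card ?S" by (intro card_mono) auto
    then show "i \<le> column n \<mu> j" by (simp add: column_def)
  next
    assume le: "i \<le> column n \<mu> j"
    show "j \<le> \<mu> i"
    proof (rule ccontr)
      assume "\<not> j \<le> \<mu> i"
      then have "?S \<subseteq> {1..<i}" using down[of _ i] assms(2) by (force simp: not_less)
      then have "card ?S \<le> card {1..<i}" by (intro card_mono) auto
      then have "column n \<mu> j \<le> i - 1" by (simp add: column_def)
      then show False using le assms(2) by auto
    qed
  qed
qed

lemma sum_column:
  assumes "\<mu> \<in> partitions n"
  shows "(\<Sum>j\<in>{1..\<mu> 1}. column n \<mu> j) = psize n \<mu>"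
proof -
  have "column n \<mu> j = (\<Sum>i\<in>{1..n}. if j \<le> \<mu> i then 1 else 0)" for j
    by (simp add: column_def sum.If_cases Int_def)
  then have "(\<Sum>j\<in>{1..\<mu> 1}. column n \<mu> j) = (\<Sum>i\<in>{1..n}. \<Sum>j\<in>{1..\<mu> 1}. if j \<le> \<mu> i then 1 else 0)"
    by (simp only: sum.swap[of _ "{1..n}"])
  also have "\<dots> = (\<Sum>i\<in>{1..n}. \<mu> i)"
  proof (intro sum.cong refl)
    fix i assume "i \<in> {1..n}"
    then have "\<mu> i \<le> \<mu> 1" using assms by (simp add: partitions_def)
    then have "{1..\<mu> 1} \<inter> {j. j \<le> \<mu> i} = {1..\<mu> i}" by auto
    then show "(\<Sum>j\<in>{1..\<mu> 1}. if j \<le> \<mu> i then 1 else 0) = \<mu> i"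
      by (simp add: sum.If_cases)
  qed
  finally show ?thesis by (simp add: psize_def)
qed

text \<open>The embedding \<open>\<iota>\<close> into a larger field is needed because the grids of the families AM and BM
  involve the square roots of \<open>q\<close> and \<open>t\<close>.\<close>

locale interpolation_family = perfect_grid V w c0 c1 d0 d1 e q0 q1 q2
  for V w :: "int \<Rightarrow> int \<Rightarrow> 'k::field_char_0" and c0 c1 d0 d1 e q0 q1 q2 +
  fixes F :: "'f::field itp_family" and n :: nat and u :: "nat \<Rightarrow> nat \<Rightarrow> 'f" and \<iota> :: "'f \<Rightarrow> 'k"
  assumes degfac_pos: "fam_degfac F > 0"
    and gen_degree: "i \<in> {1..n} \<Longrightarrow> laurent_degree (fam_gen F i) \<le> fam_degfac F"
    and gen_permute: "\<pi> permutes {1..n} \<Longrightarrow> i \<in> {1..n} \<Longrightarrow> permute_vars \<pi> (fam_gen F i) = fam_gen F (\<pi> i)"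
    and eval_mult: "p \<in> generated_algebra (fam_gen F ` {1..n}) \<Longrightarrow> r \<in> generated_algebra (fam_gen F ` {1..n}) \<Longrightarrow>
       lam \<in> partitions n \<Longrightarrow> laurent_eval (fam_shift F n lam) (p * r) =
         laurent_eval (fam_shift F n lam) p * laurent_eval (fam_shift F n lam) r"
    and eval_gen: "i \<in> {1..n} \<Longrightarrow> lam \<in> partitions n \<Longrightarrow>
       laurent_eval (fam_shift F n lam) (fam_gen F i) = u i (lam i)"
    and norm1_shift: "i \<in> {1..n} \<Longrightarrow> lam \<in> partitions n \<Longrightarrow> fam_norm1 F (fam_shift F n lam i) = u i (lam i)"
    and Lam_normal: "p \<in> Lam F n \<Longrightarrow> m \<in> Poly_Mapping.keys p \<Longrightarrow> Poly_Mapping.keys m \<subseteq> {1..n} \<and>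
       (\<exists>k. Poly_Mapping.lookup p (expo (fam_degfac F) n k) = Poly_Mapping.lookup p m \<and>
            (\<forall>i\<in>{1..n}. \<bar>Poly_Mapping.lookup m i\<bar> = int (fam_degfac F * k i)))"
    and \<iota>_add: "\<iota> (a + b) = \<iota> a + \<iota> b"
    and \<iota>_mult: "\<iota> (a * b) = \<iota> a * \<iota> b"
    and \<iota>_1: "\<iota> 1 = 1"
    and \<iota>_u: "i \<in> {1..n} \<Longrightarrow> \<iota> (u i k) = V (2 * int k) (2 * (int n - int i))"
    and norm_neq: "lam \<in> partitions n \<Longrightarrow> \<mu> \<in> partitions n \<Longrightarrow> psize n lam \<noteq> psize n \<mu> \<Longrightarrow>
       fam_norm F n (fam_shift F n lam) \<noteq> fam_norm F n (fam_shift F n \<mu>)"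
begin

abbreviation ev :: "partition \<Rightarrow> 'f laurent \<Rightarrow> 'f" where
  "ev lam p \<equiv> laurent_eval (fam_shift F n lam) p"

lemma \<iota>_0: "\<iota> 0 = 0"
  using \<iota>_add[of 0 0] by simp

lemma \<iota>_sum: "\<iota> (\<Sum>a\<in>A. f a) = (\<Sum>a\<in>A. \<iota> (f a))"
  by (induction A rule: infinite_finite_induct) (auto simp: \<iota>_0 \<iota>_add)

lemma \<iota>_prod: "\<iota> (\<Prod>a\<in>A. f a) = (\<Prod>a\<in>A. \<iota> (f a))"
  by (induction A rule: infinite_finite_induct) (auto simp: \<iota>_1 \<iota>_mult)

lemma \<iota>_eq_0: "\<iota> a = 0 \<longleftrightarrow> a = 0"
proof
  assume *: "\<iota> a = 0"
  show "a = 0"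
  proof (rule ccontr)
    assume "a \<noteq> 0"
    then have "\<iota> (a * inverse a) = 1" by (simp add: \<iota>_1)
    then show False using * by (simp add: \<iota>_mult)
  qed
qed (simp add: \<iota>_0)

lemma u_inj:
  assumes "i \<in> {1..n}" "j \<in> {1..n}" "u i a = u j b" shows "a = b"
proof -
  have "V (2 * int a) (2 * (int n - int i)) = V (2 * int b) (2 * (int n - int j))"
    using assms \<iota>_u by metis
  then show ?thesis using V_inj by fastforce
qed

lemma Lam_generated: "p \<in> Lam F n \<Longrightarrow> p \<in> generated_algebra (fam_gen F ` {1..n})"
  by (simp add: Lam_def)

lemma ev_mult: "p \<in> Lam F n \<Longrightarrow> r \<in> Lam F n \<Longrightarrow> lam \<in> partitions n \<Longrightarrow> ev lam (p * r) = ev lam p * ev lam r"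
  by (intro eval_mult Lam_generated)

lemma ev_cmult: "p \<in> Lam F n \<Longrightarrow> lam \<in> partitions n \<Longrightarrow> ev lam (lconst c * p) = c * ev lam p"
  by (simp add: ev_mult Lam_lconst)

lemma ev_lincomb:
  assumes "\<And>a. a \<in> A \<Longrightarrow> p a \<in> Lam F n" "lam \<in> partitions n"
  shows "ev lam (\<Sum>a\<in>A. lconst (c a) * p a) = (\<Sum>a\<in>A. c a * ev lam (p a))"
  unfolding laurent_eval_sum by (intro sum.cong refl ev_cmult assms)

section \<open>Elements of \<Lambda> whose grid values are given by a polynomial function\<close>

text \<open>The polynomial function over the larger field is what annihilators act on. Carrying it
  along with the element avoids having to extract it from a symmetric Laurent polynomial: everything
  built from \<open>es\<close> has one, and \<open>sym_elemI\<close> finally supplies it for all of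
  \<Lambda>.\<close>

definition sym_elem :: "nat \<Rightarrow> 'f laurent \<Rightarrow> bool" where
  "sym_elem d p \<longleftrightarrow> p \<in> Lam F n \<and> laurent_degree p \<le> fam_degfac F * d \<and>
     (\<exists>f. poly_fun n (int d) f \<and> sym_fun n f \<and> (\<forall>lam\<in>partitions n. \<iota> (ev lam p) = f (node 0 0 n lam)))"

lemma sym_elem_Lam: "sym_elem d p \<Longrightarrow> p \<in> Lam F n"
  by (simp add: sym_elem_def)

lemma sym_elem_degree: "sym_elem d p \<Longrightarrow> laurent_degree p \<le> fam_degfac F * d"
  by (simp add: sym_elem_def)

lemma sym_elem_mono: "sym_elem d p \<Longrightarrow> d \<le> d' \<Longrightarrow> sym_elem d' p"
  unfolding sym_elem_def
  by (meson le_trans mult_le_mono2 of_nat_le_iff poly_fun_mono)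

lemma sym_elem_lconst: "sym_elem d (lconst c)"
  unfolding sym_elem_def
  by (intro conjI exI[of _ "\<lambda>_. \<iota> c"]) (auto simp: Lam_lconst poly_fun_const sym_fun_def)

lemma sym_elem_add:
  assumes "sym_elem d p" "sym_elem d r" shows "sym_elem d (p + r)"
proof -
  obtain f g where "poly_fun n (int d) f" "sym_fun n f" "\<forall>lam\<in>partitions n. \<iota> (ev lam p) = f (node 0 0 n lam)"
    "poly_fun n (int d) g" "sym_fun n g" "\<forall>lam\<in>partitions n. \<iota> (ev lam r) = g (node 0 0 n lam)"
    using assms unfolding sym_elem_def by blast
  then have "\<exists>f. poly_fun n (int d) f \<and> sym_fun n f \<and> (\<forall>lam\<in>partitions n. \<iota> (ev lam (p + r)) = f (node 0 0 n lam))"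
    by (intro exI[of _ "\<lambda>y. f y + g y"]) (auto simp: sym_fun_def poly_fun_add laurent_eval_add \<iota>_add)
  then show ?thesis using assms unfolding sym_elem_def by (auto intro: Lam_add laurent_degree_add_le)
qed

lemma sym_elem_mult:
  assumes "sym_elem d p" "sym_elem d' r" shows "sym_elem (d + d') (p * r)"
proof -
  obtain f g where "poly_fun n (int d) f" "sym_fun n f" "\<forall>lam\<in>partitions n. \<iota> (ev lam p) = f (node 0 0 n lam)"
    "poly_fun n (int d') g" "sym_fun n g" "\<forall>lam\<in>partitions n. \<iota> (ev lam r) = g (node 0 0 n lam)"
    using assms unfolding sym_elem_def by blast
  then have "\<exists>f. poly_fun n (int (d + d')) f \<and> sym_fun n f \<and> (\<forall>lam\<in>partitions n. \<iota> (ev lam (p * r)) = f (node 0 0 n lam))"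
    using assms[THEN sym_elem_Lam]
    by (intro exI[of _ "\<lambda>y. f y * g y"]) (auto simp: sym_fun_def poly_fun_mult ev_mult \<iota>_mult)
  then show ?thesis using assms laurent_degree_mult_le[of p _ r]
    unfolding sym_elem_def by (auto intro: Lam_mult simp: distrib_left)
qed

lemma sym_elem_sum:
  assumes "\<And>a. a \<in> A \<Longrightarrow> sym_elem d (p a)" shows "sym_elem d (\<Sum>a\<in>A. p a)"
proof -
  have "sym_elem d 0" using sym_elem_lconst[of d 0] by simp
  then show ?thesis using assms by (induction A rule: infinite_finite_induct) (auto intro: sym_elem_add)
qed

lemma sym_elem_prod:
  assumes "\<And>a. a \<in> A \<Longrightarrow> sym_elem (d a) (p a)" shows "sym_elem (\<Sum>a\<in>A. d a) (\<Prod>a\<in>A. p a)"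
proof -
  have "sym_elem 0 1" using sym_elem_lconst[of 0 1] by simp
  then show ?thesis using assms
    by (induction A rule: infinite_finite_induct) (auto intro: sym_elem_mult)
qed

lemma sym_elem_cmult: "sym_elem d p \<Longrightarrow> sym_elem d (lconst c * p)"
  using sym_elem_mult[OF sym_elem_lconst[of 0 c], of d p] by simp

lemma ev_prod:
  assumes "\<And>a. a \<in> A \<Longrightarrow> p a \<in> Lam F n" "lam \<in> partitions n"
  shows "ev lam (\<Prod>a\<in>A. p a) = (\<Prod>a\<in>A. ev lam (p a))"
proof -
  have 1: "ev lam 1 = 1" using laurent_eval_lconst[of "fam_shift F n lam" 1] by simp
  have "(\<Prod>a\<in>A. p a) \<in> Lam F n \<and> ev lam (\<Prod>a\<in>A. p a) = (\<Prod>a\<in>A. ev lam (p a))"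
    using assms Lam_lconst[of 1 F n]
    by (induction A rule: infinite_finite_induct) (auto simp: 1 ev_mult intro: Lam_mult)
  then show ?thesis by blast
qed

lemma ev_es:
  assumes "lam \<in> partitions n"
  shows "ev lam (es (fam_gen F) {1..n} j) = es (\<lambda>i. u i (lam i)) {1..n} j"
proof -
  have 1: "ev lam 1 = 1" using laurent_eval_lconst[of "fam_shift F n lam" 1] by simp
  have "ev lam (\<Prod>i\<in>B. fam_gen F i) = (\<Prod>i\<in>B. u i (lam i))" if "B \<subseteq> {1..n}" for B
    using finite_subset[OF that] that
  proof (induction B rule: infinite_finite_induct)
    case (insert i B)
    have "ev lam (fam_gen F i * (\<Prod>i\<in>B. fam_gen F i)) = ev lam (fam_gen F i) * ev lam (\<Prod>i\<in>B. fam_gen F i)"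
      using insert assms by (intro eval_mult generated_algebra_prod generated_algebra.gen) auto
    then show ?case using insert assms eval_gen[of i lam] by auto
  qed (auto simp: 1)
  then show ?thesis unfolding es_def laurent_eval_sum by (intro sum.cong) auto
qed

lemma sym_elem_es: "sym_elem j (es (fam_gen F) {1..n} j)"
proof -
  have deg: "laurent_degree (\<Prod>i\<in>B. fam_gen F i) \<le> fam_degfac F * card B" if "B \<subseteq> {1..n}" for B
    using finite_subset[OF that] that
  proof (induction B rule: infinite_finite_induct)
    case (insert i B)
    then have "laurent_degree (fam_gen F i * (\<Prod>i\<in>B. fam_gen F i)) \<le> fam_degfac F + fam_degfac F * card B"
      by (intro laurent_degree_mult_le gen_degree) auto
    then show ?case using insert by simp
  qed (use laurent_degree_lconst[of "1 :: 'f"] in auto)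
  have degs: "laurent_degree (\<Sum>B\<in>S. \<Prod>i\<in>B. fam_gen F i) \<le> fam_degfac F * j"
    if "S \<subseteq> {B. B \<subseteq> {1..n} \<and> card B = j}" for S
    using that
  proof (induction S rule: infinite_finite_induct)
    case (insert B S)
    then show ?case using deg[of B] by (auto intro!: laurent_degree_add_le)
  qed (use laurent_degree_lconst[of "0 :: 'f"] in auto)
  have "permute_vars \<pi> (es (fam_gen F) {1..n} j) = es (fam_gen F) {1..n} j" if \<pi>: "\<pi> permutes {1..n}" for \<pi>
  proof -
    have "permute_vars \<pi> (es (fam_gen F) {1..n} j) = es (\<lambda>i. fam_gen F (\<pi> i)) {1..n} j"
      unfolding es_def permute_vars_sum[OF permutes_bij[OF \<pi>]] permute_vars_prod[OF permutes_bij[OF \<pi>]]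
      by (intro sum.cong prod.cong refl gen_permute[OF \<pi>]) auto
    then show ?thesis unfolding es_permute[OF \<pi>] .
  qed
  moreover have "es (fam_gen F) {1..n} j \<in> generated_algebra (fam_gen F ` {1..n})"
    unfolding es_def by (intro generated_algebra_sum generated_algebra_prod generated_algebra.gen) auto
  ultimately have Lam: "es (fam_gen F) {1..n} j \<in> Lam F n"
    by (simp add: Lam_def symmetric_laurent_iff)
  have "poly_fun n (int j) (\<lambda>y :: nat \<Rightarrow> 'k. es y {..<n} j)"
    unfolding es_def
  proof (rule poly_fun_sum)
    fix B assume "B \<in> {B. B \<subseteq> {..<n} \<and> card B = j}"
    then show "poly_fun n (int j) (\<lambda>y :: nat \<Rightarrow> 'k. prod y B)"
      using poly_fun_prod[of B n "\<lambda>_. 1" "\<lambda>i y. y i :: 'k"] by (auto intro: poly_fun_var)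
  qed
  moreover have "sym_fun n (\<lambda>y :: nat \<Rightarrow> 'k. es y {..<n} j)"
    by (auto simp: sym_fun_def o_def es_permute)
  moreover have "\<iota> (ev lam (es (fam_gen F) {1..n} j)) = es (node 0 0 n lam) {..<n} j" if "lam \<in> partitions n" for lam
  proof -
    have "\<iota> (ev lam (es (fam_gen F) {1..n} j)) = es (\<lambda>i. \<iota> (u i (lam i))) (Suc ` {..<n}) j"
      unfolding ev_es[OF that] by (simp add: es_def \<iota>_sum \<iota>_prod image_Suc_lessThan)
    also have "\<dots> = es (\<lambda>i. \<iota> (u (Suc i) (lam (Suc i)))) {..<n} j"
      by (rule es_image[symmetric]) auto
    also have "\<dots> = es (node 0 0 n lam) {..<n} j"
      unfolding es_def by (intro sum.cong prod.cong refl) (auto simp: node_def \<iota>_u algebra_simps)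
    finally show ?thesis .
  qed
  ultimately show ?thesis
    using Lam degs[OF order.refl] unfolding sym_elem_def es_def[of "fam_gen F"] by blast
qed

text \<open>When the variables beyond \<open>r\<close> are specialised as in \<open>\<mu>\<close>, the product over the first \<open>r\<close>
  variables extends to a symmetric polynomial of degree \<open>r\<close> in all variables. Multiplying such
  extensions over the columns of \<open>\<mu>\<close> gives the colexicographically triangular elements below.\<close>

lemma column_factor:
  assumes "r \<le> n"
  shows "\<exists>p. sym_elem r p \<and> (\<forall>lam\<in>partitions n. (\<forall>i\<in>{r<..n}. lam i = \<mu> i) \<longrightarrow>
     ev lam p = (\<Prod>i\<in>{1..r}. u i (lam i) - c))"
proof -
  obtain \<gamma> where \<gamma>: "\<And>y. (\<forall>i\<in>{r<..n}. y i = u i (\<mu> i)) \<Longrightarrow>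
      (\<Prod>i\<in>{1..r}. y i - c) = (\<Sum>j\<le>r. \<gamma> j * es y {1..n} j)"
    using es_span_prod[OF assms, of "\<lambda>i. u i (\<mu> i)" c] unfolding es_span_def by auto
  let ?p = "\<Sum>j\<le>r. lconst (\<gamma> j) * es (fam_gen F) {1..n} j"
  have "sym_elem r ?p"
    by (intro sym_elem_sum sym_elem_cmult sym_elem_mono[OF sym_elem_es]) auto
  moreover have "ev lam ?p = (\<Prod>i\<in>{1..r}. u i (lam i) - c)"
    if "lam \<in> partitions n" "\<forall>i\<in>{r<..n}. lam i = \<mu> i" for lam
    unfolding ev_lincomb[OF sym_elem_Lam[OF sym_elem_es] that(1)] ev_es[OF that(1)]
    using \<gamma>[of "\<lambda>i. u i (lam i)"] that(2) by simp
  ultimately show ?thesis by blast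
qed

text \<open>The factor for column \<open>j\<close> has its root at the value that the last row of
  this column would have with only \<open>j - 1\<close> cells. At \<open>\<mu>\<close> the rows
  meeting column \<open>j\<close> have at least \<open>j\<close> cells, so by \<open>u_inj\<close>
  no factor vanishes.\<close>

lemma ex_colex_triangular:
  assumes \<mu>: "\<mu> \<in> partitions n"
  shows "\<exists>p. sym_elem (psize n \<mu>) p \<and> ev \<mu> p \<noteq> 0 \<and> (\<forall>lam\<in>partitions n. colex n lam \<mu> \<longrightarrow> ev lam p = 0)"
proof -
  let ?r = "column n \<mu>"
  have r_le: "?r j \<le> n" for j
  proof -
    have "{i \<in> {1..n}. j \<le> \<mu> i} \<subseteq> {1..n}" by auto
    from card_mono[OF _ this] show ?thesis by (simp add: column_def)
  qed
  have "\<exists>p. sym_elem (?r j) p \<and> (\<forall>lam\<in>partitions n. (\<forall>i\<in>{?r j<..n}. lam i = \<mu> i) \<longrightarrow>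
     ev lam p = (\<Prod>i\<in>{1..?r j}. u i (lam i) - u (?r j) (j - 1)))" for j
    by (rule column_factor[OF r_le])
  then have "\<forall>j. \<exists>p. sym_elem (?r j) p \<and> (\<forall>lam\<in>partitions n. (\<forall>i\<in>{?r j<..n}. lam i = \<mu> i) \<longrightarrow>
     ev lam p = (\<Prod>i\<in>{1..?r j}. u i (lam i) - u (?r j) (j - 1)))" by (rule allI)
  from choice[OF this] obtain p where p: "\<And>j. sym_elem (?r j) (p j)"
    "\<And>j lam. lam \<in> partitions n \<Longrightarrow> (\<forall>i\<in>{?r j<..n}. lam i = \<mu> i) \<Longrightarrow>
     ev lam (p j) = (\<Prod>i\<in>{1..?r j}. u i (lam i) - u (?r j) (j - 1))"
    by blast
  have ev_eq: "ev lam (\<Prod>j\<in>{1..\<mu> 1}. p j) = (\<Prod>j\<in>{1..\<mu> 1}. ev lam (p j))"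
    if "lam \<in> partitions n" for lam
    using that by (intro ev_prod sym_elem_Lam[OF p(1)])
  have "sym_elem (psize n \<mu>) (\<Prod>j\<in>{1..\<mu> 1}. p j)"
    using sym_elem_prod[of "{1..\<mu> 1}" ?r p, OF p(1)] unfolding sum_column[OF \<mu>] .
  moreover have "ev \<mu> (p j) \<noteq> 0" if "j \<in> {1..\<mu> 1}" for j
  proof -
    have "u i (\<mu> i) \<noteq> u (?r j) (j - 1)" if "i \<in> {1..?r j}" for i
    proof
      assume eq: "u i (\<mu> i) = u (?r j) (j - 1)"
      have i: "i \<in> {1..n}" "?r j \<in> {1..n}" using that r_le[of j] by auto
      then have "\<mu> i = j - 1" using u_inj[OF _ _ eq] by blast
      moreover have "j \<le> \<mu> i" using column_iff[OF \<mu> i(1)] that by simp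
      ultimately show False using \<open>j \<in> {1..\<mu> 1}\<close> by auto
    qed
    then show ?thesis using p(2)[OF \<mu>] by auto
  qed
  then have "ev \<mu> (\<Prod>j\<in>{1..\<mu> 1}. p j) \<noteq> 0"
    by (subst ev_eq[OF \<mu>]) auto
  moreover have "ev lam (\<Prod>j\<in>{1..\<mu> 1}. p j) = 0" if lam: "lam \<in> partitions n" and less: "colex n lam \<mu>" for lam
  proof -
    obtain k where k: "k \<in> {1..n}" "\<forall>i\<in>{k<..n}. lam i = \<mu> i" "lam k < \<mu> k"
      using less unfolding colex_def by blast
    \<comment> \<open>The first column of \<open>\<mu>\<close> that row \<open>k\<close> of
      \<open>lam\<close> fails to reach ends exactly in row \<open>k\<close>: if it went further
      down, \<open>lam\<close> would agree with \<open>\<mu>\<close> in a longer row below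
      \<open>k\<close>. Its factor for row \<open>k\<close> is therefore zero at
      \<open>lam\<close>.\<close>
    let ?j = "Suc (lam k)"
    have "\<mu> k \<le> \<mu> 1" using \<mu> k(1) by (simp add: partitions_def)
    then have j: "?j \<in> {1..\<mu> 1}" using k by simp
    have "k \<le> ?r ?j" using column_iff[OF \<mu> k(1), of ?j] k(3) by simp
    moreover have "\<not> k < ?r ?j"
    proof
      assume kr: "k < ?r ?j"
      then have "?j \<le> \<mu> (?r ?j)" using column_iff[OF \<mu>, of "?r ?j" ?j] r_le[of ?j] by simp
      moreover have "lam (?r ?j) = \<mu> (?r ?j)" using k(2) kr r_le by auto
      moreover have "lam (?r ?j) \<le> lam k" using lam kr k(1) r_le by (simp add: partitions_def)
      ultimately show False by simp
    qed
    ultimately have r: "?r ?j = k" by simp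
    have "ev lam (p ?j) = (\<Prod>i\<in>{1..k}. u i (lam i) - u k (lam k))"
      using p(2)[OF lam, of ?j] k(2) unfolding r by simp
    also have "\<dots> = 0" using k(1) by auto
    finally show ?thesis using j ev_eq[OF lam] by (metis finite_atLeastAtMost prod_zero)
  qed
  ultimately show ?thesis by blast
qed

text \<open>The triangular element of the colexicographically largest point vanishes at all other
  points of \<open>S\<close>, so it corrects the value at that point without disturbing the
  rest.\<close>

lemma ex_interpolant_on:
  assumes "finite S" "S \<subseteq> {lam \<in> partitions n. psize n lam \<le> d}"
  shows "\<exists>p. sym_elem d p \<and> (\<forall>lam\<in>S. ev lam p = \<phi> lam)"
  using assms
proof (induction "card S" arbitrary: S)
  case 0
  then show ?case using sym_elem_lconst by auto
next
  case (Suc k)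
  then have "S \<noteq> {}" by auto
  then obtain m where m: "m \<in> S" "\<And>x. x \<in> S \<Longrightarrow> x \<noteq> m \<Longrightarrow> colex n x m"
    using colex_max[of S n] Suc.prems by blast
  have mp: "m \<in> partitions n" "psize n m \<le> d" using m(1) Suc.prems by auto
  have "k = card (S - {m})" using Suc.hyps(2) m(1) Suc.prems by simp
  obtain p where p: "sym_elem d p" "\<forall>lam\<in>S - {m}. ev lam p = \<phi> lam"
    using Suc.hyps(1)[of "S - {m}"] Suc.prems \<open>k = card (S - {m})\<close> by (blast intro: finite_Diff)
  obtain g where g: "sym_elem (psize n m) g" "ev m g \<noteq> 0" "\<forall>lam\<in>partitions n. colex n lam m \<longrightarrow> ev lam g = 0"
    using ex_colex_triangular[OF mp(1)] by blast
  let ?p = "p + lconst ((\<phi> m - ev m p) / ev m g) * g"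
  have "sym_elem d ?p"
    by (intro sym_elem_add p(1) sym_elem_cmult sym_elem_mono[OF g(1) mp(2)])
  moreover have "ev lam ?p = \<phi> lam" if "lam \<in> S" for lam
    using that m(2)[OF that] p(2) g(2,3) Suc.prems sym_elem_Lam[OF g(1)]
    by (cases "lam = m") (auto simp: laurent_eval_add ev_cmult subset_iff)
  ultimately show ?case by blast
qed

lemma ex_interpolant:
  "\<exists>p. sym_elem d p \<and> (\<forall>lam\<in>partitions n. psize n lam \<le> d \<longrightarrow> ev lam p = \<phi> lam)"
  using ex_interpolant_on[OF finite_partitions_le order.refl, of d \<phi>] by blast

text \<open>There are only as many coefficients at dominant exponents as there are interpolation points,
  so the triangular elements together with a nonzero \<open>p\<close> vanishing at all points would be
  linearly dependent, and evaluating the relation shows that only \<open>p\<close> occurs in it.\<close>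

lemma Lam_eq_0:
  assumes p: "p \<in> Lam F n" "laurent_degree p \<le> fam_degfac F * d"
    and zero: "\<And>lam. lam \<in> partitions n \<Longrightarrow> psize n lam \<le> d \<Longrightarrow> ev lam p = 0"
  shows "p = 0"
proof -
  let ?S = "{lam \<in> partitions n. psize n lam \<le> d}"
  have "\<forall>\<mu>\<in>partitions n. \<exists>g. sym_elem (psize n \<mu>) g \<and> ev \<mu> g \<noteq> 0 \<and>
      (\<forall>lam\<in>partitions n. colex n lam \<mu> \<longrightarrow> ev lam g = 0)"
    using ex_colex_triangular by blast
  from bchoice[OF this] obtain g where g: "\<And>\<mu>. \<mu> \<in> partitions n \<Longrightarrow> sym_elem (psize n \<mu>) (g \<mu>)"
    "\<And>\<mu>. \<mu> \<in> partitions n \<Longrightarrow> ev \<mu> (g \<mu>) \<noteq> 0"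
    "\<And>\<mu> lam. \<mu> \<in> partitions n \<Longrightarrow> lam \<in> partitions n \<Longrightarrow> colex n lam \<mu> \<Longrightarrow> ev lam (g \<mu>) = 0"
    by blast
  \<comment> \<open>\<open>None\<close> stands for the unknown \<open>p\<close>,
    \<open>Some \<mu>\<close> for the triangular element of \<open>\<mu>\<close>; this gives one
    element more than there are dominant exponents.\<close>
  define h where "h = case_option p g"
  define A where "A = insert None (Some ` ?S)"
  have finA: "finite A" using finite_partitions_le by (simp add: A_def)
  have "card A = Suc (card ?S)"
    unfolding A_def using finite_partitions_le by (subst card_insert_disjoint) (auto simp: card_image)
  then obtain c where c: "\<exists>a\<in>A. c a \<noteq> 0"
    "\<And>lam. lam \<in> ?S \<Longrightarrow> (\<Sum>a\<in>A. c a * Poly_Mapping.lookup (h a) (expo (fam_degfac F) n lam)) = 0"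
    using finite_card_lt_kernel[OF finite_partitions_le[of n d] finA,
      of "\<lambda>a lam. Poly_Mapping.lookup (h a) (expo (fam_degfac F) n lam)"] by auto
  have hL: "h a \<in> Lam F n" and hd: "laurent_degree (h a) \<le> fam_degfac F * d" if "a \<in> A" for a
    using that p sym_elem_Lam[OF g(1)] sym_elem_degree[OF sym_elem_mono[OF g(1)]] unfolding A_def h_def by auto
  define s where "s = (\<Sum>a\<in>A. lconst (c a) * h a)"
  have sL: "s \<in> Lam F n"
    unfolding s_def by (intro Lam_sum Lam_mult Lam_lconst hL)
  have "laurent_degree (\<Sum>a\<in>B. lconst (c a) * h a) \<le> fam_degfac F * d" if "B \<subseteq> A" for B
    using finite_subset[OF that finA] that
  proof (induction B rule: finite_induct)
    case (insert a B)
    then have "laurent_degree (lconst (c a) * h a) \<le> 0 + fam_degfac F * d"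
      by (intro laurent_degree_mult_le hd) auto
    then show ?case using insert by (auto intro: laurent_degree_add_le)
  qed (use laurent_degree_lconst[of "0 :: 'f"] in auto)
  then have sd: "laurent_degree s \<le> fam_degfac F * d" unfolding s_def by blast
  have s0: "s = 0"
  proof (rule symmetric_laurent_determined[OF _ sd degfac_pos])
    show "symmetric_laurent n s" using sL by (simp add: Lam_def)
    show "Poly_Mapping.lookup s (expo (fam_degfac F) n lam) = 0"
      if "lam \<in> partitions n" "psize n lam \<le> d" for lam
      using c(2)[of lam] that by (simp add: s_def lookup_sum lookup_lconst_mult)
  qed (use Lam_normal[OF sL] in blast)
  have ev_rel: "(\<Sum>\<mu>\<in>?S. c (Some \<mu>) * ev lam (g \<mu>)) = 0" if lam: "lam \<in> ?S" for lam
  proof -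
    have "ev lam s = (\<Sum>a\<in>A. c a * ev lam (h a))"
      unfolding s_def using lam by (intro ev_lincomb hL) auto
    also have "\<dots> = c None * ev lam p + (\<Sum>\<mu>\<in>?S. c (Some \<mu>) * ev lam (g \<mu>))"
      unfolding A_def using finite_partitions_le
      by (subst sum.insert) (auto simp: h_def sum.reindex)
    finally show ?thesis using zero lam by (simp add: s0)
  qed
  have cS: "c (Some \<mu>) = 0" if "\<mu> \<in> ?S" for \<mu>
  proof (rule ccontr)
    assume "c (Some \<mu>) \<noteq> 0"
    let ?T = "{\<mu> \<in> ?S. c (Some \<mu>) \<noteq> 0}"
    have "?T \<noteq> {}" using that \<open>c (Some \<mu>) \<noteq> 0\<close> by blast
    \<comment> \<open>At the colexicographically least \<open>m\<close> that occurs, the triangular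
      elements of the other occurring indices vanish, so the relation collapses to a nonzero
      multiple of \<open>ev m (g m)\<close>.\<close>
    then obtain m where m: "m \<in> ?T" "\<And>x. x \<in> ?T \<Longrightarrow> x \<noteq> m \<Longrightarrow> colex n m x"
      using colex_min[of ?T n] finite_partitions_le[of n d] by (auto simp del: mem_Collect_eq)
    have "(\<Sum>\<mu>\<in>?S. c (Some \<mu>) * ev m (g \<mu>)) = (\<Sum>\<mu>\<in>{m}. c (Some \<mu>) * ev m (g \<mu>))"
    proof (rule sum.mono_neutral_right)
      show "\<forall>i\<in>?S - {m}. c (Some i) * ev m (g i) = 0"
      proof
        fix i assume i: "i \<in> ?S - {m}"
        show "c (Some i) * ev m (g i) = 0"
          using m(1) m(2)[of i] g(3)[of i m] i by (cases "c (Some i) = 0") auto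
      qed
    qed (use finite_partitions_le m in auto)
    then show False using ev_rel[of m] m(1) g(2)[of m] by auto
  qed
  then have "s = lconst (c None) * p"
    unfolding s_def A_def using finite_partitions_le
    by (subst sum.insert) (auto simp: h_def sum.reindex)
  moreover have "c None \<noteq> 0" using c(1) cS unfolding A_def by auto
  ultimately have "lconst (inverse (c None)) * (lconst (c None) * p) = 0" using s0 by simp
  moreover have "lconst (inverse (c None)) * lconst (c None) = 1"
    using \<open>c None \<noteq> 0\<close> by (simp flip: lconst_mult)
  ultimately show ?thesis by (simp flip: mult.assoc)
qed

lemma Lam_diff: "p \<in> Lam F n \<Longrightarrow> r \<in> Lam F n \<Longrightarrow> p - r \<in> Lam F n"
  using Lam_add[OF _ Lam_mult[OF Lam_lconst[of "-1"]], of p F n r] by (simp add: lconst_minus)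

lemma laurent_eval_diff: "laurent_eval x (p - r) = laurent_eval x p - laurent_eval x r"
  using laurent_eval_add[of x "p - r" r] by (simp add: algebra_simps)

lemma laurent_degree_diff_le:
  assumes "laurent_degree p \<le> d" "laurent_degree r \<le> d"
  shows "laurent_degree (p - r :: 'f laurent) \<le> d"
proof -
  have "laurent_degree (lconst (-1) * r) \<le> 0 + d" by (intro laurent_degree_mult_le assms) auto
  then show ?thesis using laurent_degree_add_le[OF assms(1), of "lconst (-1) * r"] by (simp add: lconst_minus)
qed

lemma Lam_eqI:
  assumes "p \<in> Lam F n" "r \<in> Lam F n" "laurent_degree p \<le> fam_degfac F * d" "laurent_degree r \<le> fam_degfac F * d"
    "\<And>lam. lam \<in> partitions n \<Longrightarrow> psize n lam \<le> d \<Longrightarrow> ev lam p = ev lam r"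
  shows "p = r"
  using Lam_eq_0[of "p - r" d] assms
  by (simp add: Lam_diff laurent_eval_diff laurent_degree_diff_le)

text \<open>Interpolate the values of \<open>p\<close> by an element that carries a polynomial
  function; uniqueness identifies the two. This replaces the fundamental theorem on symmetric
  polynomials.\<close>

lemma sym_elemI:
  assumes "p \<in> Lam F n" "laurent_degree p \<le> fam_degfac F * d" shows "sym_elem d p"
proof -
  obtain r where r: "sym_elem d r" "\<forall>lam\<in>partitions n. psize n lam \<le> d \<longrightarrow> ev lam r = ev lam p"
    using ex_interpolant[of d "\<lambda>lam. ev lam p"] by blast
  then have "p = r" using assms sym_elem_Lam sym_elem_degree by (intro Lam_eqI[of _ _ d]) auto
  then show ?thesis using r by simp
qed

section \<open>Characterisation and adjacent vanishing of the interpolation polynomials\<close>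

abbreviation h :: "partition \<Rightarrow> 'f laurent" where
  "h \<mu> \<equiv> itp_poly F n \<mu>"

lemma itp_poly_spec:
  "h \<mu> \<in> Lam F n \<and> laurent_degree (h \<mu>) \<le> fam_degfac F * psize n \<mu> \<and>
     (\<forall>lam\<in>partitions n. psize n lam \<le> psize n \<mu> \<longrightarrow> ev lam (h \<mu>) = (if lam = \<mu> then 1 else 0))"
  unfolding itp_poly_def
proof (rule theI')
  show "\<exists>!h. h \<in> Lam F n \<and> laurent_degree h \<le> fam_degfac F * psize n \<mu> \<and>
     (\<forall>lam\<in>partitions n. psize n lam \<le> psize n \<mu> \<longrightarrow> ev lam h = (if lam = \<mu> then 1 else 0))"
  proof (rule ex_ex1I)
    show "\<exists>h. h \<in> Lam F n \<and> laurent_degree h \<le> fam_degfac F * psize n \<mu> \<and>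
     (\<forall>lam\<in>partitions n. psize n lam \<le> psize n \<mu> \<longrightarrow> ev lam h = (if lam = \<mu> then 1 else 0))"
      using ex_interpolant[of "psize n \<mu>" "\<lambda>lam. if lam = \<mu> then 1 else 0"] sym_elem_Lam sym_elem_degree by blast
  qed (auto intro: Lam_eqI[of _ _ "psize n \<mu>"])
qed

lemmas h_Lam = itp_poly_spec[THEN conjunct1]
  and h_degree = itp_poly_spec[THEN conjunct2, THEN conjunct1]

lemma ev_h: "lam \<in> partitions n \<Longrightarrow> psize n lam \<le> psize n \<mu> \<Longrightarrow> ev lam (h \<mu>) = (if lam = \<mu> then 1 else 0)"
  using itp_poly_spec by blast

lemma h_unique:
  assumes "p \<in> Lam F n" "laurent_degree p \<le> fam_degfac F * psize n \<mu>"
    "\<And>lam. lam \<in> partitions n \<Longrightarrow> psize n lam \<le> psize n \<mu> \<Longrightarrow> ev lam p = (if lam = \<mu> then 1 else 0)"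
  shows "h \<mu> = p"
  using assms h_Lam h_degree ev_h by (intro Lam_eqI[of _ _ "psize n \<mu>"]) auto

text \<open>The annihilator of \<open>\<nu>\<close> kills \<open>h \<mu>\<close>, whose degree bound
  is \<open>psize n \<nu> - 1\<close>. Every \<open>\<kappa>\<close> strictly below
  \<open>\<nu>\<close> has size at most \<open>psize n \<mu>\<close> and differs from
  \<open>\<mu>\<close>, since otherwise \<open>\<nu>\<close> would cover \<open>\<mu>\<close>. So
  \<open>h \<mu>\<close> is zero there, and only the term at \<open>\<nu>\<close>, with its nonzero
  coefficient, is left.\<close>

lemma adjacent_vanishing:
  assumes \<mu>: "\<mu> \<in> partitions n" and \<nu>: "\<nu> \<in> partitions n" and size: "psize n \<nu> = psize n \<mu> + 1"
    and not: "\<not> covers n \<nu> \<mu>"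
  shows "ev \<nu> (h \<mu>) = 0"
proof -
  obtain f where f: "poly_fun n (int (psize n \<mu>)) f" "sym_fun n f"
    "\<And>lam. lam \<in> partitions n \<Longrightarrow> \<iota> (ev lam (h \<mu>)) = f (node 0 0 n lam)"
    using sym_elemI[OF h_Lam h_degree, of \<mu>] unfolding sym_elem_def by blast
  obtain l where l: "l \<nu> \<noteq> 0" "\<And>f d. poly_fun n d f \<Longrightarrow> sym_fun n f \<Longrightarrow> d < int (psize n \<nu>) \<Longrightarrow>
         (\<Sum>\<kappa>\<in>below n \<nu>. l \<kappa> * f (node 0 0 n \<kappa>)) = 0"
    using annihilator[OF \<nu>, of 0 0] by auto
  have "(\<Sum>\<kappa>\<in>below n \<nu>. l \<kappa> * \<iota> (ev \<kappa> (h \<mu>))) = (\<Sum>\<kappa>\<in>{\<nu>}. l \<kappa> * \<iota> (ev \<kappa> (h \<mu>)))"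
  proof (rule sum.mono_neutral_right)
    show "\<forall>\<kappa>\<in>below n \<nu> - {\<nu>}. l \<kappa> * \<iota> (ev \<kappa> (h \<mu>)) = 0"
    proof
      fix \<kappa> assume \<kappa>: "\<kappa> \<in> below n \<nu> - {\<nu>}"
      then have \<kappa>p: "\<kappa> \<in> partitions n" and le: "\<And>i. \<kappa> i \<le> \<nu> i" by (auto simp: below_def)
      obtain i where "\<kappa> i \<noteq> \<nu> i" using \<kappa> by (auto simp: fun_eq_iff)
      moreover from this have "i \<in> {1..n}" using \<nu> le[of i] unfolding partitions_def by fastforce
      ultimately have "psize n \<kappa> < psize n \<nu>"
        unfolding psize_def using le by (intro sum_strict_mono_ex1) (auto simp: le_neq_implies_less intro!: bexI[of _ i])
      moreover have "\<kappa> \<noteq> \<mu>" using not size le by (auto simp: covers_def)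
      ultimately show "l \<kappa> * \<iota> (ev \<kappa> (h \<mu>)) = 0"
        using ev_h[OF \<kappa>p, of \<mu>] size by (simp add: \<iota>_0)
    qed
  qed (use finite_below \<nu> in \<open>auto simp: below_def\<close>)
  moreover have "(\<Sum>\<kappa>\<in>below n \<nu>. l \<kappa> * \<iota> (ev \<kappa> (h \<mu>))) = (\<Sum>\<kappa>\<in>below n \<nu>. l \<kappa> * f (node 0 0 n \<kappa>))"
    using f(3) by (intro sum.cong) (auto simp: below_def)
  ultimately have "l \<nu> * \<iota> (ev \<nu> (h \<mu>)) = 0"
    using l(2)[OF f(1,2)] size by simp
  then show ?thesis using l(1) by (simp add: \<iota>_eq_0)
qed

end

section \<open>Divided differences\<close>

text \<open>The Lagrange form of Newton's divided difference of the data \<open>e\<close> at the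
  nodes \<open>x 0, ..., x k\<close>.\<close>

definition divided_diff :: "(nat \<Rightarrow> 'f::field) \<Rightarrow> (nat \<Rightarrow> 'f) \<Rightarrow> nat \<Rightarrow> 'f" where
  "divided_diff x e k = (\<Sum>j\<le>k. e j / (\<Prod>i\<in>{..k} - {j}. x j - x i))"

text \<open>Over the common denominators of the long divided difference, dropping the last or the
  first node multiplies the term of index \<open>j\<close> by \<open>x j - x (Suc k)\<close> or by
  \<open>x j - x 0\<close>. The difference of these factors does not depend on
  \<open>j\<close>.\<close>

lemma divided_diff_Suc:
  assumes inj: "inj_on x {..Suc k}"
  shows "(x 0 - x (Suc k)) * divided_diff x e (Suc k) =
    divided_diff x e k - divided_diff (\<lambda>i. x (Suc i)) (\<lambda>i. e (Suc i)) k"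
proof -
  let ?P = "\<lambda>j. \<Prod>i\<in>{..Suc k} - {j}. x j - x i"
  have nz: "?P j \<noteq> 0" if "j \<le> Suc k" for j
    using inj that by (auto simp: inj_on_def)
  have 1: "divided_diff x e k = (\<Sum>j\<le>Suc k. e j * (x j - x (Suc k)) / ?P j)"
  proof -
    have "e j / (\<Prod>i\<in>{..k} - {j}. x j - x i) = e j * (x j - x (Suc k)) / ?P j" if "j \<le> k" for j
    proof -
      have "{..Suc k} - {j} = insert (Suc k) ({..k} - {j})" using that by auto
      then have "?P j = (x j - x (Suc k)) * (\<Prod>i\<in>{..k} - {j}. x j - x i)" by simp
      then show ?thesis using nz[of j] that by simp
    qed
    then show ?thesis by (simp add: divided_diff_def)
  qed
  have 2: "divided_diff (\<lambda>i. x (Suc i)) (\<lambda>i. e (Suc i)) k = (\<Sum>j\<le>Suc k. e j * (x j - x 0) / ?P j)"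
  proof -
    have "e (Suc j) / (\<Prod>i\<in>{..k} - {j}. x (Suc j) - x (Suc i)) = e (Suc j) * (x (Suc j) - x 0) / ?P (Suc j)"
      if "j \<le> k" for j
    proof -
      have "{..Suc k} - {Suc j} = insert 0 (Suc ` ({..k} - {j}))"
        by (auto simp: atMost_Suc_eq_insert_0)
      moreover have "(\<Prod>i\<in>Suc ` ({..k} - {j}). x (Suc j) - x i) = (\<Prod>i\<in>{..k} - {j}. x (Suc j) - x (Suc i))"
        by (subst prod.reindex) (auto simp: o_def)
      ultimately have "?P (Suc j) = (x (Suc j) - x 0) * (\<Prod>i\<in>{..k} - {j}. x (Suc j) - x (Suc i))" by simp
      then show ?thesis using nz[of "Suc j"] that by simp
    qed
    then show ?thesis by (simp add: divided_diff_def sum.atMost_Suc_shift del: sum.atMost_Suc)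
  qed
  show ?thesis
    unfolding 1 2 unfolding divided_diff_def sum_distrib_left sum_subtractf[symmetric]
    by (intro sum.cong refl) (simp add: diff_divide_distrib[symmetric] algebra_simps)
qed

section \<open>Saturated chains\<close>

lemma sat_chains_Cons:
  assumes "\<zeta> \<noteq> []"
  shows "lam # \<zeta> \<in> sat_chains n lam \<mu> \<longleftrightarrow>
    lam \<in> partitions n \<and> \<zeta> \<in> sat_chains n (hd \<zeta>) \<mu> \<and> covers n lam (hd \<zeta>)"
proof -
  have all: "(\<forall>i. P i) \<longleftrightarrow> P 0 \<and> (\<forall>i. P (Suc i))" for P :: "nat \<Rightarrow> bool"
    by (metis not0_implies_Suc)
  have "(\<forall>i. Suc i < length (lam # \<zeta>) \<longrightarrow> covers n ((lam # \<zeta>) ! i) ((lam # \<zeta>) ! Suc i)) \<longleftrightarrow>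
    covers n lam (hd \<zeta>) \<and> (\<forall>i. Suc i < length \<zeta> \<longrightarrow> covers n (\<zeta> ! i) (\<zeta> ! Suc i))"
    using assms by (subst all) (auto simp: hd_conv_nth)
  then show ?thesis using assms by (auto simp: sat_chains_def)
qed

lemma sat_chains_snoc:
  assumes "\<zeta> \<noteq> []"
  shows "\<zeta> @ [\<mu>] \<in> sat_chains n lam \<mu> \<longleftrightarrow>
    \<mu> \<in> partitions n \<and> \<zeta> \<in> sat_chains n lam (last \<zeta>) \<and> covers n (last \<zeta>) \<mu>"
proof -
  have "(\<forall>i. Suc i < length (\<zeta> @ [\<mu>]) \<longrightarrow> covers n ((\<zeta> @ [\<mu>]) ! i) ((\<zeta> @ [\<mu>]) ! Suc i)) \<longleftrightarrow>
    covers n (last \<zeta>) \<mu> \<and> (\<forall>i. Suc i < length \<zeta> \<longrightarrow> covers n (\<zeta> ! i) (\<zeta> ! Suc i))" (is "?L \<longleftrightarrow> ?R")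
  proof
    assume L: ?L
    have "covers n (last \<zeta>) \<mu>"
      using L[rule_format, of "length \<zeta> - 1"] assms by (simp add: nth_append last_conv_nth)
    moreover have "covers n (\<zeta> ! i) (\<zeta> ! Suc i)" if "Suc i < length \<zeta>" for i
      using L[rule_format, of i] that by (simp add: nth_append)
    ultimately show ?R by blast
  next
    assume R: ?R
    show ?L
    proof (intro allI impI)
      fix i assume "Suc i < length (\<zeta> @ [\<mu>])"
      then consider "Suc i < length \<zeta>" | "i = length \<zeta> - 1" by fastforce
      then show "covers n ((\<zeta> @ [\<mu>]) ! i) ((\<zeta> @ [\<mu>]) ! Suc i)"
        using R assms by cases (auto simp: nth_append last_conv_nth)
    qed
  qed
  then show ?thesis using assms by (auto simp: sat_chains_def)
qed

lemma sat_chains_psize: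
  assumes "\<zeta> \<in> sat_chains n lam \<mu>" "i < length \<zeta>"
  shows "psize n (\<zeta> ! i) + i = psize n lam"
  using assms(2)
proof (induction i)
  case 0
  then show ?case using assms(1) by (auto simp: sat_chains_def hd_conv_nth)
next
  case (Suc i)
  then have "covers n (\<zeta> ! i) (\<zeta> ! Suc i)" using assms(1) by (auto simp: sat_chains_def)
  then show ?case using Suc by (simp add: covers_def)
qed

lemma sat_chains_length:
  assumes "\<zeta> \<in> sat_chains n lam \<mu>"
  shows "length \<zeta> = Suc (psize n lam - psize n \<mu>)" "psize n \<mu> \<le> psize n lam"
proof -
  have "\<zeta> \<noteq> []" "last \<zeta> = \<mu>" using assms by (auto simp: sat_chains_def)
  then have "psize n \<mu> + (length \<zeta> - 1) = psize n lam"
    using sat_chains_psize[OF assms, of "length \<zeta> - 1"] by (simp add: last_conv_nth)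
  then show "length \<zeta> = Suc (psize n lam - psize n \<mu>)" "psize n \<mu> \<le> psize n lam"
    using \<open>\<zeta> \<noteq> []\<close> by (cases \<zeta>; simp)+
qed

lemma finite_sat_chains: "finite (sat_chains n lam \<mu>)"
proof (rule finite_subset)
  let ?A = "{\<nu> \<in> partitions n. psize n \<nu> \<le> psize n lam}"
  show "sat_chains n lam \<mu> \<subseteq> {xs. set xs \<subseteq> ?A \<and> length xs \<le> Suc (psize n lam)}"
  proof (intro subsetI CollectI conjI)
    fix \<zeta> assume \<zeta>: "\<zeta> \<in> sat_chains n lam \<mu>"
    fix \<nu> assume "\<nu> \<in> set \<zeta>"
    then obtain i where "i < length \<zeta>" "\<nu> = \<zeta> ! i" by (auto simp: in_set_conv_nth)
    then have "psize n \<nu> \<le> psize n lam" using sat_chains_psize[OF \<zeta>, of i] by simp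
    then show "\<nu> \<in> partitions n" "psize n \<nu> \<le> psize n lam"
      using \<zeta> \<open>\<nu> \<in> set \<zeta>\<close> by (auto simp: sat_chains_def)
  next
    fix \<zeta> assume "\<zeta> \<in> sat_chains n lam \<mu>"
    from sat_chains_length(1)[OF this] show "length \<zeta> \<le> Suc (psize n lam)" by simp
  qed
qed (intro finite_lists_length_le finite_partitions_le)

lemma sat_chains_small:
  assumes "lam \<in> partitions n" "psize n lam \<le> psize n \<mu>"
  shows "sat_chains n lam \<mu> = (if lam = \<mu> then {[lam]} else {})"
proof -
  have "\<zeta> = [lam] \<and> lam = \<mu>" if \<zeta>: "\<zeta> \<in> sat_chains n lam \<mu>" for \<zeta>
  proof -
    have "length \<zeta> = 1" using sat_chains_length[OF \<zeta>] assms(2) by simp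
    then obtain x where "\<zeta> = [x]" by (auto simp: length_Suc_conv)
    then show ?thesis using \<zeta> by (auto simp: sat_chains_def)
  qed
  moreover have "[lam] \<in> sat_chains n lam lam" using assms(1) by (simp add: sat_chains_def)
  ultimately show ?thesis by auto
qed

definition upper_covers :: "nat \<Rightarrow> partition \<Rightarrow> partition set" where
  "upper_covers n \<mu> = {\<nu> \<in> partitions n. covers n \<nu> \<mu>}"

definition lower_covers :: "nat \<Rightarrow> partition \<Rightarrow> partition set" where
  "lower_covers n lam = {\<kappa> \<in> partitions n. covers n lam \<kappa>}"

lemma finite_upper_covers: "finite (upper_covers n \<mu>)"
  by (rule finite_subset[OF _ finite_partitions_le[of n "Suc (psize n \<mu>)"]])
     (auto simp: upper_covers_def covers_def)

lemma finite_lower_covers: "finite (lower_covers n lam)"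
  by (rule finite_subset[OF _ finite_partitions_le[of n "psize n lam"]])
     (auto simp: lower_covers_def covers_def)

text \<open>Chains are grouped by their second element; the strict inequality of sizes guarantees
  that there is one.\<close>

lemma sum_sat_chains_Cons:
  assumes "lam \<in> partitions n" "psize n \<mu> < psize n lam"
  shows "(\<Sum>\<zeta>\<in>sat_chains n lam \<mu>. f \<zeta>) =
    (\<Sum>\<kappa>\<in>lower_covers n lam. \<Sum>\<zeta>\<in>sat_chains n \<kappa> \<mu>. f (lam # \<zeta>))"
proof -
  have U: "sat_chains n lam \<mu> = (\<Union>\<kappa>\<in>lower_covers n lam. (#) lam ` sat_chains n \<kappa> \<mu>)"
  proof (intro equalityI subsetI)
    fix \<zeta> assume \<zeta>: "\<zeta> \<in> sat_chains n lam \<mu>"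
    have "length \<zeta> \<ge> 2" using sat_chains_length[OF \<zeta>] assms(2) by simp
    then obtain x \<zeta>' where eq: "\<zeta> = x # \<zeta>'" "\<zeta>' \<noteq> []" by (cases \<zeta>; cases "tl \<zeta>") auto
    then have "x = lam" using \<zeta> by (simp add: sat_chains_def)
    then have *: "\<zeta>' \<in> sat_chains n (hd \<zeta>') \<mu>" "covers n lam (hd \<zeta>')"
      using \<zeta> sat_chains_Cons[OF eq(2)] eq(1) by auto
    moreover have "hd \<zeta>' \<in> partitions n" using *(1) eq(2) by (auto simp: sat_chains_def)
    ultimately show "\<zeta> \<in> (\<Union>\<kappa>\<in>lower_covers n lam. (#) lam ` sat_chains n \<kappa> \<mu>)"
      using eq(1) \<open>x = lam\<close> by (auto simp: lower_covers_def)
  next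
    fix \<zeta> assume "\<zeta> \<in> (\<Union>\<kappa>\<in>lower_covers n lam. (#) lam ` sat_chains n \<kappa> \<mu>)"
    then obtain \<kappa> \<zeta>' where *: "covers n lam \<kappa>" "\<zeta>' \<in> sat_chains n \<kappa> \<mu>" "\<zeta> = lam # \<zeta>'"
      by (auto simp: lower_covers_def)
    then have "\<zeta>' \<noteq> []" "hd \<zeta>' = \<kappa>" by (auto simp: sat_chains_def)
    then show "\<zeta> \<in> sat_chains n lam \<mu>" using * sat_chains_Cons[of \<zeta>' lam n \<mu>] assms(1) by auto
  qed
  have "(\<Sum>\<zeta>\<in>sat_chains n lam \<mu>. f \<zeta>) = (\<Sum>\<kappa>\<in>lower_covers n lam. \<Sum>\<zeta>\<in>(#) lam ` sat_chains n \<kappa> \<mu>. f \<zeta>)"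
    by (subst U, rule sum.UNION_disjoint) (auto simp: finite_lower_covers finite_sat_chains, auto simp: sat_chains_def)
  also have "\<dots> = (\<Sum>\<kappa>\<in>lower_covers n lam. \<Sum>\<zeta>\<in>sat_chains n \<kappa> \<mu>. f (lam # \<zeta>))"
    by (rule sum.cong[OF refl]) (simp add: sum.reindex)
  finally show ?thesis .
qed

lemma sum_sat_chains_snoc:
  assumes "\<mu> \<in> partitions n" "psize n \<mu> < psize n lam"
  shows "(\<Sum>\<zeta>\<in>sat_chains n lam \<mu>. f \<zeta>) =
    (\<Sum>\<nu>\<in>upper_covers n \<mu>. \<Sum>\<zeta>\<in>sat_chains n lam \<nu>. f (\<zeta> @ [\<mu>]))"
proof -
  have U: "sat_chains n lam \<mu> = (\<Union>\<nu>\<in>upper_covers n \<mu>. (\<lambda>\<zeta>. \<zeta> @ [\<mu>]) ` sat_chains n lam \<nu>)"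
  proof (intro equalityI subsetI)
    fix \<zeta> assume \<zeta>: "\<zeta> \<in> sat_chains n lam \<mu>"
    have "length \<zeta> \<ge> 2" using sat_chains_length[OF \<zeta>] assms(2) by simp
    then obtain x \<zeta>' where eq: "\<zeta> = \<zeta>' @ [x]" "\<zeta>' \<noteq> []"
      by (cases \<zeta> rule: rev_cases; cases "butlast \<zeta>") auto
    then have "x = \<mu>" using \<zeta> by (simp add: sat_chains_def)
    then have *: "\<zeta>' \<in> sat_chains n lam (last \<zeta>')" "covers n (last \<zeta>') \<mu>"
      using \<zeta> sat_chains_snoc[OF eq(2)] eq(1) by auto
    moreover have "last \<zeta>' \<in> partitions n" using *(1) eq(2) by (auto simp: sat_chains_def)
    ultimately show "\<zeta> \<in> (\<Union>\<nu>\<in>upper_covers n \<mu>. (\<lambda>\<zeta>. \<zeta> @ [\<mu>]) ` sat_chains n lam \<nu>)"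
      using eq(1) \<open>x = \<mu>\<close> by (auto simp: upper_covers_def)
  next
    fix \<zeta> assume "\<zeta> \<in> (\<Union>\<nu>\<in>upper_covers n \<mu>. (\<lambda>\<zeta>. \<zeta> @ [\<mu>]) ` sat_chains n lam \<nu>)"
    then obtain \<nu> \<zeta>' where *: "covers n \<nu> \<mu>" "\<zeta>' \<in> sat_chains n lam \<nu>" "\<zeta> = \<zeta>' @ [\<mu>]"
      by (auto simp: upper_covers_def)
    then have "\<zeta>' \<noteq> []" "last \<zeta>' = \<nu>" by (auto simp: sat_chains_def)
    then show "\<zeta> \<in> sat_chains n lam \<mu>" using * sat_chains_snoc[of \<zeta>' \<mu> n lam] assms(1) by auto
  qed
  have "(\<Sum>\<zeta>\<in>sat_chains n lam \<mu>. f \<zeta>) =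
      (\<Sum>\<nu>\<in>upper_covers n \<mu>. \<Sum>\<zeta>\<in>(\<lambda>\<zeta>. \<zeta> @ [\<mu>]) ` sat_chains n lam \<nu>. f \<zeta>)"
    by (subst U, rule sum.UNION_disjoint) (auto simp: finite_upper_covers finite_sat_chains, auto simp: sat_chains_def)
  also have "\<dots> = (\<Sum>\<nu>\<in>upper_covers n \<mu>. \<Sum>\<zeta>\<in>sat_chains n lam \<nu>. f (\<zeta> @ [\<mu>]))"
    by (rule sum.cong[OF refl]) (simp add: sum.reindex inj_on_def)
  finally show ?thesis .
qed

section \<open>Structure coefficients\<close>

lemma es_1: "finite A \<Longrightarrow> es y A 1 = (\<Sum>i\<in>A. y i)"
proof -
  have "{B. B \<subseteq> A \<and> card B = 1} = (\<lambda>i. {i}) ` A" by (auto simp: card_1_singleton_iff)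
  then show ?thesis by (simp add: es_def sum.reindex)
qed

context interpolation_family
begin

abbreviation N :: "partition \<Rightarrow> 'f" where
  "N lam \<equiv> fam_norm F n (fam_shift F n lam)"

text \<open>\<open>fam_norm\<close> is only a function of points; products with
  \<open>h \<mu>\<close> need the norm as an element of \<Lambda>.\<close>

abbreviation norm_elem :: "'f laurent" where
  "norm_elem \<equiv> es (fam_gen F) {1..n} 1"

lemma ev_norm_elem:
  assumes "lam \<in> partitions n" shows "ev lam norm_elem = N lam"
proof -
  have "ev lam norm_elem = (\<Sum>i\<in>{1..n}. u i (lam i))"
    using ev_es[OF assms, of 1] unfolding es_1[OF finite_atLeastAtMost] .
  then show ?thesis unfolding fam_norm_def using assms by (simp add: norm1_shift)
qed

text \<open>The left-hand side minus the first summand vanishes at all points of size at most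
  \<open>psize n \<mu>\<close>; in the next size, adjacent vanishing leaves only the covers of \<open>\<mu>\<close>.\<close>

lemma norm_elem_mult_h:
  assumes \<mu>: "\<mu> \<in> partitions n"
  shows "norm_elem * h \<mu> = lconst (N \<mu>) * h \<mu> +
    (\<Sum>\<nu>\<in>upper_covers n \<mu>. lconst ((N \<nu> - N \<mu>) * adj_binom F n \<nu> \<mu>) * h \<nu>)" (is "?l = ?a + ?b")
proof (rule Lam_eqI[of _ _ "psize n \<mu> + 1"])
  have h': "sym_elem (psize n \<mu> + 1) (h \<mu>)" by (rule sym_elem_mono[OF sym_elemI[OF h_Lam h_degree]]) simp
  have "sym_elem (psize n \<mu> + 1) (h \<nu>)" if "\<nu> \<in> upper_covers n \<mu>" for \<nu>
    using sym_elemI[OF h_Lam h_degree, of \<nu>] that by (simp add: upper_covers_def covers_def)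
  then have r: "sym_elem (psize n \<mu> + 1) (?a + ?b)"
    using h' by (intro sym_elem_add sym_elem_sum sym_elem_cmult) auto
  have l: "sym_elem (psize n \<mu> + 1) ?l"
    using sym_elem_mult[OF sym_elem_es[of 1] sym_elemI[OF h_Lam h_degree, of \<mu>]] by simp
  show "?l \<in> Lam F n" "?a + ?b \<in> Lam F n" using l r by (blast intro: sym_elem_Lam)+
  show "laurent_degree ?l \<le> fam_degfac F * (psize n \<mu> + 1)"
    "laurent_degree (?a + ?b) \<le> fam_degfac F * (psize n \<mu> + 1)"
    using l r by (blast intro: sym_elem_degree)+
  fix lam assume lam: "lam \<in> partitions n" "psize n lam \<le> psize n \<mu> + 1"
  have "ev lam ?b = (\<Sum>\<nu>\<in>upper_covers n \<mu>. (N \<nu> - N \<mu>) * adj_binom F n \<nu> \<mu> * ev lam (h \<nu>))"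
    by (rule ev_lincomb[OF h_Lam lam(1)])
  also have "\<dots> = (\<Sum>\<nu>\<in>upper_covers n \<mu>. if lam = \<nu> then (N \<nu> - N \<mu>) * adj_binom F n \<nu> \<mu> else 0)"
    using lam by (intro sum.cong refl) (auto simp: ev_h upper_covers_def covers_def)
  also have "\<dots> = (if lam \<in> upper_covers n \<mu> then (N lam - N \<mu>) * adj_binom F n lam \<mu> else 0)"
    by (rule sum.delta'[OF finite_upper_covers])
  also have "\<dots> = (N lam - N \<mu>) * ev lam (h \<mu>)"
  proof (cases "lam \<in> upper_covers n \<mu>")
    case False
    have "(N lam - N \<mu>) * ev lam (h \<mu>) = 0"
    proof (cases "psize n lam \<le> psize n \<mu>")
      case False
      then show ?thesis using lam \<open>lam \<notin> upper_covers n \<mu>\<close> adjacent_vanishing[OF \<mu> lam(1)]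
        by (auto simp: upper_covers_def)
    qed (use lam in \<open>auto simp: ev_h\<close>)
    then show ?thesis using False by simp
  qed (simp add: adj_binom_def binom_def)
  finally show "ev lam ?l = ev lam (?a + ?b)"
    using lam(1) by (simp only: laurent_eval_add ev_mult[OF sym_elem_Lam[OF sym_elem_es] h_Lam]
      ev_norm_elem ev_cmult[OF h_Lam]) (simp add: algebra_simps)
qed

section \<open>Expansion in the interpolation basis\<close>

text \<open>The condition inside the definite description of \<open>struct_coeff\<close>, for an
  arbitrary left-hand side.\<close>

definition expands :: "'f laurent \<Rightarrow> (partition \<Rightarrow> 'f) \<Rightarrow> bool" where
  "expands p c \<longleftrightarrow> finite {\<nu>. c \<nu> \<noteq> 0} \<and> {\<nu>. c \<nu> \<noteq> 0} \<subseteq> partitions n \<and>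
     p = (\<Sum>\<nu> | c \<nu> \<noteq> 0. lconst (c \<nu>) * h \<nu>)"

lemma expands_superset:
  assumes "expands p c" "finite T" "{\<nu>. c \<nu> \<noteq> 0} \<subseteq> T"
  shows "p = (\<Sum>\<nu>\<in>T. lconst (c \<nu>) * h \<nu>)"
proof -
  have "(\<Sum>\<nu> | c \<nu> \<noteq> 0. lconst (c \<nu>) * h \<nu>) = (\<Sum>\<nu>\<in>T. lconst (c \<nu>) * h \<nu>)"
    by (rule sum.mono_neutral_left) (use assms in auto)
  then show ?thesis using assms(1) by (simp add: expands_def)
qed

lemma expandsI:
  assumes "finite T" "T \<subseteq> partitions n" "\<And>\<nu>. \<nu> \<notin> T \<Longrightarrow> c \<nu> = 0"
    "p = (\<Sum>\<nu>\<in>T. lconst (c \<nu>) * h \<nu>)"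
  shows "expands p c"
  unfolding expands_def
proof (intro conjI)
  have sub: "{\<nu>. c \<nu> \<noteq> 0} \<subseteq> T" using assms(3) by blast
  show "finite {\<nu>. c \<nu> \<noteq> 0}" by (rule finite_subset[OF sub assms(1)])
  show "{\<nu>. c \<nu> \<noteq> 0} \<subseteq> partitions n" using sub assms(2) by blast
  show "p = (\<Sum>\<nu> | c \<nu> \<noteq> 0. lconst (c \<nu>) * h \<nu>)"
    unfolding assms(4) by (rule sum.mono_neutral_right) (use assms(1) sub in auto)
qed

text \<open>At a point \<open>lam\<close>, the polynomials \<open>h \<nu>\<close> with
  \<open>\<nu> \<noteq> lam\<close> of the same or larger size vanish, and by induction the
  coefficients of smaller size are zero. Hence the value at \<open>lam\<close> is the coefficient.
  Applied to \<open>p = 0\<close> this gives uniqueness of expansions.\<close>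

lemma expands_low:
  assumes exp: "expands p c" and vanish: "\<And>\<nu>. \<nu> \<in> partitions n \<Longrightarrow> psize n \<nu> < m \<Longrightarrow> ev \<nu> p = 0"
  shows "lam \<in> partitions n \<Longrightarrow> psize n lam \<le> m \<Longrightarrow> c lam = ev lam p"
proof (induction "psize n lam" arbitrary: lam rule: less_induct)
  case less
  let ?S = "insert lam {\<nu>. c \<nu> \<noteq> 0}"
  have S: "finite ?S" "?S \<subseteq> partitions n" using exp less.prems by (auto simp: expands_def)
  have p: "p = (\<Sum>\<nu>\<in>?S. lconst (c \<nu>) * h \<nu>)" by (rule expands_superset[OF exp S(1)]) auto
  have "ev lam p = (\<Sum>\<nu>\<in>?S. c \<nu> * ev lam (h \<nu>))"
    by (subst p) (rule ev_lincomb[OF h_Lam less.prems(1)])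
  also have "\<dots> = (\<Sum>\<nu>\<in>{lam}. c \<nu> * ev lam (h \<nu>))"
  proof (rule sum.mono_neutral_right)
    show "\<forall>\<nu>\<in>?S - {lam}. c \<nu> * ev lam (h \<nu>) = 0"
    proof
      fix \<nu> assume \<nu>: "\<nu> \<in> ?S - {lam}"
      then have \<nu>p: "\<nu> \<in> partitions n" using S by blast
      show "c \<nu> * ev lam (h \<nu>) = 0"
      proof (cases "psize n \<nu> < psize n lam")
        case True
        then show ?thesis using less.hyps[OF True \<nu>p] less.prems vanish[OF \<nu>p] by simp
      next
        case False
        then show ?thesis using \<nu> less.prems ev_h[of lam \<nu>] by auto
      qed
    qed
  qed (use S in auto)
  finally show ?case using ev_h[OF less.prems(1) order.refl] by simp
qed

lemma expands_cmult_add: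
  assumes "expands p c" "expands r d"
  shows "expands (lconst a * p + r) (\<lambda>\<nu>. a * c \<nu> + d \<nu>)"
proof (rule expandsI)
  let ?T = "{\<nu>. c \<nu> \<noteq> 0} \<union> {\<nu>. d \<nu> \<noteq> 0}"
  show T: "finite ?T" "?T \<subseteq> partitions n" using assms by (auto simp: expands_def)
  have "p = (\<Sum>\<nu>\<in>?T. lconst (c \<nu>) * h \<nu>)" "r = (\<Sum>\<nu>\<in>?T. lconst (d \<nu>) * h \<nu>)"
    by (rule expands_superset[OF _ T(1)]; use assms in blast)+
  then show "lconst a * p + r = (\<Sum>\<nu>\<in>?T. lconst (a * c \<nu> + d \<nu>) * h \<nu>)"
    by (simp only: lconst_add lconst_mult distrib_right sum.distrib sum_distrib_left mult.assoc)
qed auto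

lemma expands_unique:
  assumes "expands p c" "expands p d" shows "c = d"
proof (rule ext)
  fix \<nu>
  have *: "expands (lconst (-1) * p + p) (\<lambda>\<nu>. -1 * c \<nu> + d \<nu>)" by (rule expands_cmult_add[OF assms])
  have "lconst (-1) * p + p = 0" by (simp add: lconst_minus)
  with * have 0: "expands 0 (\<lambda>\<nu>. -1 * c \<nu> + d \<nu>)" by simp
  have "-1 * c \<nu> + d \<nu> = 0" if "\<nu> \<in> partitions n"
    using expands_low[OF 0, of "psize n \<nu>" \<nu>] that by simp
  moreover have "c \<nu> = 0 \<and> d \<nu> = 0" if "\<nu> \<notin> partitions n" using assms that by (auto simp: expands_def)
  ultimately show "c \<nu> = d \<nu>" by (cases "\<nu> \<in> partitions n") auto
qed

lemma expands_h: "\<mu> \<in> partitions n \<Longrightarrow> expands (h \<mu>) (\<lambda>\<nu>. if \<nu> = \<mu> then 1 else 0)"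
  by (rule expandsI[of "{\<mu>}"]) auto

lemma expands_0: "expands 0 (\<lambda>_. 0)"
  by (rule expandsI[of "{}"]) auto

lemma expands_lincomb:
  assumes "\<And>a. a \<in> A \<Longrightarrow> expands (p a) (c a)"
  shows "expands (\<Sum>a\<in>A. lconst (x a) * p a) (\<lambda>\<nu>. \<Sum>a\<in>A. x a * c a \<nu>)"
  using assms by (induction A rule: infinite_finite_induct) (auto intro: expands_0 expands_cmult_add)

text \<open>Interpolation proceeds size by size: on the partitions of size \<open>k\<close> the
  \<open>h \<mu>\<close> of that size are delta functions, and they vanish at all smaller ones. Once
  all sizes up to the degree are matched, uniqueness finishes.\<close>

lemma ex_expands:
  assumes p: "p \<in> Lam F n" shows "\<exists>c. expands p c"
proof -
  let ?d = "laurent_degree p"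
  let ?S = "\<lambda>k. {lam \<in> partitions n. psize n lam < k}"
  have fin: "finite (?S k)" for k
    by (rule finite_subset[OF _ finite_partitions_le[of n k]]) auto
  have "\<exists>c. expands (\<Sum>\<mu>\<in>?S k. lconst (c \<mu>) * h \<mu>) c \<and>
     (\<forall>lam\<in>?S k. ev lam (\<Sum>\<mu>\<in>?S k. lconst (c \<mu>) * h \<mu>) = ev lam p)" for k
  proof (induction k)
    case 0
    show ?case by (intro exI[of _ "\<lambda>_. 0"]) (auto intro: expands_0)
  next
    case (Suc k)
    then obtain c where c: "expands (\<Sum>\<mu>\<in>?S k. lconst (c \<mu>) * h \<mu>) c"
     "\<And>lam. lam \<in> ?S k \<Longrightarrow> ev lam (\<Sum>\<mu>\<in>?S k. lconst (c \<mu>) * h \<mu>) = ev lam p" by blast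
    \<comment> \<open>The new coefficients are the defects that the sum over smaller sizes leaves at
      size \<open>k\<close>.\<close>
    define c' where "c' = (\<lambda>lam. if lam \<in> ?S k then c lam else if lam \<in> partitions n \<and> psize n lam = k
        then ev lam p - ev lam (\<Sum>\<mu>\<in>?S k. lconst (c \<mu>) * h \<mu>) else 0)"
    let ?L = "{lam \<in> partitions n. psize n lam = k}"
    have SL: "?S (Suc k) = ?S k \<union> ?L" "?S k \<inter> ?L = {}" by auto
    have finL: "finite ?L" using fin[of "Suc k"] by (rule finite_subset[rotated]) auto
    have ev_sum: "ev lam (\<Sum>\<mu>\<in>?S (Suc k). lconst (c' \<mu>) * h \<mu>) =
        ev lam (\<Sum>\<mu>\<in>?S k. lconst (c \<mu>) * h \<mu>) + (\<Sum>\<mu>\<in>?L. c' \<mu> * ev lam (h \<mu>))"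
      if "lam \<in> partitions n" for lam
    proof -
      have "ev lam (\<Sum>\<mu>\<in>?S (Suc k). lconst (c' \<mu>) * h \<mu>) = (\<Sum>\<mu>\<in>?S (Suc k). c' \<mu> * ev lam (h \<mu>))"
        by (rule ev_lincomb[OF h_Lam that])
      also have "\<dots> = (\<Sum>\<mu>\<in>?S k. c' \<mu> * ev lam (h \<mu>)) + (\<Sum>\<mu>\<in>?L. c' \<mu> * ev lam (h \<mu>))"
        unfolding SL(1) by (rule sum.union_disjoint[OF fin finL SL(2)])
      also have "(\<Sum>\<mu>\<in>?S k. c' \<mu> * ev lam (h \<mu>)) = (\<Sum>\<mu>\<in>?S k. c \<mu> * ev lam (h \<mu>))"
        by (intro sum.cong refl) (auto simp: c'_def)
      also have "\<dots> = ev lam (\<Sum>\<mu>\<in>?S k. lconst (c \<mu>) * h \<mu>)"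
        by (rule ev_lincomb[OF h_Lam that, symmetric])
      finally show ?thesis .
    qed
    have "ev lam (\<Sum>\<mu>\<in>?S (Suc k). lconst (c' \<mu>) * h \<mu>) = ev lam p" if lam: "lam \<in> ?S (Suc k)" for lam
    proof -
      have lamp: "lam \<in> partitions n" using lam by simp
      have "(\<Sum>\<mu>\<in>?L. c' \<mu> * ev lam (h \<mu>)) = (\<Sum>\<mu>\<in>?L. if lam = \<mu> then c' \<mu> else 0)"
        using lam by (intro sum.cong refl) (auto simp: ev_h)
      also have "\<dots> = (if lam \<in> ?L then c' lam else 0)" by (rule sum.delta'[OF finL])
      finally show ?thesis using ev_sum[OF lamp] c(2)[of lam] lam by (auto simp: c'_def)
    qed
    moreover have "expands (\<Sum>\<mu>\<in>?S (Suc k). lconst (c' \<mu>) * h \<mu>) c'"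
      by (rule expandsI[OF fin _ _ refl]) (auto simp: c'_def)
    ultimately show ?case by blast
  qed
  then obtain c where c: "expands (\<Sum>\<mu>\<in>?S (Suc ?d). lconst (c \<mu>) * h \<mu>) c"
    "\<forall>lam\<in>?S (Suc ?d). ev lam (\<Sum>\<mu>\<in>?S (Suc ?d). lconst (c \<mu>) * h \<mu>) = ev lam p" by blast
  have s: "sym_elem ?d (\<Sum>\<mu>\<in>?S (Suc ?d). lconst (c \<mu>) * h \<mu>)"
    by (intro sym_elem_sum sym_elem_cmult sym_elem_mono[OF sym_elemI[OF h_Lam h_degree]]) auto
  have "p = (\<Sum>\<mu>\<in>?S (Suc ?d). lconst (c \<mu>) * h \<mu>)"
  proof (rule Lam_eqI[OF p sym_elem_Lam[OF s] _ sym_elem_degree[OF s]])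
    \<comment> \<open>Matching all sizes up to \<open>?d\<close> is generous when
      \<open>fam_degfac F\<close> exceeds 1, but it avoids a division of the degree.\<close>
    show "?d \<le> fam_degfac F * ?d" using degfac_pos by simp
  qed (use c(2) in auto)
  then show ?thesis using c(1) by metis
qed

definition coef :: "'f laurent \<Rightarrow> partition \<Rightarrow> 'f" where
  "coef p = (THE c. expands p c)"

lemma coef_eqI: "expands p c \<Longrightarrow> coef p = c"
  unfolding coef_def using expands_unique by blast

lemma expands_coef: "p \<in> Lam F n \<Longrightarrow> expands p (coef p)"
  using ex_expands coef_eqI by metis

lemma struct_coeff_eq: "struct_coeff F n p lam \<mu> = coef (p * h \<mu>) lam"
  by (simp add: struct_coeff_def coef_def expands_def)

lemma coef_lincomb:
  assumes "\<And>a. a \<in> A \<Longrightarrow> p a \<in> Lam F n"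
  shows "coef (\<Sum>a\<in>A. lconst (x a) * p a) lam = (\<Sum>a\<in>A. x a * coef (p a) lam)"
  using coef_eqI[OF expands_lincomb[of A p "\<lambda>a. coef (p a)" x]] expands_coef assms by simp

lemma coef_cmult_add:
  assumes "p \<in> Lam F n" "r \<in> Lam F n"
  shows "coef (lconst a * p + r) lam = a * coef p lam + coef r lam"
  using coef_eqI[OF expands_cmult_add[OF expands_coef expands_coef], OF assms] by simp

lemma coef_h: "\<mu> \<in> partitions n \<Longrightarrow> coef (h \<mu>) lam = (if lam = \<mu> then 1 else 0)"
  by (simp add: coef_eqI[OF expands_h])

text \<open>The transpose of \<open>norm_elem_mult_h\<close>: the basis element of
  \<open>lam\<close> occurs in the product of the norm with \<open>h \<kappa>\<close> only if
  \<open>\<kappa>\<close> is \<open>lam\<close> or is covered by it.\<close>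

lemma coef_norm_elem_mult:
  assumes p: "p \<in> Lam F n" and lam: "lam \<in> partitions n"
  shows "coef (norm_elem * p) lam = N lam * coef p lam +
    (\<Sum>\<kappa>\<in>lower_covers n lam. (N lam - N \<kappa>) * adj_binom F n lam \<kappa> * coef p \<kappa>)"
proof -
  \<comment> \<open>The index set is enlarged by partitions whose coefficient may be zero, so that
    both resulting sums range over all required terms.\<close>
  let ?T = "insert lam ({\<nu>. coef p \<nu> \<noteq> 0} \<union> lower_covers n lam)"
  have exp: "expands p (coef p)" by (rule expands_coef[OF p])
  have T: "finite ?T" "?T \<subseteq> partitions n"
    using exp lam finite_lower_covers by (auto simp: expands_def lower_covers_def)
  have NL: "norm_elem \<in> Lam F n" by (rule sym_elem_Lam[OF sym_elem_es])
  have coef_Nh: "coef (norm_elem * h \<kappa>) lam = (if \<kappa> = lam then N lam else 0) +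
      (if \<kappa> \<in> lower_covers n lam then (N lam - N \<kappa>) * adj_binom F n lam \<kappa> else 0)"
    if \<kappa>: "\<kappa> \<in> partitions n" for \<kappa>
  proof -
    have "coef (norm_elem * h \<kappa>) lam = N \<kappa> * coef (h \<kappa>) lam +
       (\<Sum>\<nu>\<in>upper_covers n \<kappa>. (N \<nu> - N \<kappa>) * adj_binom F n \<nu> \<kappa> * coef (h \<nu>) lam)"
      unfolding norm_elem_mult_h[OF \<kappa>]
      by (simp only: coef_cmult_add[OF h_Lam Lam_sum[OF Lam_mult[OF Lam_lconst h_Lam]]] coef_lincomb[OF h_Lam])
    also have "(\<Sum>\<nu>\<in>upper_covers n \<kappa>. (N \<nu> - N \<kappa>) * adj_binom F n \<nu> \<kappa> * coef (h \<nu>) lam) =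
       (\<Sum>\<nu>\<in>upper_covers n \<kappa>. if lam = \<nu> then (N \<nu> - N \<kappa>) * adj_binom F n \<nu> \<kappa> else 0)"
      by (intro sum.cong refl) (auto simp: coef_h upper_covers_def)
    also have "\<dots> = (if lam \<in> upper_covers n \<kappa> then (N lam - N \<kappa>) * adj_binom F n lam \<kappa> else 0)"
      by (rule sum.delta'[OF finite_upper_covers])
    finally show ?thesis using \<kappa> lam by (auto simp: coef_h upper_covers_def lower_covers_def)
  qed
  have "norm_elem * p = (\<Sum>\<kappa>\<in>?T. lconst (coef p \<kappa>) * (norm_elem * h \<kappa>))"
    by (subst expands_superset[OF exp T(1)]) (auto simp: sum_distrib_left mult.left_commute)
  then have "coef (norm_elem * p) lam = (\<Sum>\<kappa>\<in>?T. coef p \<kappa> * coef (norm_elem * h \<kappa>) lam)"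
    using coef_lincomb[OF Lam_mult[OF NL h_Lam]] by simp
  also have "\<dots> = (\<Sum>\<kappa>\<in>?T. (if lam = \<kappa> then coef p \<kappa> * N lam else 0)) +
     (\<Sum>\<kappa>\<in>?T. if \<kappa> \<in> lower_covers n lam then (N lam - N \<kappa>) * adj_binom F n lam \<kappa> * coef p \<kappa> else 0)"
    unfolding sum.distrib[symmetric]
  proof (rule sum.cong[OF refl])
    fix \<kappa> assume "\<kappa> \<in> ?T"
    then have "\<kappa> \<in> partitions n" using T(2) by blast
    then show "coef p \<kappa> * coef (norm_elem * h \<kappa>) lam = (if lam = \<kappa> then coef p \<kappa> * N lam else 0) +
      (if \<kappa> \<in> lower_covers n lam then (N lam - N \<kappa>) * adj_binom F n lam \<kappa> * coef p \<kappa> else 0)"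
      unfolding coef_Nh[OF \<open>\<kappa> \<in> partitions n\<close>] by (auto simp: distrib_left)
  qed
  also have "(\<Sum>\<kappa>\<in>?T. if lam = \<kappa> then coef p \<kappa> * N lam else 0) = N lam * coef p lam"
    unfolding sum.delta'[OF T(1)] by (simp only: insertI1 if_True mult.commute)
  also have "(\<Sum>\<kappa>\<in>?T. if \<kappa> \<in> lower_covers n lam then (N lam - N \<kappa>) * adj_binom F n lam \<kappa> * coef p \<kappa> else 0) =
     (\<Sum>\<kappa>\<in>lower_covers n lam. (N lam - N \<kappa>) * adj_binom F n lam \<kappa> * coef p \<kappa>)"
    by (rule sum.mono_neutral_cong_right[OF T(1)]) auto
  finally show ?thesis .
qed

text \<open>Attaching the norm to the whole product \<open>p * h \<mu>\<close> produces the diagonal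
  factor \<open>N lam\<close>, attaching it to \<open>h \<mu>\<close> alone produces
  \<open>N \<mu>\<close>; together they give the factor on the left.\<close>

lemma struct_coeff_rec:
  assumes p: "p \<in> Lam F n" and lam: "lam \<in> partitions n" and \<mu>: "\<mu> \<in> partitions n"
  shows "(N lam - N \<mu>) * struct_coeff F n p lam \<mu> =
    (\<Sum>\<nu>\<in>upper_covers n \<mu>. (N \<nu> - N \<mu>) * adj_binom F n \<nu> \<mu> * struct_coeff F n p lam \<nu>) -
    (\<Sum>\<kappa>\<in>lower_covers n lam. (N lam - N \<kappa>) * adj_binom F n lam \<kappa> * struct_coeff F n p \<kappa> \<mu>)"
proof -
  have "norm_elem * (p * h \<mu>) = p * (norm_elem * h \<mu>)" by (rule mult.left_commute)
  also have "\<dots> = lconst (N \<mu>) * (p * h \<mu>) +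
    (\<Sum>\<nu>\<in>upper_covers n \<mu>. lconst ((N \<nu> - N \<mu>) * adj_binom F n \<nu> \<mu>) * (p * h \<nu>))"
    unfolding norm_elem_mult_h[OF \<mu>] by (simp only: distrib_left sum_distrib_left mult.left_commute)
  finally have "coef (norm_elem * (p * h \<mu>)) lam = N \<mu> * coef (p * h \<mu>) lam +
    (\<Sum>\<nu>\<in>upper_covers n \<mu>. (N \<nu> - N \<mu>) * adj_binom F n \<nu> \<mu> * coef (p * h \<nu>) lam)"
    by (simp only: coef_cmult_add[OF Lam_mult[OF p h_Lam] Lam_sum[OF Lam_mult[OF Lam_lconst Lam_mult[OF p h_Lam]]]]
      coef_lincomb[OF Lam_mult[OF p h_Lam]])
  then show ?thesis
    unfolding coef_norm_elem_mult[OF Lam_mult[OF p h_Lam] lam] struct_coeff_eq by (simp add: algebra_simps)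
qed

text \<open>The product \<open>p * h \<mu>\<close> vanishes at all points smaller than
  \<open>\<mu>\<close>, so \<open>expands_low\<close> reads its coefficients off as values. This is
  the base of the recursion.\<close>

lemma struct_coeff_low:
  assumes p: "p \<in> Lam F n" and lam: "lam \<in> partitions n" and le: "psize n lam \<le> psize n \<mu>"
  shows "struct_coeff F n p lam \<mu> = (if lam = \<mu> then ev lam p else 0)"
proof -
  have "coef (p * h \<mu>) lam = ev lam (p * h \<mu>)"
    by (rule expands_low[OF expands_coef[OF Lam_mult[OF p h_Lam]] _ lam le])
       (auto simp: ev_mult[OF p h_Lam] ev_h)
  then show ?thesis using lam le by (auto simp: struct_coeff_eq ev_mult[OF p h_Lam] ev_h)
qed

section \<open>Chain sums and their recursion\<close>

text \<open>The numerator of \<open>wt_LR\<close> is merged with the adjacent coefficients, and the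
  rest of \<open>wt_LR\<close> is the divided difference \<open>chain_diff\<close>. In this form,
  extending a chain at either end multiplies the weight by exactly the factor in
  \<open>norm_elem_mult_h\<close>.\<close>

definition chain_weight :: "partition list \<Rightarrow> 'f" where
  "chain_weight \<zeta> = (\<Prod>i<length \<zeta> - 1. (N (\<zeta> ! i) - N (\<zeta> ! Suc i)) * adj_binom F n (\<zeta> ! i) (\<zeta> ! Suc i))"

definition chain_diff :: "'f laurent \<Rightarrow> partition list \<Rightarrow> 'f" where
  "chain_diff p \<zeta> = divided_diff (\<lambda>i. N (\<zeta> ! i)) (\<lambda>i. ev (\<zeta> ! i) p) (length \<zeta> - 1)"

definition chain_sum :: "'f laurent \<Rightarrow> partition \<Rightarrow> partition \<Rightarrow> 'f" where
  "chain_sum p lam \<mu> = (\<Sum>\<zeta>\<in>sat_chains n lam \<mu>. chain_weight \<zeta> * chain_diff p \<zeta>)"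

lemma chain_sum_eq:
  "(\<Sum>\<zeta>\<in>sat_chains n lam \<mu>. wt_LR F n p \<zeta> *
     (\<Prod>i<psize n lam - psize n \<mu>. adj_binom F n (\<zeta> ! i) (\<zeta> ! Suc i))) = chain_sum p lam \<mu>"
  unfolding chain_sum_def
proof (intro sum.cong refl)
  fix \<zeta> assume "\<zeta> \<in> sat_chains n lam \<mu>"
  then have "psize n lam - psize n \<mu> = length \<zeta> - 1" using sat_chains_length by fastforce
  moreover have "wt_LR F n p \<zeta> = (\<Prod>i<length \<zeta> - 1. N (\<zeta> ! i) - N (\<zeta> ! Suc i)) * chain_diff p \<zeta>"
    by (simp add: wt_LR_def chain_diff_def divided_diff_def chain_norm_def sum_distrib_left
        atLeast0AtMost Let_def mult.commute)
  ultimately show "wt_LR F n p \<zeta> * (\<Prod>i<psize n lam - psize n \<mu>. adj_binom F n (\<zeta> ! i) (\<zeta> ! Suc i)) =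
     chain_weight \<zeta> * chain_diff p \<zeta>"
    by (simp add: chain_weight_def prod.distrib mult_ac)
qed

text \<open>Sizes strictly decrease along a chain and different sizes have different norms; so the
  denominators of the divided differences are nonzero.\<close>

lemma chain_norm_inj:
  assumes "\<zeta> \<in> sat_chains n lam \<mu>"
  shows "inj_on (\<lambda>i. N (\<zeta> ! i)) {..length \<zeta> - 1}"
proof (rule inj_onI)
  fix i j assume ij: "i \<in> {..length \<zeta> - 1}" "j \<in> {..length \<zeta> - 1}" and eq: "N (\<zeta> ! i) = N (\<zeta> ! j)"
  have "length \<zeta> > 0" using assms by (simp add: sat_chains_def)
  then have len: "i < length \<zeta>" "j < length \<zeta>" using ij unfolding atMost_iff by linarith+
  then have "\<zeta> ! i \<in> partitions n" "\<zeta> ! j \<in> partitions n" using assms by (auto simp: sat_chains_def)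
  then have "psize n (\<zeta> ! i) = psize n (\<zeta> ! j)" using norm_neq eq by blast
  then show "i = j" using sat_chains_psize[OF assms] len by (metis add_left_cancel)
qed

lemma chain_weight_Cons:
  "\<zeta> \<noteq> [] \<Longrightarrow> chain_weight (lam # \<zeta>) = (N lam - N (hd \<zeta>)) * adj_binom F n lam (hd \<zeta>) * chain_weight \<zeta>"
proof -
  assume "\<zeta> \<noteq> []"
  then obtain m where "length \<zeta> = Suc m" by (cases \<zeta>) auto
  then show ?thesis using \<open>\<zeta> \<noteq> []\<close>
    by (simp add: chain_weight_def prod.lessThan_Suc_shift hd_conv_nth del: prod.lessThan_Suc)
qed

lemma chain_weight_snoc:
  "\<zeta> \<noteq> [] \<Longrightarrow> chain_weight (\<zeta> @ [\<mu>]) = (N (last \<zeta>) - N \<mu>) * adj_binom F n (last \<zeta>) \<mu> * chain_weight \<zeta>"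
proof -
  assume "\<zeta> \<noteq> []"
  then obtain m where m: "length \<zeta> = Suc m" by (cases \<zeta>) auto
  have "(\<Prod>i<m. (N ((\<zeta> @ [\<mu>]) ! i) - N ((\<zeta> @ [\<mu>]) ! Suc i)) * adj_binom F n ((\<zeta> @ [\<mu>]) ! i) ((\<zeta> @ [\<mu>]) ! Suc i)) =
    (\<Prod>i<m. (N (\<zeta> ! i) - N (\<zeta> ! Suc i)) * adj_binom F n (\<zeta> ! i) (\<zeta> ! Suc i))"
    by (intro prod.cong refl) (auto simp: nth_append m)
  then show ?thesis using \<open>\<zeta> \<noteq> []\<close>
    by (simp add: chain_weight_def m nth_append last_conv_nth)
qed

text \<open>Omitting the last node of the divided difference is \<open>butlast\<close>, omitting the
  first is \<open>tl\<close>; the outer nodes have norms \<open>N lam\<close> and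
  \<open>N \<mu>\<close>.\<close>

lemma chain_diff_rec:
  assumes \<zeta>: "\<zeta> \<in> sat_chains n lam \<mu>" and len: "length \<zeta> \<ge> 2"
  shows "(N lam - N \<mu>) * chain_diff p \<zeta> = chain_diff p (butlast \<zeta>) - chain_diff p (tl \<zeta>)"
proof -
  obtain k where k: "length \<zeta> = Suc (Suc k)" using len by (metis Suc_le_D numeral_2_eq_2 Suc_le_mono)
  have ends: "\<zeta> ! 0 = lam" "\<zeta> ! Suc k = \<mu>"
    using \<zeta> k by (auto simp: sat_chains_def hd_conv_nth last_conv_nth)
  have but: "divided_diff (\<lambda>i. N (butlast \<zeta> ! i)) (\<lambda>i. ev (butlast \<zeta> ! i) p) k =
     divided_diff (\<lambda>i. N (\<zeta> ! i)) (\<lambda>i. ev (\<zeta> ! i) p) k"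
    unfolding divided_diff_def
    by (intro sum.cong refl arg_cong2[of _ _ _ _ "(/)"] prod.cong) (auto simp: nth_butlast k)
  have tl: "divided_diff (\<lambda>i. N (tl \<zeta> ! i)) (\<lambda>i. ev (tl \<zeta> ! i) p) k =
     divided_diff (\<lambda>i. N (\<zeta> ! Suc i)) (\<lambda>i. ev (\<zeta> ! Suc i) p) k"
    unfolding divided_diff_def
    by (intro sum.cong refl arg_cong2[of _ _ _ _ "(/)"] prod.cong) (auto simp: nth_tl k)
  have "inj_on (\<lambda>i. N (\<zeta> ! i)) {..Suc k}" using chain_norm_inj[OF \<zeta>] k by simp
  from divided_diff_Suc[OF this, of "\<lambda>i. ev (\<zeta> ! i) p"] show ?thesis
    using but tl by (simp add: chain_diff_def k ends)
qed

text \<open>The chains without their last element are grouped by the upper cover of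
  \<open>\<mu>\<close> at which they end, those without their first element by the lower cover of
  \<open>lam\<close> at which they start.\<close>

lemma chain_sum_rec:
  assumes lam: "lam \<in> partitions n" and \<mu>: "\<mu> \<in> partitions n" and less: "psize n \<mu> < psize n lam"
  shows "(N lam - N \<mu>) * chain_sum p lam \<mu> =
    (\<Sum>\<nu>\<in>upper_covers n \<mu>. (N \<nu> - N \<mu>) * adj_binom F n \<nu> \<mu> * chain_sum p lam \<nu>) -
    (\<Sum>\<kappa>\<in>lower_covers n lam. (N lam - N \<kappa>) * adj_binom F n lam \<kappa> * chain_sum p \<kappa> \<mu>)"
proof -
  have "(N lam - N \<mu>) * chain_sum p lam \<mu> =
     (\<Sum>\<zeta>\<in>sat_chains n lam \<mu>. chain_weight \<zeta> * ((N lam - N \<mu>) * chain_diff p \<zeta>))"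
    by (simp add: chain_sum_def sum_distrib_left mult_ac)
  also have "\<dots> = (\<Sum>\<zeta>\<in>sat_chains n lam \<mu>. chain_weight \<zeta> * (chain_diff p (butlast \<zeta>) - chain_diff p (tl \<zeta>)))"
  proof (intro sum.cong refl arg_cong2[of _ _ _ _ "(*)"] chain_diff_rec)
    fix \<zeta> assume "\<zeta> \<in> sat_chains n lam \<mu>"
    from sat_chains_length[OF this] show "length \<zeta> \<ge> 2" using less by simp
  qed
  also have "\<dots> = (\<Sum>\<zeta>\<in>sat_chains n lam \<mu>. chain_weight \<zeta> * chain_diff p (butlast \<zeta>)) -
     (\<Sum>\<zeta>\<in>sat_chains n lam \<mu>. chain_weight \<zeta> * chain_diff p (tl \<zeta>))"
    by (simp add: right_diff_distrib sum_subtractf)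
  also have "(\<Sum>\<zeta>\<in>sat_chains n lam \<mu>. chain_weight \<zeta> * chain_diff p (butlast \<zeta>)) =
     (\<Sum>\<nu>\<in>upper_covers n \<mu>. (N \<nu> - N \<mu>) * adj_binom F n \<nu> \<mu> * chain_sum p lam \<nu>)"
    unfolding sum_sat_chains_snoc[OF \<mu> less] chain_sum_def sum_distrib_left
    by (intro sum.cong refl) (auto simp: sat_chains_def chain_weight_snoc)
  also have "(\<Sum>\<zeta>\<in>sat_chains n lam \<mu>. chain_weight \<zeta> * chain_diff p (tl \<zeta>)) =
     (\<Sum>\<kappa>\<in>lower_covers n lam. (N lam - N \<kappa>) * adj_binom F n lam \<kappa> * chain_sum p \<kappa> \<mu>)"
    unfolding sum_sat_chains_Cons[OF lam less] chain_sum_def sum_distrib_left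
    by (intro sum.cong refl) (auto simp: sat_chains_def chain_weight_Cons)
  finally show ?thesis .
qed

text \<open>Both recursions reduce the difference of sizes by one, and
  \<open>N lam - N \<mu>\<close> can be cancelled. When \<open>lam\<close> is not larger than
  \<open>\<mu>\<close>, both sides are the value of \<open>p\<close> for \<open>lam = \<mu>\<close>
  and zero otherwise.\<close>

lemma struct_coeff_chain_sum:
  assumes p: "p \<in> Lam F n" and "lam \<in> partitions n" "\<mu> \<in> partitions n"
  shows "struct_coeff F n p lam \<mu> = chain_sum p lam \<mu>"
  using assms(2,3)
proof (induction "psize n lam - psize n \<mu>" arbitrary: lam \<mu> rule: less_induct)
  case less
  show ?case
  proof (cases "psize n lam \<le> psize n \<mu>")
    case True
    then show ?thesis
      using struct_coeff_low[OF p less.prems(1) True]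
      by (simp add: chain_sum_def sat_chains_small[OF less.prems(1) True] chain_weight_def chain_diff_def divided_diff_def)
  next
    case False
    have "struct_coeff F n p lam \<nu> = chain_sum p lam \<nu>" if "\<nu> \<in> upper_covers n \<mu>" for \<nu>
      using less.hyps[of lam \<nu>] less.prems that False by (auto simp: upper_covers_def covers_def)
    moreover have "struct_coeff F n p \<kappa> \<mu> = chain_sum p \<kappa> \<mu>" if "\<kappa> \<in> lower_covers n lam" for \<kappa>
      using less.hyps[of \<kappa> \<mu>] less.prems that False by (auto simp: lower_covers_def covers_def)
    ultimately have "(N lam - N \<mu>) * struct_coeff F n p lam \<mu> = (N lam - N \<mu>) * chain_sum p lam \<mu>"
      using struct_coeff_rec[OF p less.prems] chain_sum_rec[OF less.prems, of p] False by simp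
    moreover have "N lam - N \<mu> \<noteq> 0" using norm_neq[OF less.prems] False by simp
    ultimately show ?thesis by simp
  qed
qed

theorem struct_coeff_formula:
  assumes "p \<in> Lam F n" "lam \<in> partitions n" "\<mu> \<in> partitions n"
  shows "struct_coeff F n p lam \<mu> = (\<Sum>\<zeta>\<in>sat_chains n lam \<mu>. wt_LR F n p \<zeta> *
     (\<Prod>i<psize n lam - psize n \<mu>. adj_binom F n (\<zeta> ! i) (\<zeta> ! Suc i)))"
  unfolding chain_sum_eq by (rule struct_coeff_chain_sum[OF assms])

lemma zero_partition: "zero_partition \<in> partitions n" "psize n zero_partition = 0"
  by (auto simp: partitions_def zero_partition_def psize_def)

lemma h_zero_partition: "h zero_partition = 1"
proof (rule h_unique)
  have 1: "lconst (1 :: 'f) = 1" by simp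
  show "1 \<in> Lam F n" using Lam_lconst[of 1 F n] unfolding 1 .
  show "laurent_degree (1 :: 'f laurent) \<le> fam_degfac F * psize n zero_partition"
    using laurent_degree_lconst[of "1 :: 'f"] unfolding 1 by simp
  fix lam assume lam: "lam \<in> partitions n" "psize n lam \<le> psize n zero_partition"
  then have "lam i = 0" for i
    unfolding zero_partition(2) partitions_def by (cases "i \<in> {1..n}") (auto simp: psize_eq_0_iff)
  then have "lam = zero_partition" by (auto simp: zero_partition_def)
  then show "ev lam 1 = (if lam = zero_partition then 1 else 0)"
    using laurent_eval_lconst[of "fam_shift F n lam" 1] unfolding 1 by simp
qed

theorem itp_expansion:
  assumes p: "p \<in> Lam F n"
  shows "finite {lam \<in> partitions n. struct_coeff F n p lam zero_partition \<noteq> 0}" (is "finite ?S")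
    and "p = (\<Sum>lam | lam \<in> partitions n \<and> struct_coeff F n p lam zero_partition \<noteq> 0.
              lconst (struct_coeff F n p lam zero_partition) * itp_poly F n lam)"
proof -
  have eq: "struct_coeff F n p lam zero_partition = coef p lam" for lam
    by (simp add: struct_coeff_eq h_zero_partition)
  have exp: "expands p (coef p)" by (rule expands_coef[OF p])
  then have "?S = {\<nu>. coef p \<nu> \<noteq> 0}" unfolding eq expands_def by auto
  then show "finite ?S" "p = (\<Sum>lam | lam \<in> partitions n \<and> struct_coeff F n p lam zero_partition \<noteq> 0.
              lconst (struct_coeff F n p lam zero_partition) * itp_poly F n lam)"
    using exp unfolding expands_def eq by auto
qed

end

section \<open>The four families\<close>

lemma power_int_eq_divide: "(x :: 'f::field) \<noteq> 0 \<Longrightarrow> x powi A = x ^ nat A / x ^ nat (- A)"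
  by (cases "A \<ge> 0") (auto simp: power_int_def field_simps)

lemma to_ac_power_int: "to_ac (x powi A) = to_ac x powi A"
  by (simp add: power_int_def)

subsection \<open>Grids\<close>

text \<open>Here \<open>y = x\<close>, and the half steps are translations by \<open>1/2\<close> and
  \<open>\<tau>/2\<close>, so \<open>w\<close> is the constant \<open>1/2\<close> and
  \<open>e\<close> is \<open>\<tau>\<close>.\<close>

lemma perfect_grid_linear:
  fixes \<tau> :: "'k::field_char_0"
  assumes indep: "\<And>A B. of_int A + of_int B * \<tau> = 0 \<Longrightarrow> A = 0 \<and> B = 0"
  shows "perfect_grid (\<lambda>A B. of_int A / 2 + of_int B / 2 * \<tau>) (\<lambda>_ _. 1 / 2) 0 1 0 1 \<tau> (1 / 4) 0 0"
proof
  fix A B A' B'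
  let ?x = "of_int A / 2 + of_int B / 2 * \<tau>" and ?y = "of_int A' / 2 + of_int B' / 2 * \<tau>"
  assume "?x = ?y"
  moreover have "of_int (A - A') + of_int (B - B') * \<tau> = 2 * (?x - ?y)" by (simp add: field_simps)
  ultimately have "of_int (A - A') + of_int (B - B') * \<tau> = 0" by simp
  from indep[OF this] show "A = A' \<and> B = B'" by simp
qed (auto simp: field_simps)

text \<open>Expanding the square of \<open>x\<close> plus or minus a half step shows
  \<open>w = x\<close>, \<open>e = \<tau>\<close> and the constants \<open>1/4\<close> and
  \<open>\<tau>^2/4\<close>; moreover \<open>w^2\<close> is the value \<open>y\<close> itself. Two
  grid points with opposite \<open>x\<close> are excluded because their sum keeps a nonzero multiple
  of \<open>\<alpha>\<close>.\<close>

lemma perfect_grid_quadratic: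
  fixes \<tau> \<alpha> :: "'k::field_char_0"
  assumes indep: "\<And>A B C. of_int A + of_int B * \<tau> + of_int C * \<alpha> = 0 \<Longrightarrow> A = 0 \<and> B = 0 \<and> C = 0"
  shows "perfect_grid (\<lambda>A B. (of_int A / 2 + of_int B / 2 * \<tau> + \<alpha>)\<^sup>2)
    (\<lambda>A B. of_int A / 2 + of_int B / 2 * \<tau> + \<alpha>) (1 / 4) 1 (\<tau>\<^sup>2 / 4) 1 \<tau> 0 1 0"
proof
  fix A B A' B'
  let ?x = "of_int A / 2 + of_int B / 2 * \<tau> + \<alpha>" and ?y = "of_int A' / 2 + of_int B' / 2 * \<tau> + \<alpha>"
  assume "?x\<^sup>2 = ?y\<^sup>2"
  then consider "?x = ?y" | "?x = - ?y" by (auto simp: power2_eq_iff)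
  then show "A = A' \<and> B = B'"
  proof cases
    case 1
    moreover have "of_int (A - A') + of_int (B - B') * \<tau> + of_int 0 * \<alpha> = 2 * (?x - ?y)"
      by (simp add: field_simps)
    ultimately have "of_int (A - A') + of_int (B - B') * \<tau> + of_int 0 * \<alpha> = 0" by simp
    from indep[OF this] show ?thesis by simp
  next
    case 2
    then have "?x + ?y = 0" by (simp only: eq_neg_iff_add_eq_0)
    moreover have "of_int (A + A') + of_int (B + B') * \<tau> + of_int 4 * \<alpha> = 2 * (?x + ?y)"
      by (simp add: field_simps)
    ultimately have "of_int (A + A') + of_int (B + B') * \<tau> + of_int 4 * \<alpha> = 0" by simp
    from indep[OF this] show ?thesis by simp
  qed
qed (auto simp: field_simps power2_eq_square)

text \<open>Half steps multiply by \<open>s\<close> or \<open>1/s\<close>, which are the half sum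
  \<open>(s + 1/s)/2\<close> plus or minus the half difference \<open>(s - 1/s)/2\<close>; likewise
  for \<open>r\<close>. The factor \<open>e\<close> rescales the half difference of \<open>s\<close>
  to that of \<open>r\<close>.\<close>

lemma perfect_grid_exponential:
  fixes s r :: "'k::field_char_0"
  assumes nz: "s \<noteq> 0" "r \<noteq> 0" and indep: "\<And>A B. s powi A * r powi B = 1 \<Longrightarrow> A = 0 \<and> B = 0"
  shows "perfect_grid (\<lambda>A B. s powi A * r powi B) (\<lambda>A B. (s - 1 / s) / 2 * (s powi A * r powi B))
    0 ((s + 1 / s) / 2) 0 ((r + 1 / r) / 2) ((r - 1 / r) / (s - 1 / s)) 0 0 (((s - 1 / s) / 2)\<^sup>2)"
proof
  have s: "s - 1 / s \<noteq> 0"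
    using indep[of 2 0] nz by (auto simp: field_simps power2_eq_square)
  fix A B
  have r: "(r - 1 / r) / (s - 1 / s) * ((s - 1 / s) / 2 * (s powi A * r powi B)) =
      (r - 1 / r) / 2 * (s powi A * r powi B)" using s by simp
  show "s powi (A + 1) * r powi B = 0 + (s + 1 / s) / 2 * (s powi A * r powi B) + (s - 1 / s) / 2 * (s powi A * r powi B)"
    "s powi (A - 1) * r powi B = 0 + (s + 1 / s) / 2 * (s powi A * r powi B) - (s - 1 / s) / 2 * (s powi A * r powi B)"
    using nz by (auto simp: power_int_add_1 power_int_diff field_simps)
  show "s powi A * r powi (B + 1) = 0 + (r + 1 / r) / 2 * (s powi A * r powi B) +
      (r - 1 / r) / (s - 1 / s) * ((s - 1 / s) / 2 * (s powi A * r powi B))"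
    "s powi A * r powi (B - 1) = 0 + (r + 1 / r) / 2 * (s powi A * r powi B) -
      (r - 1 / r) / (s - 1 / s) * ((s - 1 / s) / 2 * (s powi A * r powi B))"
    unfolding r using nz by (auto simp: power_int_add_1 power_int_diff field_simps)
  fix A' B' assume "s powi A * r powi B = s powi A' * r powi B'"
  then have "s powi (A - A') * r powi (B - B') = 1" using nz by (simp add: power_int_diff field_simps)
  from indep[OF this] show "A = A' \<and> B = B'" by simp
qed (simp_all add: power2_eq_square mult_ac)

text \<open>Splitting \<open>s\<close> and \<open>1/s\<close> into half sum and half difference
  leaves \<open>x + 1/x\<close> in the even part and \<open>x - 1/x\<close> in the odd part, and the
  square of \<open>x - 1/x\<close> is \<open>y^2 - 4\<close>. Equal values of \<open>y\<close> mean
  equal or inverse \<open>x\<close>; the second case would give a relation containing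
  \<open>a^2\<close>.\<close>

lemma perfect_grid_BC_exponential:
  fixes s r a :: "'k::field_char_0"
  assumes nz: "s \<noteq> 0" "r \<noteq> 0" "a \<noteq> 0"
    and indep: "\<And>A B C. s powi A * r powi B * a powi C = 1 \<Longrightarrow> A = 0 \<and> B = 0 \<and> C = 0"
  defines "x \<equiv> \<lambda>A B. a * s powi A * r powi B"
  shows "perfect_grid (\<lambda>A B. x A B + 1 / x A B) (\<lambda>A B. (s - 1 / s) / 2 * (x A B - 1 / x A B))
    0 ((s + 1 / s) / 2) 0 ((r + 1 / r) / 2) ((r - 1 / r) / (s - 1 / s))
    (- 4 * ((s - 1 / s) / 2)\<^sup>2) 0 (((s - 1 / s) / 2)\<^sup>2)"
proof
  have s: "s - 1 / s \<noteq> 0"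
    using indep[of 2 0 0] nz by (auto simp: field_simps power2_eq_square)
  have x0: "x A B \<noteq> 0" for A B using nz by (simp add: x_def)
  have shift: "x (A + 1) B = s * x A B" "x (A - 1) B = x A B / s"
    "x A (B + 1) = r * x A B" "x A (B - 1) = x A B / r" for A B
    using nz by (auto simp: x_def power_int_add_1 power_int_diff)
  fix A B
  have r: "(r - 1 / r) / (s - 1 / s) * ((s - 1 / s) / 2 * (x A B - 1 / x A B)) =
      (r - 1 / r) / 2 * (x A B - 1 / x A B)" using s by simp
  show "x (A + 1) B + 1 / x (A + 1) B = 0 + (s + 1 / s) / 2 * (x A B + 1 / x A B) + (s - 1 / s) / 2 * (x A B - 1 / x A B)"
    "x (A - 1) B + 1 / x (A - 1) B = 0 + (s + 1 / s) / 2 * (x A B + 1 / x A B) - (s - 1 / s) / 2 * (x A B - 1 / x A B)"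
    unfolding shift using nz x0[of A B] by (auto simp: field_simps)
  show "x A (B + 1) + 1 / x A (B + 1) = 0 + (r + 1 / r) / 2 * (x A B + 1 / x A B) +
      (r - 1 / r) / (s - 1 / s) * ((s - 1 / s) / 2 * (x A B - 1 / x A B))"
    "x A (B - 1) + 1 / x A (B - 1) = 0 + (r + 1 / r) / 2 * (x A B + 1 / x A B) -
      (r - 1 / r) / (s - 1 / s) * ((s - 1 / s) / 2 * (x A B - 1 / x A B))"
    unfolding shift r using nz x0[of A B] by (auto simp: field_simps)
  have sq: "D * z * (D * z) = - 4 * D\<^sup>2 + 0 * y + D\<^sup>2 * (y * y)" if "z * z = y * y - 4" for D z y :: 'k
  proof -
    have "D * z * (D * z) = D\<^sup>2 * (z * z)" by (simp add: power2_eq_square mult_ac)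
    then show ?thesis unfolding that by (simp add: algebra_simps)
  qed
  have "(x A B - 1 / x A B) * (x A B - 1 / x A B) = (x A B + 1 / x A B) * (x A B + 1 / x A B) - 4"
    using x0[of A B] by (simp add: field_simps)
  then show "(s - 1 / s) / 2 * (x A B - 1 / x A B) * ((s - 1 / s) / 2 * (x A B - 1 / x A B)) =
     - 4 * ((s - 1 / s) / 2)\<^sup>2 + 0 * (x A B + 1 / x A B) + ((s - 1 / s) / 2)\<^sup>2 * ((x A B + 1 / x A B) * (x A B + 1 / x A B))"
    by (rule sq)
  fix A' B' assume eq: "x A B + 1 / x A B = x A' B' + 1 / x A' B'"
  have "(x A B - x A' B') * (x A B * x A' B' - 1) = 0"
    using eq x0[of A B] x0[of A' B'] by (simp add: field_simps)
  then consider "x A B = x A' B'" | "x A B * x A' B' = 1" by auto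
  then show "A = A' \<and> B = B'"
  proof cases
    case 1
    then have "s powi (A - A') * r powi (B - B') * a powi 0 = 1"
      using nz by (simp add: x_def power_int_diff field_simps)
    from indep[OF this] show ?thesis by simp
  next
    case 2
    then have "s powi (A + A') * r powi (B + B') * a powi 2 = 1"
      using nz by (simp add: x_def power_int_add power2_eq_square mult_ac)
    from indep[OF this] show ?thesis by simp
  qed
qed

subsection \<open>Normal forms of exponents\<close>

lemma generated_by_powers_keys:
  assumes "p \<in> generated_algebra ((\<lambda>i. var_power i (int s)) ` {1..n})" "m \<in> Poly_Mapping.keys p"
  shows "Poly_Mapping.keys m \<subseteq> {1..n} \<and> (\<forall>i. \<exists>k. Poly_Mapping.lookup m i = int (s * k))"
  using assms
proof (induction arbitrary: m rule: generated_algebra.induct)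
  case (const c)
  then have "m = 0" by (auto simp: lconst_def split: if_splits)
  then show ?case by (auto intro: exI[of _ 0])
next
  case (gen g)
  then obtain i where "i \<in> {1..n}" "m = Poly_Mapping.single i (int s)" by (auto simp: var_power_def)
  then show ?case by (auto simp: lookup_single when_def intro: exI[of _ 1] exI[of _ 0])
next
  case (add p r)
  then show ?case using keys_add[of p r] by blast
next
  case (mult p r)
  then obtain a b where ab: "m = a + b" "a \<in> Poly_Mapping.keys p" "b \<in> Poly_Mapping.keys r"
    using keys_mult[of p r] by blast
  have "\<exists>k. Poly_Mapping.lookup m i = int (s * k)" for i
  proof -
    obtain k l where "Poly_Mapping.lookup a i = int (s * k)" "Poly_Mapping.lookup b i = int (s * l)"
      using mult.IH(1)[OF ab(2)] mult.IH(2)[OF ab(3)] by blast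
    then show ?thesis by (intro exI[of _ "k + l"]) (simp add: ab(1) lookup_add distrib_left)
  qed
  then show ?case using mult.IH(1)[OF ab(2)] mult.IH(2)[OF ab(3)] keys_add[of a b] ab(1) by blast
qed

text \<open>All exponents are nonnegative, so evaluation is multiplicative even at points with zero
  coordinates.\<close>

lemma powers_eval_mult:
  assumes "p \<in> generated_algebra ((\<lambda>i. var_power i (int s)) ` {1..n})"
    "r \<in> generated_algebra ((\<lambda>i. var_power i (int s)) ` {1..n})"
  shows "laurent_eval x (p * r) = laurent_eval x p * laurent_eval x r"
proof (rule laurent_eval_mult, rule mono_eval_add)
  fix a b i assume "a \<in> Poly_Mapping.keys p" "b \<in> Poly_Mapping.keys r"
  then obtain k l where "Poly_Mapping.lookup a i = int (s * k)" "Poly_Mapping.lookup b i = int (s * l)"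
    using generated_by_powers_keys[OF assms(1)] generated_by_powers_keys[OF assms(2)] by blast
  then show "x i \<noteq> 0 \<or> 0 \<le> Poly_Mapping.lookup a i \<and> 0 \<le> Poly_Mapping.lookup b i" by simp
qed

lemma powers_normal:
  assumes "p \<in> generated_algebra ((\<lambda>i. var_power i (int s)) ` {1..n})" "m \<in> Poly_Mapping.keys p"
  shows "Poly_Mapping.keys m \<subseteq> {1..n} \<and>
       (\<exists>k. Poly_Mapping.lookup p (expo s n k) = Poly_Mapping.lookup p m \<and>
            (\<forall>i\<in>{1..n}. \<bar>Poly_Mapping.lookup m i\<bar> = int (s * k i)))"
proof -
  have m: "Poly_Mapping.keys m \<subseteq> {1..n}" "\<forall>i. \<exists>k. Poly_Mapping.lookup m i = int (s * k)"
    using generated_by_powers_keys[OF assms] by auto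
  from choice[OF m(2)] obtain k where k: "\<And>i. Poly_Mapping.lookup m i = int (s * k i)" by blast
  have "expo s n k = m"
    by (rule poly_mapping_eqI) (use k m(1) in \<open>auto simp: lookup_expo in_keys_iff subset_iff\<close>)
  then show ?thesis using m(1) k by (intro conjI exI[of _ k]) auto
qed

text \<open>The action on exponents of replacing the variables in \<open>S\<close> by their
  inverses.\<close>

definition flip :: "nat set \<Rightarrow> (nat \<Rightarrow>\<^sub>0 int) \<Rightarrow> nat \<Rightarrow>\<^sub>0 int" where
  "flip S m = Poly_Mapping.mapp (\<lambda>i v. if i \<in> S then - v else v) m"

lemma lookup_flip: "Poly_Mapping.lookup (flip S m) i =
    (if i \<in> S then - Poly_Mapping.lookup m i else Poly_Mapping.lookup m i)"
  by (auto simp: flip_def lookup_mapp in_keys_iff when_def)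

lemma flip_flip: "flip S (flip S m) = m"
  by (rule poly_mapping_eqI) (simp add: lookup_flip)

lemma flip_add: "flip S (a + b) = flip S a + flip S b"
  by (rule poly_mapping_eqI) (simp add: lookup_flip lookup_add)

lemma flip_single: "flip S (Poly_Mapping.single i v) = Poly_Mapping.single i (if i \<in> S then - v else v)"
  by (rule poly_mapping_eqI) (auto simp: lookup_flip lookup_single when_def)

lemma inj_flip: "inj (flip S)"
  by (metis injI flip_flip)

abbreviation gen_BM :: "nat \<Rightarrow> 'f::field laurent" where
  "gen_BM i \<equiv> var_power i 1 + var_power i (- 1)"

text \<open>Inverting variables is a ring homomorphism and fixes each generator.\<close>

lemma map_key_flip_generated:
  fixes p :: "'f::field laurent"
  assumes "p \<in> generated_algebra (gen_BM ` {1..n})"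
  shows "Poly_Mapping.map_key (flip S) p = p"
  using assms
proof (induction rule: generated_algebra.induct)
  case (const c)
  have "flip S 0 = 0" by (rule poly_mapping_eqI) (simp add: lookup_flip)
  then show ?case unfolding lconst_def by (rule map_key_single_inverse[OF inj_flip])
next
  case (gen g)
  have "Poly_Mapping.map_key (flip S) (var_power i e :: 'f laurent) = var_power i (if i \<in> S then - e else e)" for i e
    unfolding var_power_def by (rule map_key_single_inverse[OF inj_flip]) (simp add: flip_single)
  then show ?case using gen by (auto simp: map_key_plus[OF inj_flip])
next
  case (mult p r)
  then show ?case by (simp add: map_key_times[OF inj_flip flip_flip flip_add])
qed (simp add: map_key_plus[OF inj_flip])

lemma BM_keys:
  assumes "p \<in> generated_algebra (gen_BM ` {1..n})" "m \<in> Poly_Mapping.keys p"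
  shows "Poly_Mapping.keys m \<subseteq> {1..n}"
  using assms
proof (induction arbitrary: m rule: generated_algebra.induct)
  case (const c)
  then show ?case by (auto simp: lconst_def split: if_splits)
next
  case (gen g)
  then obtain i where i: "i \<in> {1..n}" "g = gen_BM i" by blast
  then have "m = Poly_Mapping.single i 1 \<or> m = Poly_Mapping.single i (- 1)"
    using gen.prems keys_add[of "var_power i 1" "var_power i (- 1)"] by (auto simp: var_power_def)
  then show ?case using i by auto
next
  case (add p r)
  then show ?case using keys_add[of p r] by blast
next
  case (mult p r)
  then obtain a b where "m = a + b" "a \<in> Poly_Mapping.keys p" "b \<in> Poly_Mapping.keys r"
    using keys_mult[of p r] by blast
  then show ?case using mult.IH keys_add[of a b] by blast
qed

text \<open>Inverting the variables with negative exponent replaces all exponents by their absolute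
  values without changing the coefficient.\<close>

lemma BM_normal:
  assumes "p \<in> generated_algebra (gen_BM ` {1..n})" "m \<in> Poly_Mapping.keys p"
  shows "Poly_Mapping.keys m \<subseteq> {1..n} \<and>
       (\<exists>k. Poly_Mapping.lookup p (expo 1 n k) = Poly_Mapping.lookup p m \<and>
            (\<forall>i\<in>{1..n}. \<bar>Poly_Mapping.lookup m i\<bar> = int (1 * k i)))"
proof -
  have keys: "Poly_Mapping.keys m \<subseteq> {1..n}" by (rule BM_keys[OF assms])
  let ?k = "\<lambda>i. nat \<bar>Poly_Mapping.lookup m i\<bar>" and ?S = "{i. Poly_Mapping.lookup m i < 0}"
  have "expo 1 n ?k = flip ?S m"
    by (rule poly_mapping_eqI) (use keys in \<open>auto simp: lookup_expo lookup_flip in_keys_iff subset_iff\<close>)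
  then have "Poly_Mapping.lookup p (expo 1 n ?k) = Poly_Mapping.lookup (Poly_Mapping.map_key (flip ?S) p) m"
    by (simp add: Poly_Mapping.map_key.rep_eq[OF inj_flip])
  then show ?thesis
    unfolding map_key_flip_generated[OF assms(1)] using keys by (intro conjI exI[of _ ?k]) auto
qed

subsection \<open>Independence of the parameters\<close>

lemma Fract_1_eq_iff: "Fract p 1 = Fract r 1 \<longleftrightarrow> p = r"
  by (simp add: eq_fract)

lemma Fract_1_0: "Fract 0 1 = 0" and Fract_1_1: "Fract 1 1 = 1"
  by (simp_all add: Zero_fract_def One_fract_def)

lemma Fract_1_power: "Fract p 1 ^ k = Fract (p ^ k) 1"
  by (induction k) (auto simp: Fract_1_1)

lemma Fract_1_sum: "(\<Sum>i\<in>A. Fract (f i) 1) = Fract (\<Sum>i\<in>A. f i) 1"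
  by (induction A rule: infinite_finite_induct) (auto simp: Fract_1_0)

lemma of_int_Fract: "of_int k = Fract (of_int k) 1"
proof (cases k)
  case (nonneg m)
  have "of_nat m = Fract (of_nat m) 1" by (induction m) (auto simp: Fract_1_0 One_fract_def)
  then show ?thesis using nonneg by simp
next
  case (neg m)
  have "of_nat m = Fract (of_nat m) 1" for m by (induction m) (auto simp: Fract_1_0 One_fract_def)
  then have "- of_nat (Suc m) = - Fract (of_nat (Suc m)) 1" by (rule arg_cong)
  then show ?thesis unfolding neg minus_fract by (simp only: of_int_minus of_int_of_nat_eq)
qed

lemma AJ_indep:
  assumes "of_int A + of_int B * AJ_tau = 0" shows "A = 0 \<and> B = 0"
proof -
  have "Fract [:of_int A, of_int B:] 1 = of_int A + of_int B * AJ_tau"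
    by (simp add: AJ_tau_def of_int_Fract of_int_poly)
  then show ?thesis using assms by (simp add: Zero_fract_def Fract_1_eq_iff)
qed

lemma BJ_indep:
  assumes "of_int A + of_int B * BJ_tau + of_int C * BJ_alpha = 0" shows "A = 0 \<and> B = 0 \<and> C = 0"
proof -
  have "Fract [:[:of_int A, of_int B:], [:of_int C:]:] 1 = of_int A + of_int B * BJ_tau + of_int C * BJ_alpha"
    by (simp add: BJ_tau_def BJ_alpha_def of_int_Fract of_int_poly)
  then show ?thesis using assms by (simp add: Zero_fract_def Fract_1_eq_iff)
qed

lemma AM_monomial: "AM_q ^ i * AM_t ^ j = Fract (Polynomial.monom (Polynomial.monom 1 i) j) 1"
proof -
  have "[:[:0, 1:]:] ^ i * [:0, 1:] ^ j = (Polynomial.monom (Polynomial.monom 1 i) j :: rat poly poly)"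
    by (simp add: poly_const_pow monom_altdef smult_monom)
  then show ?thesis by (simp add: AM_q_def AM_t_def Fract_1_power)
qed

lemma BM_monomial: "BM_q ^ i * BM_t ^ j * BM_a ^ k = Fract (Polynomial.monom (Polynomial.monom (Polynomial.monom 1 i) j) k) 1"
proof -
  have "[:[:0, 1:]:] ^ i * [:0, 1:] ^ j = (Polynomial.monom (Polynomial.monom 1 i) j :: rat poly poly)"
    by (simp add: poly_const_pow monom_altdef smult_monom)
  then have "[:[:[:0, 1:]:]:] ^ i * [:[:0, 1:]:] ^ j = [:Polynomial.monom (Polynomial.monom 1 i) j :: rat poly poly:]"
    by (simp add: poly_const_pow)
  then have "[:[:[:0, 1:]:]:] ^ i * [:[:0, 1:]:] ^ j * [:0, 1:] ^ k = (Polynomial.monom (Polynomial.monom (Polynomial.monom 1 i) j) k :: rat poly poly poly)"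
    by (simp add: monom_altdef)
  then show ?thesis by (simp add: BM_q_def BM_t_def BM_a_def Fract_1_power)
qed

lemma AM_nonzero: "AM_q \<noteq> 0" "AM_t \<noteq> 0"
  by (simp_all add: AM_q_def AM_t_def Zero_fract_def Fract_1_eq_iff)

lemma BM_nonzero: "BM_q \<noteq> 0" "BM_t \<noteq> 0" "BM_a \<noteq> 0"
  by (simp_all add: BM_q_def BM_t_def BM_a_def Zero_fract_def Fract_1_eq_iff)

text \<open>Moving negative powers to the other side compares two honest monomials, and
  \<open>nat A = nat (- A)\<close> holds only for \<open>A = 0\<close>.\<close>

lemma AM_indep:
  assumes "AM_q powi A * AM_t powi B = 1" shows "A = 0 \<and> B = 0"
proof -
  have "AM_q ^ nat A * AM_t ^ nat B = AM_q ^ nat (- A) * AM_t ^ nat (- B)"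
    using assms AM_nonzero by (simp add: power_int_eq_divide)
  then have "nat A = nat (- A)" "nat B = nat (- B)"
    by (simp_all add: AM_monomial Fract_1_eq_iff monom_eq_iff')
  then show ?thesis by linarith
qed

lemma BM_indep:
  assumes "BM_q powi A * BM_t powi B * BM_a powi C = 1" shows "A = 0 \<and> B = 0 \<and> C = 0"
proof -
  have "BM_q ^ nat A * BM_t ^ nat B * BM_a ^ nat C = BM_q ^ nat (- A) * BM_t ^ nat (- B) * BM_a ^ nat (- C)"
    using assms BM_nonzero by (simp add: power_int_eq_divide)
  then have "nat A = nat (- A)" "nat B = nat (- B)" "nat C = nat (- C)"
    by (simp_all add: BM_monomial Fract_1_eq_iff monom_eq_iff')
  then show ?thesis by linarith
qed


subsection \<open>Verification of the axioms\<close>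

lemma psize_eq: "psize n lam = psize n \<mu>" if "\<And>i. i \<in> {1..n} \<Longrightarrow> lam i = \<mu> i"
  using that by (simp add: psize_def)

text \<open>Common to AJ, BJ and AM, whose generators are the powers of the variables with exponent
  \<open>s\<close> equal to 1, 2 and 1.\<close>

lemma interpolation_family_powers:
  fixes F :: "'f::field itp_family"
  assumes grid: "perfect_grid V w c0 c1 d0 d1 e q0 q1 q2"
    and s: "s > 0" and gen: "fam_gen F = (\<lambda>i. var_power i (int s))" and degfac: "fam_degfac F = s"
    and shift: "\<And>lam i. fam_shift F n lam i ^ s = u i (lam i)" and norm1: "\<And>x. fam_norm1 F x = x ^ s"
    and \<iota>: "\<And>a b. \<iota> (a + b) = \<iota> a + \<iota> b" "\<And>a b. \<iota> (a * b) = \<iota> a * \<iota> b" "\<iota> 1 = 1"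
      "\<And>i k. i \<in> {1..n} \<Longrightarrow> \<iota> (u i k) = V (2 * int k) (2 * (int n - int i))"
    and norm_neq: "\<And>lam \<mu>. psize n lam \<noteq> psize n \<mu> \<Longrightarrow>
       fam_norm F n (fam_shift F n lam) \<noteq> fam_norm F n (fam_shift F n \<mu>)"
  shows "interpolation_family V w c0 c1 d0 d1 e q0 q1 q2 F n u \<iota>"
proof (intro interpolation_family.intro grid interpolation_family_axioms.intro \<iota> norm_neq)
  fix p r lam i \<pi> m
  show "fam_degfac F > 0" by (simp add: s degfac)
  show "laurent_degree (fam_gen F i) \<le> fam_degfac F"
    using laurent_degree_var_power[of i "int s"] by (simp add: gen degfac)
  show "permute_vars \<pi> (fam_gen F i) = fam_gen F (\<pi> i)" if "\<pi> permutes {1..n}"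
    by (simp add: gen permute_vars_var_power[OF permutes_bij[OF that]])
  show "laurent_eval (fam_shift F n lam) (p * r) = laurent_eval (fam_shift F n lam) p * laurent_eval (fam_shift F n lam) r"
    if "p \<in> generated_algebra (fam_gen F ` {1..n})" "r \<in> generated_algebra (fam_gen F ` {1..n})"
    using that unfolding gen by (rule powers_eval_mult)
  show "laurent_eval (fam_shift F n lam) (fam_gen F i) = u i (lam i)"
    "fam_norm1 F (fam_shift F n lam i) = u i (lam i)"
    by (simp_all add: gen norm1 shift laurent_eval_var_power power_int_of_nat)
  show "Poly_Mapping.keys m \<subseteq> {1..n} \<and>
       (\<exists>k. Poly_Mapping.lookup p (expo (fam_degfac F) n k) = Poly_Mapping.lookup p m \<and>
            (\<forall>i\<in>{1..n}. \<bar>Poly_Mapping.lookup m i\<bar> = int (fam_degfac F * k i)))"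
    if "p \<in> Lam F n" "m \<in> Poly_Mapping.keys p"
    using powers_normal[of p s n m] that by (simp add: Lam_def gen degfac)
qed auto

text \<open>Half steps only need division by 2 here, so the base field itself suffices and the
  embedding is the identity.\<close>

lemma interpolation_family_AJ:
  "interpolation_family (\<lambda>A B. of_int A / 2 + of_int B / 2 * AJ_tau) (\<lambda>_ _. 1 / 2) 0 1 0 1 AJ_tau (1 / 4) 0 0
     family_AJ n (\<lambda>i k. of_nat k + of_nat (n - i) * AJ_tau) (\<lambda>x. x)"
proof (intro interpolation_family_powers perfect_grid_linear AJ_indep)
  fix lam \<mu> i
  show "fam_gen family_AJ = (\<lambda>i. var_power i (int 1))" "fam_degfac family_AJ = 1"
    by (simp_all add: family_AJ_def)
  show "fam_norm family_AJ n (fam_shift family_AJ n lam) \<noteq> fam_norm family_AJ n (fam_shift family_AJ n \<mu>)"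
    if "psize n lam \<noteq> psize n \<mu>"
  proof -
    \<comment> \<open>The norm is the size plus a constant independent of the partition.\<close>
    have "fam_norm family_AJ n (fam_shift family_AJ n lam) = of_nat (psize n lam) + (\<Sum>i\<in>{1..n}. of_nat (n - i) * AJ_tau)" for lam
      by (simp add: fam_norm_def family_AJ_def sum.distrib psize_def)
    then show ?thesis using that by simp
  qed
  fix k
  show "of_nat k + of_nat (n - i) * AJ_tau =
    of_int (2 * int k) / 2 + of_int (2 * (int n - int i)) / 2 * AJ_tau" if "i \<in> {1..n}"
    using that by (simp add: of_nat_diff)
qed (auto simp: family_AJ_def)

lemma interpolation_family_BJ:
  "interpolation_family (\<lambda>A B. (of_int A / 2 + of_int B / 2 * BJ_tau + BJ_alpha)\<^sup>2)
    (\<lambda>A B. of_int A / 2 + of_int B / 2 * BJ_tau + BJ_alpha) (1 / 4) 1 (BJ_tau\<^sup>2 / 4) 1 BJ_tau 0 1 0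
     family_BJ n (\<lambda>i k. (of_nat k + of_nat (n - i) * BJ_tau + BJ_alpha)\<^sup>2) (\<lambda>x. x)"
proof (intro interpolation_family_powers perfect_grid_quadratic BJ_indep)
  fix lam \<mu> i
  show "fam_gen family_BJ = (\<lambda>i. var_power i (int 2))" "fam_degfac family_BJ = 2"
    by (simp_all add: family_BJ_def)
  show "fam_norm family_BJ n (fam_shift family_BJ n lam) \<noteq> fam_norm family_BJ n (fam_shift family_BJ n \<mu>)"
    if "psize n lam \<noteq> psize n \<mu>"
  proof
    assume eq: "fam_norm family_BJ n (fam_shift family_BJ n lam) = fam_norm family_BJ n (fam_shift family_BJ n \<mu>)"
    \<comment> \<open>Up to the common term \<open>?D\<close>, the norm is an integer combination of
      \<open>1\<close>, \<open>\<tau>\<close> and \<open>\<alpha>\<close> in which the coefficient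
      of \<open>\<alpha>\<close> is twice the size.\<close>
    let ?A = "\<lambda>lam. \<Sum>i\<in>{1..n}. int (lam i) ^ 2"
      and ?B = "\<lambda>lam. \<Sum>i\<in>{1..n}. 2 * int (lam i) * int (n - i)"
      and ?D = "\<Sum>i\<in>{1..n}. (of_nat (n - i) * BJ_tau + BJ_alpha) ^ 2"
    have norm: "fam_norm family_BJ n (fam_shift family_BJ n lam) =
       of_int (?A lam) + of_int (?B lam) * BJ_tau + of_int (2 * int (psize n lam)) * BJ_alpha + ?D" for lam
    proof -
      have "(of_nat (lam i) + of_nat (n - i) * BJ_tau + BJ_alpha) ^ 2 =
        of_int (int (lam i) ^ 2) + of_int (2 * int (lam i) * int (n - i)) * BJ_tau + of_int (2 * int (lam i)) * BJ_alpha +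
        (of_nat (n - i) * BJ_tau + BJ_alpha) ^ 2" for i
        by (simp add: power2_eq_square algebra_simps)
      then show ?thesis
        by (simp only: fam_norm_def family_BJ_def itp_family.simps psize_def sum.distrib of_int_sum
            sum_distrib_right sum_distrib_left of_nat_sum)
    qed
    have "of_int (?A lam - ?A \<mu>) + of_int (?B lam - ?B \<mu>) * BJ_tau +
        of_int (2 * int (psize n lam) - 2 * int (psize n \<mu>)) * BJ_alpha = 0"
      using eq unfolding norm of_int_diff left_diff_distrib by (simp add: algebra_simps)
    from BJ_indep[OF this] show False using that by simp
  qed
  fix k
  show "(of_nat k + of_nat (n - i) * BJ_tau + BJ_alpha)\<^sup>2 =
    (of_int (2 * int k) / 2 + of_int (2 * (int n - int i)) / 2 * BJ_tau + BJ_alpha)\<^sup>2" if "i \<in> {1..n}"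
  proof -
    have eq: "2 * (int n - int i) = 2 * int (n - i)" using that by simp
    show ?thesis unfolding eq by simp
  qed
qed (auto simp: family_BJ_def)

text \<open>Different rows carry different powers \<open>n - i\<close> of the outer variable, so the
  part of row \<open>j\<close> can be read off from the coefficient at \<open>n - j\<close>.\<close>

lemma sum_monom_eq_imp:
  assumes "(\<Sum>i\<in>{1..n}. Polynomial.monom (Polynomial.monom (1 :: rat) (lam i)) (n - i)) =
     (\<Sum>i\<in>{1..n}. Polynomial.monom (Polynomial.monom 1 (\<mu> i)) (n - i))" "j \<in> {1..n}"
  shows "lam j = \<mu> j"
proof -
  have "Polynomial.coeff (\<Sum>i\<in>{1..n}. Polynomial.monom (Polynomial.monom (1 :: rat) (lam i)) (n - i)) (n - j) =
      Polynomial.monom 1 (lam j)" for lam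
  proof -
    have "Polynomial.coeff (\<Sum>i\<in>{1..n}. Polynomial.monom (Polynomial.monom (1 :: rat) (lam i)) (n - i)) (n - j) =
       (\<Sum>i\<in>{1..n}. if j = i then Polynomial.monom 1 (lam i) else 0)"
      unfolding Polynomial.coeff_sum using assms(2) by (intro sum.cong refl) auto
    also have "\<dots> = Polynomial.monom 1 (lam j)"
      by (subst sum.delta') (use assms(2) in auto)
    finally show ?thesis .
  qed
  then have "Polynomial.monom (1 :: rat) (lam j) = Polynomial.monom 1 (\<mu> j)" using assms(1) by metis
  then show ?thesis by (simp add: monom_eq_iff')
qed

lemma ex_square_root: "\<exists>s. s ^ 2 = (x :: 'a::alg_closed_field)"
  using nth_root_exists[of 2 x] by auto

lemma square_root_indep:
  assumes "(s :: 'a::field) ^ 2 = x" shows "(s powi A) ^ 2 = x powi A"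
  unfolding assms[symmetric] by (simp add: power_int_def power_inverse flip: power_mult add: mult.commute)

text \<open>The algebraic closure provides square roots of \<open>q\<close> and \<open>t\<close>.
  Squaring a multiplicative relation between the roots gives one between \<open>q\<close> and
  \<open>t\<close>, so the roots are independent too.\<close>

lemma interpolation_family_AM:
  "\<exists>V w c0 c1 d0 d1 e q0 q1 q2 u \<iota>. interpolation_family (V :: int \<Rightarrow> int \<Rightarrow> ratfun2 alg_closure)
     w c0 c1 d0 d1 e q0 q1 q2 family_AM n u \<iota>"
proof -
  obtain s r where s: "s ^ 2 = to_ac AM_q" and r: "r ^ 2 = to_ac AM_t" using ex_square_root by metis
  have nz: "s \<noteq> 0" "r \<noteq> 0" using s r AM_nonzero by auto
  have indep: "A = 0 \<and> B = 0" if "s powi A * r powi B = 1" for A B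
  proof (rule AM_indep)
    have "to_ac (AM_q powi A * AM_t powi B) = (s powi A * r powi B) ^ 2"
      by (simp add: to_ac_power_int power_mult_distrib square_root_indep[OF s] square_root_indep[OF r])
    then have "to_ac (AM_q powi A * AM_t powi B) = to_ac 1" using that by (simp only: power_one to_ac_1)
    then show "AM_q powi A * AM_t powi B = 1" by (simp only: to_ac_eq_iff)
  qed
  have "interpolation_family (\<lambda>A B. s powi A * r powi B) (\<lambda>A B. (s - 1 / s) / 2 * (s powi A * r powi B))
    0 ((s + 1 / s) / 2) 0 ((r + 1 / r) / 2) ((r - 1 / r) / (s - 1 / s)) 0 0 (((s - 1 / s) / 2)\<^sup>2)
    family_AM n (\<lambda>i k. AM_q ^ k * AM_t ^ (n - i)) to_ac"
  proof (intro interpolation_family_powers perfect_grid_exponential nz indep)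
    fix lam \<mu> i
    show "fam_gen family_AM = (\<lambda>i. var_power i (int 1))" "fam_degfac family_AM = 1"
      by (simp_all add: family_AM_def)
    show "fam_norm family_AM n (fam_shift family_AM n lam) \<noteq> fam_norm family_AM n (fam_shift family_AM n \<mu>)"
      if "psize n lam \<noteq> psize n \<mu>"
    proof
      assume eq: "fam_norm family_AM n (fam_shift family_AM n lam) = fam_norm family_AM n (fam_shift family_AM n \<mu>)"
      have "fam_norm family_AM n (fam_shift family_AM n lam) =
         Fract (\<Sum>i\<in>{1..n}. Polynomial.monom (Polynomial.monom 1 (lam i)) (n - i)) 1" for lam
        by (simp add: fam_norm_def family_AM_def AM_monomial Fract_1_sum)
      then have "(\<Sum>i\<in>{1..n}. Polynomial.monom (Polynomial.monom (1 :: rat) (lam i)) (n - i)) = (\<Sum>i\<in>{1..n}. Polynomial.monom (Polynomial.monom (1 :: rat) (\<mu> i)) (n - i))"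
        using eq by (simp add: Fract_1_eq_iff)
      from sum_monom_eq_imp[OF this] show False using that psize_eq by blast
    qed
    fix k
    show "to_ac (AM_q ^ k * AM_t ^ (n - i)) = s powi (2 * int k) * r powi (2 * (int n - int i))" if "i \<in> {1..n}"
    proof -
      have "2 * int k = int (2 * k)" "2 * (int n - int i) = int (2 * (n - i))" using that by auto
      then show ?thesis by (simp only: power_int_of_nat power_mult s r to_ac_mult to_ac_power)
    qed
  qed (auto simp: family_AM_def)
  then show ?thesis by blast
qed

lemma sum_const_poly: "(\<Sum>i\<in>A. [:f i:]) = [:\<Sum>i\<in>A. f i:]"
  by (induction A rule: infinite_finite_induct) auto

text \<open>The norm is \<open>a X + Y/a\<close> with \<open>X\<close> and \<open>Y\<close> free of
  \<open>a\<close>. Equal norms give \<open>a^2\<close> times the difference of the \<open>X\<close>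
  as a difference of the \<open>Y\<close>; after clearing denominators, comparing coefficients of
  \<open>a^2\<close> forces equal \<open>X\<close>, and these determine the partitions.\<close>

lemma BM_norm_neq:
  assumes "psize n lam \<noteq> psize n \<mu>"
  shows "fam_norm family_BM n (fam_shift family_BM n lam) \<noteq> fam_norm family_BM n (fam_shift family_BM n \<mu>)"
proof
  assume eq: "fam_norm family_BM n (fam_shift family_BM n lam) = fam_norm family_BM n (fam_shift family_BM n \<mu>)"
  define mon where "mon = (\<lambda>lam i. BM_q ^ lam i * BM_t ^ (n - i))"
  \<comment> \<open>\<open>a\<close> is the outermost indeterminate, so these are the elements that
    are polynomials in \<open>q\<close> and \<open>t\<close> alone.\<close>
  define cst where "cst = (\<lambda>x :: ratfun3. \<exists>p. x = Fract [:p:] 1)"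
  let ?X = "\<lambda>lam. \<Sum>i\<in>{1..n}. mon lam i" and ?Y = "\<lambda>lam. \<Sum>i\<in>{1..n}. inverse (mon lam i)"
  \<comment> \<open>A common denominator of all the inverse monomials in \<open>?Y lam\<close> and
    \<open>?Y \<mu>\<close>.\<close>
  let ?M = "(\<Prod>i\<in>{1..n}. mon lam i) * (\<Prod>i\<in>{1..n}. mon \<mu> i)"
  have cst_add: "cst (x + y)" and cst_diff: "cst (x - y)" and cst_mult: "cst (x * y)" if xy: "cst x" "cst y" for x y
  proof -
    obtain p r where "x = Fract [:p:] 1" "y = Fract [:r:] 1" using xy unfolding cst_def by blast
    then have "x + y = Fract [:p + r:] 1" "x - y = Fract [:p - r:] 1" "x * y = Fract [:p * r:] 1"
      by (auto simp: mult.commute)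
    then show "cst (x + y)" "cst (x - y)" "cst (x * y)" unfolding cst_def by blast+
  qed
  have cst_0: "cst 0" and cst_1: "cst 1"
    unfolding cst_def by (intro exI[of _ 0] exI[of _ 1]; simp add: Fract_1_0 Fract_1_1 flip: one_pCons)+
  have cst_sum: "cst (\<Sum>i\<in>A. f i)" if "\<And>i. i \<in> A \<Longrightarrow> cst (f i)" for A :: "nat set" and f
    using that by (induction A rule: infinite_finite_induct) (auto intro: cst_add cst_0)
  have cst_prod: "cst (\<Prod>i\<in>A. f i)" if "\<And>i. i \<in> A \<Longrightarrow> cst (f i)" for A :: "nat set" and f
    using that by (induction A rule: infinite_finite_induct) (auto intro: cst_mult cst_1)
  have mon_eq: "mon lam i = Fract [:Polynomial.monom (Polynomial.monom 1 (lam i)) (n - i):] 1" for lam i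
    using BM_monomial[of "lam i" "n - i" 0] by (simp add: mon_def monom_0)
  then have cst_mon: "cst (mon lam i)" for lam i unfolding cst_def by blast
  have mon_nz: "mon lam i \<noteq> 0" for lam i using BM_nonzero by (simp add: mon_def)
  have cst_inv: "cst (inverse (mon lam i) * (\<Prod>i\<in>{1..n}. mon lam i))" if "i \<in> {1..n}" for lam i
  proof -
    have "(\<Prod>i\<in>{1..n}. mon lam i) = mon lam i * (\<Prod>i\<in>{1..n} - {i}. mon lam i)"
      by (rule prod.remove) (use that in auto)
    then have "inverse (mon lam i) * (\<Prod>i\<in>{1..n}. mon lam i) = (\<Prod>i\<in>{1..n} - {i}. mon lam i)"
      using mon_nz[of lam i] by simp
    then show ?thesis using cst_prod[of _ "mon lam"] cst_mon by simp
  qed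
  have norm: "fam_norm family_BM n (fam_shift family_BM n lam) = BM_a * ?X lam + inverse BM_a * ?Y lam" for lam
    by (simp add: fam_norm_def family_BM_def mon_def sum.distrib sum_distrib_left mult.assoc)
  have "BM_a ^ 2 * (?X lam - ?X \<mu>) = ?Y \<mu> - ?Y lam"
    using eq BM_nonzero(3) unfolding norm by (simp add: field_simps power2_eq_square)
  then have rel: "BM_a ^ 2 * ((?X lam - ?X \<mu>) * ?M) = (?Y \<mu> - ?Y lam) * ?M" by (simp flip: mult.assoc)
  have "cst (?Y \<mu> * ?M)"
  proof -
    have "?Y \<mu> * ?M = (\<Sum>i\<in>{1..n}. (inverse (mon \<mu> i) * (\<Prod>i\<in>{1..n}. mon \<mu> i)) * (\<Prod>i\<in>{1..n}. mon lam i))"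
      unfolding sum_distrib_right by (intro sum.cong refl) (simp add: mult_ac)
    also have "cst \<dots>" by (intro cst_sum cst_mult cst_inv cst_prod cst_mon)
    finally show ?thesis .
  qed
  moreover have "cst (?Y lam * ?M)"
  proof -
    have "?Y lam * ?M = (\<Sum>i\<in>{1..n}. (inverse (mon lam i) * (\<Prod>i\<in>{1..n}. mon lam i)) * (\<Prod>i\<in>{1..n}. mon \<mu> i))"
      unfolding sum_distrib_right by (intro sum.cong refl) (simp add: mult_ac)
    also have "cst \<dots>" by (intro cst_sum cst_mult cst_inv cst_prod cst_mon)
    finally show ?thesis .
  qed
  ultimately have "cst ((?Y \<mu> - ?Y lam) * ?M)" unfolding left_diff_distrib by (rule cst_diff)
  moreover have "cst ((?X lam - ?X \<mu>) * ?M)" by (intro cst_mult cst_diff cst_sum cst_prod cst_mon)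
  ultimately obtain x y where xy: "(?X lam - ?X \<mu>) * ?M = Fract [:x:] 1" "(?Y \<mu> - ?Y lam) * ?M = Fract [:y:] 1"
    unfolding cst_def by blast
  have "Fract [:0, 0, x:] 1 = Fract [:y:] 1"
    using rel unfolding xy by (simp add: BM_a_def power2_eq_square)
  then have "x = 0" by (simp add: Fract_1_eq_iff)
  then have "(?X lam - ?X \<mu>) * ?M = 0" using xy(1) by (simp add: Fract_1_0)
  then have "?X lam = ?X \<mu>" using mon_nz by simp
  moreover have "?X lam = Fract [:\<Sum>i\<in>{1..n}. Polynomial.monom (Polynomial.monom 1 (lam i)) (n - i):] 1" for lam
    unfolding mon_eq Fract_1_sum by (simp add: Fract_1_eq_iff sum_const_poly)
  ultimately have "(\<Sum>i\<in>{1..n}. Polynomial.monom (Polynomial.monom (1 :: rat) (lam i)) (n - i)) = (\<Sum>i\<in>{1..n}. Polynomial.monom (Polynomial.monom (1 :: rat) (\<mu> i)) (n - i))"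
    by (simp add: Fract_1_eq_iff)
  from sum_monom_eq_imp[OF this] show False using assms psize_eq by blast
qed


lemma interpolation_family_BM:
  "\<exists>V w c0 c1 d0 d1 e q0 q1 q2 u \<iota>. interpolation_family (V :: int \<Rightarrow> int \<Rightarrow> ratfun3 alg_closure)
     w c0 c1 d0 d1 e q0 q1 q2 family_BM n u \<iota>"
proof -
  obtain s r where s: "s ^ 2 = to_ac BM_q" and r: "r ^ 2 = to_ac BM_t" using ex_square_root by metis
  have nz: "s \<noteq> 0" "r \<noteq> 0" "to_ac BM_a \<noteq> 0" using s r BM_nonzero by auto
  have indep: "A = 0 \<and> B = 0 \<and> C = 0" if "s powi A * r powi B * to_ac BM_a powi C = 1" for A B C
  proof -
    \<comment> \<open>Only \<open>q\<close> and \<open>t\<close> receive square roots, so squaring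
      the relation doubles the exponent of \<open>a\<close>.\<close>
    have "BM_q powi A * BM_t powi B * BM_a powi (2 * C) = 1"
    proof -
      have "to_ac BM_a powi (2 * C) = (to_ac BM_a powi C) ^ 2"
        by (simp only: mult_2 power2_eq_square power_int_add[OF disjI1[OF nz(3)]])
      then have "to_ac (BM_q powi A * BM_t powi B * BM_a powi (2 * C)) = (s powi A * r powi B * to_ac BM_a powi C) ^ 2"
        by (simp add: to_ac_power_int power_mult_distrib square_root_indep[OF s] square_root_indep[OF r])
      then have "to_ac (BM_q powi A * BM_t powi B * BM_a powi (2 * C)) = to_ac 1"
        using that by (simp only: power_one to_ac_1)
      then show ?thesis by (simp only: to_ac_eq_iff)
    qed
    from BM_indep[OF this] show ?thesis by simp
  qed
  let ?x = "\<lambda>A B. to_ac BM_a * s powi A * r powi B"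
  let ?m = "\<lambda>i k. BM_a * BM_q ^ k * BM_t ^ (n - i)"
  have m_nz: "?m i k \<noteq> 0" for i k using BM_nonzero by simp
  have "interpolation_family (\<lambda>A B. ?x A B + 1 / ?x A B) (\<lambda>A B. (s - 1 / s) / 2 * (?x A B - 1 / ?x A B))
    0 ((s + 1 / s) / 2) 0 ((r + 1 / r) / 2) ((r - 1 / r) / (s - 1 / s))
    (- 4 * ((s - 1 / s) / 2)\<^sup>2) 0 (((s - 1 / s) / 2)\<^sup>2)
    family_BM n (\<lambda>i k. ?m i k + inverse (?m i k)) to_ac"
  proof (intro interpolation_family.intro perfect_grid_BC_exponential nz indep interpolation_family_axioms.intro BM_norm_neq)
    have G: "fam_gen family_BM = gen_BM" by (simp add: family_BM_def fun_eq_iff)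
    fix p r' lam \<mu> i \<pi> m
    show "fam_degfac family_BM > 0" by (simp add: family_BM_def)
    show "laurent_degree (fam_gen family_BM i) \<le> fam_degfac family_BM"
      by (auto simp: family_BM_def intro!: laurent_degree_add_le order.trans[OF laurent_degree_var_power])
    show "permute_vars \<pi> (fam_gen family_BM i) = fam_gen family_BM (\<pi> i)" if "\<pi> permutes {1..n}"
      by (simp add: G permute_vars_add[OF permutes_bij[OF that]] permute_vars_var_power[OF permutes_bij[OF that]])
    show "laurent_eval (fam_shift family_BM n lam) (p * r') =
        laurent_eval (fam_shift family_BM n lam) p * laurent_eval (fam_shift family_BM n lam) r'"
      by (intro laurent_eval_mult mono_eval_add) (simp add: family_BM_def BM_nonzero)
    show "laurent_eval (fam_shift family_BM n lam) (fam_gen family_BM i) = ?m i (lam i) + inverse (?m i (lam i))"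
      "fam_norm1 family_BM (fam_shift family_BM n lam i) = ?m i (lam i) + inverse (?m i (lam i))"
      by (simp_all add: family_BM_def laurent_eval_add laurent_eval_var_power power_int_minus)
    show "Poly_Mapping.keys m \<subseteq> {1..n} \<and>
         (\<exists>k. Poly_Mapping.lookup p (expo (fam_degfac family_BM) n k) = Poly_Mapping.lookup p m \<and>
              (\<forall>i\<in>{1..n}. \<bar>Poly_Mapping.lookup m i\<bar> = int (fam_degfac family_BM * k i)))"
      if "p \<in> Lam family_BM n" "m \<in> Poly_Mapping.keys p"
      using BM_normal[of p n m] that by (simp add: Lam_def G) (simp add: family_BM_def)
    fix k
    show "to_ac (?m i k + inverse (?m i k)) =
       ?x (2 * int k) (2 * (int n - int i)) + 1 / ?x (2 * int k) (2 * (int n - int i))" if "i \<in> {1..n}"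
    proof -
      have "2 * int k = int (2 * k)" "2 * (int n - int i) = int (2 * (n - i))" using that by auto
      then have "?x (2 * int k) (2 * (int n - int i)) = to_ac (?m i k)"
        by (simp only: power_int_of_nat power_mult s r to_ac_mult to_ac_power)
      then show ?thesis by (simp only: to_ac_add to_ac_divide to_ac_1 inverse_eq_divide)
    qed
  qed auto
  then show ?thesis by blast
qed

text \<open>Along a chain the norm drops by exactly 1 in each step, so the numerator is 1 and the
  denominator for index \<open>j\<close> is the product of all \<open>i - j\<close>: the indices
  below \<open>j\<close> contribute \<open>j!\<close> with sign \<open>(-1)^j\<close>, those above
  contribute \<open>(k - j)!\<close>.\<close>

lemma wt_LR_AJ:
  assumes \<zeta>: "\<zeta> \<in> sat_chains n lam \<mu>" and k: "k = psize n lam - psize n \<mu>"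
  shows "wt_LR family_AJ n p \<zeta> = 1 / of_nat (fact k) *
     (\<Sum>j = 0..k. (- 1) ^ j * of_nat (k choose j) * laurent_eval (fam_shift family_AJ n (\<zeta> ! j)) p)"
proof -
  have len: "length \<zeta> - 1 = k" using sat_chains_length[OF \<zeta>] k by simp
  have norm: "chain_norm family_AJ n \<zeta> i - chain_norm family_AJ n \<zeta> j = of_int (int j - int i)"
    if "i \<le> k" "j \<le> k" for i j
  proof -
    have N: "chain_norm family_AJ n \<zeta> i = of_nat (psize n (\<zeta> ! i)) + (\<Sum>i\<in>{1..n}. of_nat (n - i) * AJ_tau)" for i
      by (simp add: chain_norm_def fam_norm_def family_AJ_def sum.distrib psize_def)
    have "psize n (\<zeta> ! i) + i = psize n (\<zeta> ! j) + j"
      using sat_chains_psize[OF \<zeta>, of i] sat_chains_psize[OF \<zeta>, of j] that sat_chains_length(1)[OF \<zeta>] k by simp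
    then have "int (psize n (\<zeta> ! i)) - int (psize n (\<zeta> ! j)) = int j - int i" by linarith
    then have "of_int (int (psize n (\<zeta> ! i)) - int (psize n (\<zeta> ! j))) = (of_int (int j - int i) :: ratfun1)" by simp
    then show ?thesis by (simp add: N)
  qed
  have den: "(\<Prod>i\<in>{0..k} - {j}. chain_norm family_AJ n \<zeta> j - chain_norm family_AJ n \<zeta> i) =
      (- 1) ^ j * of_nat (fact j * fact (k - j))" if "j \<le> k" for j
  proof -
    have "{0..k} - {j} = {..<j} \<union> {j<..k}" "{..<j} \<inter> {j<..k} = {}" using that by auto
    then have "(\<Prod>i\<in>{0..k} - {j}. chain_norm family_AJ n \<zeta> j - chain_norm family_AJ n \<zeta> i) =
       (\<Prod>i\<in>{..<j}. of_int (int i - int j)) * (\<Prod>i\<in>{j<..k}. of_int (int i - int j))"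
      using that by (simp add: prod.union_disjoint norm)
    also have "(\<Prod>i\<in>{..<j}. of_int (int i - int j)) = (- 1 :: ratfun1) ^ j * of_nat (fact j)"
    proof -
      have "(\<Prod>i\<in>{..<j}. of_int (int i - int j)) = (\<Prod>i\<in>{..<j}. - of_nat (j - i) :: ratfun1)"
        by (intro prod.cong refl) (simp add: of_nat_diff)
      also have "\<dots> = (- 1) ^ j * (\<Prod>i\<in>{..<j}. of_nat (j - i))" by (simp only: prod_uminus card_lessThan)
      also have "(\<Prod>i\<in>{..<j}. of_nat (j - i)) = (of_nat (fact j) :: ratfun1)"
        by (simp add: fact_prod_rev atLeast0LessThan)
      finally show ?thesis .
    qed
    also have "(\<Prod>i\<in>{j<..k}. of_int (int i - int j)) = (of_nat (fact (k - j)) :: ratfun1)"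
    proof -
      have "(\<Prod>i\<in>{j<..k}. of_int (int i - int j) :: ratfun1) = (\<Prod>i\<in>{1..k - j}. of_nat i)"
        by (rule prod.reindex_bij_witness[of _ "\<lambda>i. i + j" "\<lambda>i. i - j"]) (use that in \<open>auto simp: of_nat_diff\<close>)
      then show ?thesis by (simp add: fact_prod)
    qed
    finally show ?thesis by (simp add: mult.assoc)
  qed
  have num: "(\<Prod>i<k. chain_norm family_AJ n \<zeta> i - chain_norm family_AJ n \<zeta> (Suc i)) = 1"
    by (intro prod.neutral) (simp add: norm)
  have "1 / ((- 1) ^ j * of_nat (fact j * fact (k - j))) = 1 / of_nat (fact k) * ((- 1) ^ j * of_nat (k choose j) :: ratfun1)"
    if "j \<le> k" for j
  proof -
    have "of_nat (fact j * fact (k - j)) * of_nat (k choose j) = (of_nat (fact k) :: ratfun1)"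
      using binomial_fact_lemma[OF that] by (metis of_nat_mult)
    moreover have "of_nat (fact j * fact (k - j)) \<noteq> (0 :: ratfun1)" "of_nat (fact k) \<noteq> (0 :: ratfun1)" by simp_all
    moreover have "(- 1 :: ratfun1) ^ j * (- 1) ^ j = 1" by (simp flip: power_mult_distrib)
    ultimately show ?thesis
      by (simp only: divide_simps) (simp add: mult_ac)
  qed
  then show ?thesis
    unfolding wt_LR_def Let_def len num sum_distrib_left
    by (intro sum.cong refl) (simp add: den mult.assoc)
qed

section \<open>The formulas for one family and for all four\<close>

lemma (in interpolation_family) family_formulas:
  "\<forall>p\<in>Lam F n. \<forall>lam\<in>partitions n. \<forall>\<mu>\<in>partitions n.
       struct_coeff F n p lam \<mu> =
         (\<Sum>\<zeta>\<in>sat_chains n lam \<mu>. wt_LR F n p \<zeta> *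
            (\<Prod>i<psize n lam - psize n \<mu>. adj_binom F n (\<zeta> ! i) (\<zeta> ! Suc i)))"
  "\<forall>\<nu>\<in>partitions n. \<forall>lam\<in>partitions n. \<forall>\<mu>\<in>partitions n. \<forall>\<zeta>\<in>sat_chains n lam \<mu>.
       wt_LR F n (itp_poly F n \<nu>) \<zeta> = wt_LR_binom F n \<nu> \<zeta>"
  "itp_poly F n zero_partition = 1"
  "\<forall>p\<in>Lam F n.
       finite {lam \<in> partitions n. struct_coeff F n p lam zero_partition \<noteq> 0} \<and>
       p = (\<Sum>lam | lam \<in> partitions n \<and> struct_coeff F n p lam zero_partition \<noteq> 0.
              lconst (struct_coeff F n p lam zero_partition) * itp_poly F n lam) \<and>
       (\<forall>lam\<in>partitions n.
          struct_coeff F n p lam zero_partition =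
            (\<Sum>\<zeta>\<in>sat_chains n lam zero_partition. wt_LR F n p \<zeta> *
               (\<Prod>i<psize n lam. adj_binom F n (\<zeta> ! i) (\<zeta> ! Suc i))))"
  using struct_coeff_formula struct_coeff_formula[OF _ _ zero_partition(1)] itp_expansion h_zero_partition
  by (simp_all add: wt_LR_def wt_LR_binom_def binom_def zero_partition(2))

theorem corollary3p9:
  fixes n :: nat
  assumes "n \<ge> 1"
  shows "(\<forall>p\<in>Lam family_AJ n. \<forall>lam\<in>partitions n. \<forall>\<mu>\<in>partitions n.
       struct_coeff family_AJ n p lam \<mu> =
         (\<Sum>\<zeta>\<in>sat_chains n lam \<mu>. wt_LR family_AJ n p \<zeta> *
            (\<Prod>i<psize n lam - psize n \<mu>. adj_binom family_AJ n (\<zeta> ! i) (\<zeta> ! Suc i))))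
   \<and> (\<forall>\<nu>\<in>partitions n. \<forall>lam\<in>partitions n. \<forall>\<mu>\<in>partitions n. \<forall>\<zeta>\<in>sat_chains n lam \<mu>.
       wt_LR family_AJ n (itp_poly family_AJ n \<nu>) \<zeta> = wt_LR_binom family_AJ n \<nu> \<zeta>)
   \<and> (\<forall>p\<in>Lam family_AJ n. \<forall>lam\<in>partitions n. \<forall>\<mu>\<in>partitions n. \<forall>\<zeta>\<in>sat_chains n lam \<mu>.
       \<forall>k. k = psize n lam - psize n \<mu> \<longrightarrow>
       wt_LR family_AJ n p \<zeta> = 1 / of_nat (fact k) *
         (\<Sum>j = 0..k. (- 1) ^ j * of_nat (k choose j) * laurent_eval (fam_shift family_AJ n (\<zeta> ! j)) p))
   \<and> itp_poly family_AJ n zero_partition = 1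
   \<and> (\<forall>p\<in>Lam family_AJ n.
       finite {lam \<in> partitions n. struct_coeff family_AJ n p lam zero_partition \<noteq> 0} \<and>
       p = (\<Sum>lam | lam \<in> partitions n \<and> struct_coeff family_AJ n p lam zero_partition \<noteq> 0.
              lconst (struct_coeff family_AJ n p lam zero_partition) * itp_poly family_AJ n lam) \<and>
       (\<forall>lam\<in>partitions n.
          struct_coeff family_AJ n p lam zero_partition =
            (\<Sum>\<zeta>\<in>sat_chains n lam zero_partition. wt_LR family_AJ n p \<zeta> *
               (\<Prod>i<psize n lam. adj_binom family_AJ n (\<zeta> ! i) (\<zeta> ! Suc i)))))
   \<and> (\<forall>p\<in>Lam family_BJ n. \<forall>lam\<in>partitions n. \<forall>\<mu>\<in>partitions n.
       struct_coeff family_BJ n p lam \<mu> =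
         (\<Sum>\<zeta>\<in>sat_chains n lam \<mu>. wt_LR family_BJ n p \<zeta> *
            (\<Prod>i<psize n lam - psize n \<mu>. adj_binom family_BJ n (\<zeta> ! i) (\<zeta> ! Suc i))))
   \<and> (\<forall>\<nu>\<in>partitions n. \<forall>lam\<in>partitions n. \<forall>\<mu>\<in>partitions n. \<forall>\<zeta>\<in>sat_chains n lam \<mu>.
       wt_LR family_BJ n (itp_poly family_BJ n \<nu>) \<zeta> = wt_LR_binom family_BJ n \<nu> \<zeta>)
   \<and> itp_poly family_BJ n zero_partition = 1
   \<and> (\<forall>p\<in>Lam family_BJ n.
       finite {lam \<in> partitions n. struct_coeff family_BJ n p lam zero_partition \<noteq> 0} \<and>
       p = (\<Sum>lam | lam \<in> partitions n \<and> struct_coeff family_BJ n p lam zero_partition \<noteq> 0.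
              lconst (struct_coeff family_BJ n p lam zero_partition) * itp_poly family_BJ n lam) \<and>
       (\<forall>lam\<in>partitions n.
          struct_coeff family_BJ n p lam zero_partition =
            (\<Sum>\<zeta>\<in>sat_chains n lam zero_partition. wt_LR family_BJ n p \<zeta> *
               (\<Prod>i<psize n lam. adj_binom family_BJ n (\<zeta> ! i) (\<zeta> ! Suc i)))))
   \<and> (\<forall>p\<in>Lam family_AM n. \<forall>lam\<in>partitions n. \<forall>\<mu>\<in>partitions n.
       struct_coeff family_AM n p lam \<mu> =
         (\<Sum>\<zeta>\<in>sat_chains n lam \<mu>. wt_LR family_AM n p \<zeta> *
            (\<Prod>i<psize n lam - psize n \<mu>. adj_binom family_AM n (\<zeta> ! i) (\<zeta> ! Suc i))))
   \<and> (\<forall>\<nu>\<in>partitions n. \<forall>lam\<in>partitions n. \<forall>\<mu>\<in>partitions n. \<forall>\<zeta>\<in>sat_chains n lam \<mu>.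
       wt_LR family_AM n (itp_poly family_AM n \<nu>) \<zeta> = wt_LR_binom family_AM n \<nu> \<zeta>)
   \<and> itp_poly family_AM n zero_partition = 1
   \<and> (\<forall>p\<in>Lam family_AM n.
       finite {lam \<in> partitions n. struct_coeff family_AM n p lam zero_partition \<noteq> 0} \<and>
       p = (\<Sum>lam | lam \<in> partitions n \<and> struct_coeff family_AM n p lam zero_partition \<noteq> 0.
              lconst (struct_coeff family_AM n p lam zero_partition) * itp_poly family_AM n lam) \<and>
       (\<forall>lam\<in>partitions n.
          struct_coeff family_AM n p lam zero_partition =
            (\<Sum>\<zeta>\<in>sat_chains n lam zero_partition. wt_LR family_AM n p \<zeta> *
               (\<Prod>i<psize n lam. adj_binom family_AM n (\<zeta> ! i) (\<zeta> ! Suc i)))))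
   \<and> (\<forall>p\<in>Lam family_BM n. \<forall>lam\<in>partitions n. \<forall>\<mu>\<in>partitions n.
       struct_coeff family_BM n p lam \<mu> =
         (\<Sum>\<zeta>\<in>sat_chains n lam \<mu>. wt_LR family_BM n p \<zeta> *
            (\<Prod>i<psize n lam - psize n \<mu>. adj_binom family_BM n (\<zeta> ! i) (\<zeta> ! Suc i))))
   \<and> (\<forall>\<nu>\<in>partitions n. \<forall>lam\<in>partitions n. \<forall>\<mu>\<in>partitions n. \<forall>\<zeta>\<in>sat_chains n lam \<mu>.
       wt_LR family_BM n (itp_poly family_BM n \<nu>) \<zeta> = wt_LR_binom family_BM n \<nu> \<zeta>)
   \<and> itp_poly family_BM n zero_partition = 1
   \<and> (\<forall>p\<in>Lam family_BM n.
       finite {lam \<in> partitions n. struct_coeff family_BM n p lam zero_partition \<noteq> 0} \<and>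
       p = (\<Sum>lam | lam \<in> partitions n \<and> struct_coeff family_BM n p lam zero_partition \<noteq> 0.
              lconst (struct_coeff family_BM n p lam zero_partition) * itp_poly family_BM n lam) \<and>
       (\<forall>lam\<in>partitions n.
          struct_coeff family_BM n p lam zero_partition =
            (\<Sum>\<zeta>\<in>sat_chains n lam zero_partition. wt_LR family_BM n p \<zeta> *
               (\<Prod>i<psize n lam. adj_binom family_BM n (\<zeta> ! i) (\<zeta> ! Suc i)))))"
proof -
  note AJ = interpolation_family.family_formulas[OF interpolation_family_AJ, of n]
    and BJ = interpolation_family.family_formulas[OF interpolation_family_BJ, of n]
  obtain V w c0 c1 d0 d1 e q0 q1 q2 u \<iota> where
    "interpolation_family (V :: int \<Rightarrow> int \<Rightarrow> ratfun2 alg_closure) w c0 c1 d0 d1 e q0 q1 q2 family_AM n u \<iota>"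
    using interpolation_family_AM[of n] by (elim exE)
  note AM = interpolation_family.family_formulas[OF this]
  obtain V w c0 c1 d0 d1 e q0 q1 q2 u \<iota> where
    "interpolation_family (V :: int \<Rightarrow> int \<Rightarrow> ratfun3 alg_closure) w c0 c1 d0 d1 e q0 q1 q2 family_BM n u \<iota>"
    using interpolation_family_BM[of n] by (elim exE)
  note BM = interpolation_family.family_formulas[OF this]
  have wt_AJ: "\<forall>p\<in>Lam family_AJ n. \<forall>lam\<in>partitions n. \<forall>\<mu>\<in>partitions n. \<forall>\<zeta>\<in>sat_chains n lam \<mu>.
       \<forall>k. k = psize n lam - psize n \<mu> \<longrightarrow>
       wt_LR family_AJ n p \<zeta> = 1 / of_nat (fact k) *
         (\<Sum>j = 0..k. (- 1) ^ j * of_nat (k choose j) * laurent_eval (fam_shift family_AJ n (\<zeta> ! j)) p)"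
    by (intro ballI allI impI wt_LR_AJ)
  show ?thesis by (intro conjI AJ BJ AM BM wt_AJ)
qed

end
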